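(* For any integer $d\ge2$, the canonical embedding $i_d:H^1(\mathbb{T}^d)\to L_a^2(\mathbb{D}^d)$ satisfies $$\|i_d:H^1(\mathbb{T}^d)\to L_a^2(\mathbb{D}^d)\|_{cb}=\pi^{d/2}.$$
   Context: $\mathbb{T}^d$ carries normalized Haar measure; $H^1(\mathbb{T}^d)$ is the space of $f\in L^1(\mathbb{T}^d)$ whose Fourier coefficients vanish outside $\mathbb{N}^d$, $\mathbb{N}=\{0,1,2,\dots\}$. $\mathbb{D}$ is the open unit disk with normalized area measure $dA=\frac{dx\,dy}{\pi}$; $L_a^2(\mathbb{D}^d)$ is the Bergman space of holomorphic functions in $L^2(\mathbb{D}^d,dA^{\otimes d})$. The map $i_d$ sends $f=\sum_{\alpha\in\mathbb{N}^d}\widehat f(\alpha)e^{i\alpha\cdot\theta}$ to its holomorphic extension $\sum_{\alpha\in\mathbb{N}^d}\widehat f(\alpha)z^\alpha$. Operator space structures: $L^1(\mathbb{T}^d)$ has its structure as predual of the commutative $C^*$-algebra $L^\infty(\mathbb{T}^d)$, and $H^1(\mathbb{T}^d)$ is viewed as a subspace of it; $L^2(\mathbb{D}^d)$ has its natural structure, that of Pisier's operator Hilbert space $OH$ (i.e. $L^2=(L^\infty,L^1)_{1/2}$), and $L_a^2(\mathbb{D}^d)$ is viewed as a subspace of it. $OH$ is characterized by: for orthonormal vectors $v_i$ and finitely many elements $a_i$ of a $C^*$-algebra $A$, $\|\sum_iv_i\otimes a_i\|_{OH\otimes_{\min}A}=\|\sum_ia_i\otimes\overline a_i\|^{1/2}_{A\otimes_{\min}\overline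 A}$, where $\overline{A}$ is the complex conjugate $C^*$-algebra. *)

theory Defs
  imports "HOL-Analysis.Analysis"
begin

section \<open>Matrices and operator space structures\<close>

text \<open>Matrices are functions of two indices ranging over a finite set \<open>I\<close>; entries outside
  \<open>I\<close> are irrelevant. The norm is that of the operator on \<open>\<ell>\<^sup>2(I)\<close>.\<close>

definition mat_norm :: "'i set \<Rightarrow> ('i \<Rightarrow> 'i \<Rightarrow> complex) \<Rightarrow> real" where
  "mat_norm I A = (SUP x\<in>{x :: 'i \<Rightarrow> complex. L2_set (\<lambda>j. cmod (x j)) I \<le> 1}.
     L2_set (\<lambda>i. cmod (\<Sum>j\<in>I. A i j * x j)) I)"

text \<open>An operator space structure: the underlying space \<open>V\<close> and, for every \<open>n\<close>, the norm on
  \<open>M\<^sub>n(V)\<close>. Elements of function spaces are represented by functions rather than by classes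
  modulo null functions, so the values are seminorms; they are extended reals so that the
  suprema below always make sense.\<close>

record 'a op_space =
  elems :: "'a set"
  mnorm :: "nat \<Rightarrow> (nat \<Rightarrow> nat \<Rightarrow> 'a) \<Rightarrow> ennreal"

definition subspace_os :: "'a set \<Rightarrow> 'a op_space \<Rightarrow> 'a op_space" where
  "subspace_os S V = \<lparr>elems = S \<inter> elems V, mnorm = mnorm V\<rparr>"

definition cb_norm :: "'a op_space \<Rightarrow> 'b op_space \<Rightarrow> ('a \<Rightarrow> 'b) \<Rightarrow> ennreal" where
  "cb_norm V W u = (SUP n. SUP x\<in>{x. (\<forall>i<n. \<forall>j<n. x i j \<in> elems V) \<and> mnorm V n x \<le> 1}.
     mnorm W n (\<lambda>i j. u (x i j)))"

text \<open>The \<open>C\<^sup>*\<close>-algebra \<open>M\<^sub>k\<close>, with \<open>M\<^sub>n(M\<^sub>k) = M\<^sub>n\<^sub>k\<close>.\<close>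

definition matrix_os :: "nat \<Rightarrow> (nat \<Rightarrow> nat \<Rightarrow> complex) op_space" where
  "matrix_os k = \<lparr>elems = UNIV,
     mnorm = (\<lambda>n A. ennreal (mat_norm ({..<n} \<times> {..<k}) (\<lambda>(p, i) (q, j). A p q i j)))\<rparr>"

text \<open>The commutative \<open>C\<^sup>*\<close>-algebra \<open>L\<^sup>\<infinity>\<close>: the norm on \<open>M\<^sub>n(L\<^sup>\<infinity>) = L\<^sup>\<infinity>(M\<^sub>n)\<close> is the
  essential supremum of the pointwise matrix norm.\<close>

definition Linf_os :: "'a measure \<Rightarrow> ('a \<Rightarrow> complex) op_space" where
  "Linf_os M = \<lparr>elems = {g \<in> borel_measurable M. \<exists>c. AE t in M. cmod (g t) \<le> c},
     mnorm = (\<lambda>n g. INF c\<in>{c. 0 \<le> c \<and> (AE t in M. mat_norm {..<n} (\<lambda>i j. g i j t) \<le> c)}. ennreal c)\<rparr>"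

text \<open>\<open>L\<^sup>1\<close> as predual of \<open>L\<^sup>\<infinity>\<close>: the norm on \<open>M\<^sub>n(L\<^sup>1)\<close> is the one induced by
  \<open>M\<^sub>n((L\<^sup>\<infinity>)\<^sup>*) = CB(L\<^sup>\<infinity>, M\<^sub>n)\<close>, where \<open>[f\<^sub>i\<^sub>j]\<close> acts as \<open>g \<mapsto> [\<integral> f\<^sub>i\<^sub>j g]\<close>.\<close>

definition L1_os :: "'a measure \<Rightarrow> ('a \<Rightarrow> complex) op_space" where
  "L1_os M = \<lparr>elems = {f. integrable M f},
     mnorm = (\<lambda>n f. cb_norm (Linf_os M) (matrix_os n) (\<lambda>g i j. LINT t|M. f i j t * g t))\<rparr>"

definition L2_space :: "'a measure \<Rightarrow> ('a \<Rightarrow> complex) set" where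
  "L2_space M = {h \<in> borel_measurable M. integrable M (\<lambda>x. (cmod (h x))\<^sup>2)}"

text \<open>\<open>L\<^sup>2\<close> as operator Hilbert space \<open>OH\<close>. If \<open>h = \<Sum>\<^sub>k v\<^sub>k \<otimes> a\<^sub>k\<close> with \<open>v\<^sub>k\<close> orthonormal and
  \<open>a\<^sub>k \<in> M\<^sub>n\<close>, then the entry of \<open>\<Sum>\<^sub>k a\<^sub>k \<otimes> cnj a\<^sub>k\<close> in row \<open>(p, r)\<close> and column \<open>(q, s)\<close> is the
  inner product of \<open>h\<^sub>p\<^sub>q\<close> and \<open>h\<^sub>r\<^sub>s\<close>; see \<open>mnorm_L2_os_orthonormal\<close>.\<close>

definition L2_os :: "'a measure \<Rightarrow> ('a \<Rightarrow> complex) op_space" where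
  "L2_os M = \<lparr>elems = L2_space M,
     mnorm = (\<lambda>n h. ennreal (sqrt (mat_norm ({..<n} \<times> {..<n})
       (\<lambda>(p, r) (q, s). LINT x|M. h p q x * cnj (h r s x)))))\<rparr>"

lemma borel_measurable_cnj [measurable (raw)]:
  "f \<in> borel_measurable M \<Longrightarrow> (\<lambda>x. cnj (f x)) \<in> borel_measurable M"
  by (rule borel_measurable_continuous_on[where f = cnj]) (auto intro: continuous_intros)

lemma integrable_L2_mult_cnj:
  assumes "f \<in> L2_space M" "g \<in> L2_space M"
  shows "integrable M (\<lambda>x. f x * cnj (g x))"
proof (rule Bochner_Integration.integrable_bound)
  show "integrable M (\<lambda>x. (cmod (f x))\<^sup>2 + (cmod (g x))\<^sup>2)"
    using assms by (auto simp: L2_space_def)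
  have [measurable]: "f \<in> borel_measurable M" "g \<in> borel_measurable M"
    using assms by (auto simp: L2_space_def)
  show "(\<lambda>x. f x * cnj (g x)) \<in> borel_measurable M"
    by measurable
  have "a * b \<le> a\<^sup>2 + b\<^sup>2" if "0 \<le> a" "0 \<le> b" for a b :: real
    using sum_squares_bound[of a b] mult_nonneg_nonneg[OF that] by linarith
  then show "AE x in M. norm (f x * cnj (g x)) \<le> norm ((cmod (f x))\<^sup>2 + (cmod (g x))\<^sup>2)"
    by (simp add: norm_mult)
qed

lemma mat_norm_cong:
  assumes "\<And>i j. i \<in> I \<Longrightarrow> j \<in> I \<Longrightarrow> A i j = B i j"
  shows "mat_norm I A = mat_norm I B"
proof -
  have "(\<Sum>j\<in>I. A i j * x j) = (\<Sum>j\<in>I. B i j * x j)" if "i \<in> I" for i x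
    using assms that by (intro sum.cong) auto
  then show ?thesis
    unfolding mat_norm_def by (intro SUP_cong L2_set_cong) auto
qed

lemma mnorm_L2_os_orthonormal:
  fixes v :: "'k \<Rightarrow> 'a \<Rightarrow> complex" and a :: "'k \<Rightarrow> nat \<Rightarrow> nat \<Rightarrow> complex"
  assumes "finite K" and v: "\<And>k. k \<in> K \<Longrightarrow> v k \<in> L2_space M"
    and orth: "\<And>k l. k \<in> K \<Longrightarrow> l \<in> K \<Longrightarrow>
      (LINT x|M. v k x * cnj (v l x)) = (if k = l then 1 else 0)"
    and h: "\<And>p q. p < n \<Longrightarrow> q < n \<Longrightarrow> h p q \<in> L2_space M"
    and h_eq: "\<And>p q. p < n \<Longrightarrow> q < n \<Longrightarrow> AE x in M. h p q x = (\<Sum>k\<in>K. a k p q * v k x)"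
  shows "mnorm (L2_os M) n h = ennreal (sqrt (mat_norm ({..<n} \<times> {..<n})
     (\<lambda>(p, r) (q, s). \<Sum>k\<in>K. a k p q * cnj (a k r s))))"
proof -
  have "(LINT x|M. h p q x * cnj (h r s x)) = (\<Sum>k\<in>K. a k p q * cnj (a k r s))"
    if "p < n" "q < n" "r < n" "s < n" for p q r s
  proof -
    have [measurable]: "h p q \<in> borel_measurable M" "h r s \<in> borel_measurable M"
      using h that by (auto simp: L2_space_def)
    have [measurable]: "v k \<in> borel_measurable M" if "k \<in> K" for k
      using v that by (auto simp: L2_space_def)
    have "(LINT x|M. h p q x * cnj (h r s x)) =
        (LINT x|M. (\<Sum>k\<in>K. \<Sum>l\<in>K. a k p q * cnj (a l r s) * (v k x * cnj (v l x))))"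
    proof (rule integral_cong_AE)
      show "AE x in M. h p q x * cnj (h r s x) =
          (\<Sum>k\<in>K. \<Sum>l\<in>K. a k p q * cnj (a l r s) * (v k x * cnj (v l x)))"
        using h_eq[OF that(1,2)] h_eq[OF that(3,4)]
        by eventually_elim (simp add: cnj_sum sum_product mult_ac)
    qed measurable
    also have "\<dots> = (\<Sum>k\<in>K. \<Sum>l\<in>K. a k p q * cnj (a l r s) * (LINT x|M. v k x * cnj (v l x)))"
      using v by (simp add: Bochner_Integration.integral_sum integrable_L2_mult_cnj)
    also have "\<dots> = (\<Sum>k\<in>K. \<Sum>l\<in>K. if k = l then a k p q * cnj (a l r s) else 0)"
      by (intro sum.cong refl) (simp add: orth)
    also have "\<dots> = (\<Sum>k\<in>K. a k p q * cnj (a k r s))"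
      using \<open>finite K\<close> by (intro sum.cong refl) simp
    finally show ?thesis .
  qed
  then show ?thesis
    unfolding L2_os_def op_space.simps
    by (intro arg_cong[where f = ennreal] arg_cong[where f = sqrt] mat_norm_cong) auto
qed


section \<open>Hardy and Bergman spaces\<close>

text \<open>Points of the torus and of the polydisc are functions on \<open>{..<d}\<close>, extended by
  \<open>undefined\<close>; both measures below live on exactly these sets.\<close>

definition circle_measure :: "complex measure" where
  "circle_measure = distr (uniform_measure lborel {0..<2 * pi}) (restrict_space borel (sphere 0 1)) cis"

definition torus_measure :: "nat \<Rightarrow> (nat \<Rightarrow> complex) measure" where
  "torus_measure d = PiM {..<d} (\<lambda>_. circle_measure)"

definition disk_measure :: "complex measure" where
  "disk_measure = scale_measure (ennreal (1 / pi)) (restrict_space lborel (ball 0 1))"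

definition polydisc :: "nat \<Rightarrow> (nat \<Rightarrow> complex) set" where
  "polydisc d = {..<d} \<rightarrow>\<^sub>E ball 0 1"

definition polydisc_measure :: "nat \<Rightarrow> (nat \<Rightarrow> complex) measure" where
  "polydisc_measure d = PiM {..<d} (\<lambda>_. disk_measure)"

definition fourier_coeff :: "nat \<Rightarrow> ((nat \<Rightarrow> complex) \<Rightarrow> complex) \<Rightarrow> (nat \<Rightarrow> int) \<Rightarrow> complex" where
  "fourier_coeff d f \<alpha> = (LINT t|torus_measure d. f t * cnj (\<Prod>j<d. t j powi \<alpha> j))"

definition hardy1 :: "nat \<Rightarrow> ((nat \<Rightarrow> complex) \<Rightarrow> complex) set" where
  "hardy1 d = {f. integrable (torus_measure d) f \<and>
     (\<forall>\<alpha>. (\<exists>j<d. \<alpha> j < 0) \<longrightarrow> fourier_coeff d f \<alpha> = 0)}"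

definition hardy1_os :: "nat \<Rightarrow> ((nat \<Rightarrow> complex) \<Rightarrow> complex) op_space" where
  "hardy1_os d = subspace_os (hardy1 d) (L1_os (torus_measure d))"

text \<open>Holomorphy in several variables: continuous and holomorphic in each variable separately.\<close>

definition holomorphic_on_polydisc :: "nat \<Rightarrow> ((nat \<Rightarrow> complex) \<Rightarrow> complex) \<Rightarrow> bool" where
  "holomorphic_on_polydisc d h \<longleftrightarrow> continuous_on (polydisc d) h \<and>
     (\<forall>z\<in>polydisc d. \<forall>j<d. (\<lambda>w. h (z(j := w))) holomorphic_on ball 0 1)"

definition bergman2 :: "nat \<Rightarrow> ((nat \<Rightarrow> complex) \<Rightarrow> complex) set" where
  "bergman2 d = {h \<in> L2_space (polydisc_measure d). holomorphic_on_polydisc d h}"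

definition bergman2_os :: "nat \<Rightarrow> ((nat \<Rightarrow> complex) \<Rightarrow> complex) op_space" where
  "bergman2_os d = subspace_os (bergman2 d) (L2_os (polydisc_measure d))"

text \<open>The map \<open>i\<^sub>d\<close>. The multi-indices range over \<open>\<nat>\<^sup>d\<close>, represented as functions on \<open>{..<d}\<close>.\<close>

definition hol_ext :: "nat \<Rightarrow> ((nat \<Rightarrow> complex) \<Rightarrow> complex) \<Rightarrow> (nat \<Rightarrow> complex) \<Rightarrow> complex" where
  "hol_ext d f z = (\<Sum>\<^sub>\<infinity>\<alpha>\<in>{..<d} \<rightarrow>\<^sub>E (UNIV :: nat set).
     fourier_coeff d f (\<lambda>j. int (\<alpha> j)) * (\<Prod>j<d. z j ^ \<alpha> j))"

end

theory Submission
  imports Defs "HOL-Complex_Analysis.Complex_Analysis"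
begin

text \<open>
  Since the norm of \<open>M\<^sub>n(OH)\<close> only depends on inner products, the square of the completely bounded
  norm of \<open>i\<^sub>d\<close> is governed by the sesquilinear form
  \<open>(f, g) \<mapsto> \<langle>i\<^sub>d f, i\<^sub>d g\<rangle> = \<Sum>\<^sub>\<alpha> a\<^sub>\<alpha> cnj (b\<^sub>\<alpha>) \<Prod>\<^sub>j 1/(\<alpha>\<^sub>j + 1)\<close> on the Hardy space, where \<open>a\<^sub>\<alpha>\<close> and \<open>b\<^sub>\<alpha>\<close>
  are the Fourier coefficients of \<open>f\<close> and \<open>g\<close>. The constant \<open>\<pi>\<close> per variable is the norm of the Hilbert matrix \<open>[1/(i + j + 1)]\<close>.

  Upper bound. As \<open>f\<close> and \<open>g\<close> have no Fourier coefficients outside \<open>\<nat>\<^sup>d\<close>, the weights at the other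
  frequencies may be chosen freely. With the weight \<open>1/(n + 1)\<close> for all integers \<open>n \<noteq> -1\<close> and \<open>0\<close> for
  \<open>n = -1\<close> one obtains the Fourier coefficients of Hilbert's symbol, a function on the circle of
  modulus at most \<open>\<pi>\<close>. Hence the form is integration of \<open>f(s) cnj (g(t))\<close> against a kernel on
  the product of two tori that is bounded by \<open>\<pi>\<^sup>d\<close>. A matrix \<open>f\<close> in the unit ball of \<open>M\<^sub>n(L\<^sup>1)\<close> is
  a complete contraction \<open>L\<^sup>\<infinity> \<rightarrow> M\<^sub>n\<close>; applying it in the variable \<open>s\<close> to the kernel and then, on the
  level \<open>n\<close>, in the variable \<open>t\<close> to the result bounds the matrix \<open>[\<langle>i\<^sub>d f\<^sub>p\<^sub>q, i\<^sub>d f\<^sub>r\<^sub>s\<rangle>]\<close> by \<open>\<pi>\<^sup>d\<close>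
  (\<open>torus_form_matrix_bound\<close>). To keep every series absolutely convergent, the area integrals are
  first taken over the polydisc of radius \<open>\<rho> < 1\<close>; this replaces the symbol by its analogue with the
  coefficients damped by powers of \<open>r = \<rho>\<^sup>2\<close>, which is an explicit logarithm with the same bound
  (\<open>norm_hilbert_kernel\<close>). The two expansions meet in \<open>hol_ext_form_eq\<close>.

  Lower bound. The matrix \<open>[z\<^sup>k\<^sup>+\<^sup>l]\<close>, indexed by multi-indices \<open>k, l\<close>, has norm at most \<open>1\<close> in
  \<open>M\<^sub>n(L\<^sup>1)\<close>, because it is a compression of the multiplication representation of \<open>L\<^sup>\<infinity>\<close> on \<open>L\<^sup>2\<close>
  (\<open>hankel_contraction\<close>). On vectors supported on the diagonal, the matrix of its inner products acts
  as the \<open>d\<close>-fold tensor power of a finite section of the Hilbert matrix. That the norms of these sections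
  tend to \<open>\<pi>\<close> is seen with the Taylor coefficients of \<open>(1 - x)\<^sup>-\<^sup>1\<^sup>/\<^sup>2\<close> as test vectors
  (\<open>hilbert_matrix_lower_bound\<close>).
\<close>

section \<open>Matrix norms and the norms of \<open>L\<^sup>1\<close> and \<open>L\<^sup>\<infinity>\<close>\<close>

lemma mat_vec_bound:
  assumes "finite I" "L2_set (\<lambda>j. cmod (x j)) I \<le> 1"
  shows "L2_set (\<lambda>i. cmod (\<Sum>j\<in>I. A i j * x j)) I
    \<le> L2_set (\<lambda>i. L2_set (\<lambda>j. cmod (A i j)) I) I"
proof (rule L2_set_mono)
  fix i
  have "cmod (\<Sum>j\<in>I. A i j * x j) \<le> (\<Sum>j\<in>I. \<bar>cmod (A i j)\<bar> * \<bar>cmod (x j)\<bar>)"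
    by (rule order_trans[OF norm_sum]) (simp add: norm_mult)
  also have "\<dots> \<le> L2_set (\<lambda>j. cmod (A i j)) I * L2_set (\<lambda>j. cmod (x j)) I"
    by (rule L2_set_mult_ineq)
  also have "\<dots> \<le> L2_set (\<lambda>j. cmod (A i j)) I * 1"
    by (intro mult_left_mono assms) simp
  finally show "cmod (\<Sum>j\<in>I. A i j * x j) \<le> L2_set (\<lambda>j. cmod (A i j)) I"
    by simp
qed simp

lemma mat_norm_upper:
  assumes "finite I" "L2_set (\<lambda>j. cmod (x j)) I \<le> 1"
  shows "L2_set (\<lambda>i. cmod (\<Sum>j\<in>I. A i j * x j)) I \<le> mat_norm I A"
  unfolding mat_norm_def
proof (rule cSUP_upper)
  show "bdd_above ((\<lambda>x. L2_set (\<lambda>i. cmod (\<Sum>j\<in>I. A i j * x j)) I) ` {x. L2_set (\<lambda>j. cmod (x j)) I \<le> 1})"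
    using mat_vec_bound[OF assms(1)] by (intro bdd_aboveI2) auto
qed (use assms in auto)

lemma mat_norm_leI:
  assumes "\<And>x. L2_set (\<lambda>j. cmod (x j)) I \<le> 1 \<Longrightarrow>
    L2_set (\<lambda>i. cmod (\<Sum>j\<in>I. A i j * x j)) I \<le> c"
  shows "mat_norm I A \<le> c"
  unfolding mat_norm_def
proof (rule cSUP_least)
  have "(\<lambda>_. 0) \<in> {x :: 'a \<Rightarrow> complex. L2_set (\<lambda>j. cmod (x j)) I \<le> 1}"
    by (simp add: L2_set_def)
  then show "{x :: 'a \<Rightarrow> complex. L2_set (\<lambda>j. cmod (x j)) I \<le> 1} \<noteq> {}" by (metis empty_iff)
next
  fix x :: "'a \<Rightarrow> complex" assume "x \<in> {x. L2_set (\<lambda>j. cmod (x j)) I \<le> 1}"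
  then show "L2_set (\<lambda>i. cmod (\<Sum>j\<in>I. A i j * x j)) I \<le> c"
    by (intro assms) simp
qed

lemma L2_set_cmod_divide:
  assumes "N > 0"
  shows "L2_set (\<lambda>i. cmod (v i / complex_of_real N)) I = L2_set (\<lambda>i. cmod (v i)) I / N"
proof -
  have "cmod (v i / complex_of_real N) = inverse N * cmod (v i)" for i
    using assms by (simp add: norm_divide divide_inverse norm_mult norm_inverse mult.commute)
  then have "L2_set (\<lambda>i. cmod (v i / complex_of_real N)) I = L2_set (\<lambda>i. inverse N * cmod (v i)) I"
    by (simp only:)
  also have "\<dots> = inverse N * L2_set (\<lambda>i. cmod (v i)) I"
    using assms by (intro L2_set_right_distrib[symmetric]) simp
  finally show ?thesis
    by (simp only: divide_inverse mult.commute)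
qed

lemma mat_norm_vec:
  assumes "finite I"
  shows "L2_set (\<lambda>i. cmod (\<Sum>j\<in>I. A i j * x j)) I \<le> mat_norm I A * L2_set (\<lambda>j. cmod (x j)) I"
proof (cases "L2_set (\<lambda>j. cmod (x j)) I = 0")
  case True
  then have "\<forall>j\<in>I. x j = 0"
    using assms by (simp add: L2_set_eq_0_iff)
  then show ?thesis
    using True by (simp add: L2_set_def)
next
  case False
  define N where "N = L2_set (\<lambda>j. cmod (x j)) I"
  have N: "N > 0"
    using False L2_set_nonneg[of "\<lambda>j. cmod (x j)" I] unfolding N_def by linarith
  have 1: "L2_set (\<lambda>j. cmod (x j / of_real N)) I = 1"
    using N by (subst L2_set_cmod_divide) (simp_all flip: N_def)
  have "(\<Sum>j\<in>I. A i j * (x j / of_real N)) = (\<Sum>j\<in>I. A i j * x j) / of_real N" for i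
    by (simp add: sum_divide_distrib)
  then have "L2_set (\<lambda>i. cmod (\<Sum>j\<in>I. A i j * (x j / of_real N))) I =
      L2_set (\<lambda>i. cmod (\<Sum>j\<in>I. A i j * x j)) I / N"
    using L2_set_cmod_divide[OF N, of "\<lambda>i. \<Sum>j\<in>I. A i j * x j"] by (simp only:)
  moreover have "L2_set (\<lambda>i. cmod (\<Sum>j\<in>I. A i j * (x j / of_real N))) I \<le> mat_norm I A"
    using 1 by (intro mat_norm_upper assms) simp
  ultimately show ?thesis
    using N by (simp add: pos_divide_le_eq flip: N_def)
qed

text \<open>The Cauchy-Schwarz inequality; \<open>mat_norm_leI_bilinear\<close> is the converse, so that operator norms can be
  estimated through bilinear forms.\<close>

lemma mat_norm_bilinear:
  assumes "finite I"
  shows "cmod (\<Sum>i\<in>I. \<Sum>j\<in>I. y i * A i j * x j)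
    \<le> mat_norm I A * L2_set (\<lambda>j. cmod (x j)) I * L2_set (\<lambda>i. cmod (y i)) I"
proof -
  have "cmod (\<Sum>i\<in>I. \<Sum>j\<in>I. y i * A i j * x j) = cmod (\<Sum>i\<in>I. y i * (\<Sum>j\<in>I. A i j * x j))"
    by (simp add: sum_distrib_left mult.assoc)
  also have "\<dots> \<le> (\<Sum>i\<in>I. \<bar>cmod (y i)\<bar> * \<bar>cmod (\<Sum>j\<in>I. A i j * x j)\<bar>)"
    by (rule order_trans[OF norm_sum]) (simp add: norm_mult)
  also have "\<dots> \<le> L2_set (\<lambda>i. cmod (y i)) I * L2_set (\<lambda>i. cmod (\<Sum>j\<in>I. A i j * x j)) I"
    by (rule L2_set_mult_ineq)
  also have "\<dots> \<le> L2_set (\<lambda>i. cmod (y i)) I * (mat_norm I A * L2_set (\<lambda>j. cmod (x j)) I)"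
    by (intro mult_left_mono mat_norm_vec assms) simp
  finally show ?thesis by (simp add: mult_ac)
qed

lemma mat_norm_leI_bilinear:
  assumes "finite I" "0 \<le> c"
    and le: "\<And>x y. L2_set (\<lambda>j. cmod (x j)) I \<le> 1 \<Longrightarrow> L2_set (\<lambda>i. cmod (y i)) I \<le> 1 \<Longrightarrow>
      cmod (\<Sum>i\<in>I. \<Sum>j\<in>I. y i * A i j * x j) \<le> c"
  shows "mat_norm I A \<le> c"
proof (rule mat_norm_leI)
  fix x :: "'a \<Rightarrow> complex" assume x: "L2_set (\<lambda>j. cmod (x j)) I \<le> 1"
  define v where "v i = (\<Sum>j\<in>I. A i j * x j)" for i
  define N where "N = L2_set (\<lambda>i. cmod (v i)) I"
  have "N \<le> c"
  proof (cases "N = 0")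
    case False
    then have N: "N > 0"
      using L2_set_nonneg[of "\<lambda>i. cmod (v i)" I] unfolding N_def by linarith
    define y where "y i = cnj (v i) / of_real N" for i
    have "L2_set (\<lambda>i. cmod (cnj (v i) / of_real N)) I = 1"
      using N by (subst L2_set_cmod_divide) (simp_all flip: N_def)
    then have "L2_set (\<lambda>i. cmod (y i)) I = 1"
      by (simp only: y_def)
    then have "cmod (\<Sum>i\<in>I. \<Sum>j\<in>I. y i * A i j * x j) \<le> c"
      using x by (intro le) auto
    also have "(\<Sum>i\<in>I. \<Sum>j\<in>I. y i * A i j * x j) = (\<Sum>i\<in>I. y i * v i)"
      by (simp add: sum_distrib_left mult.assoc v_def)
    also have "\<dots> = (\<Sum>i\<in>I. of_real ((cmod (v i))\<^sup>2 / N))"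
    proof (rule sum.cong)
      fix i
      show "y i * v i = of_real ((cmod (v i))\<^sup>2 / N)"
        unfolding y_def of_real_divide complex_norm_square by simp
    qed simp
    also have "\<dots> = of_real ((\<Sum>i\<in>I. (cmod (v i))\<^sup>2) / N)"
      by (simp add: sum_divide_distrib)
    also have "(\<Sum>i\<in>I. (cmod (v i))\<^sup>2) = N\<^sup>2"
      by (simp add: N_def L2_set_def sum_nonneg)
    also have "N\<^sup>2 / N = N" by (simp add: power2_eq_square)
    finally show ?thesis using N by simp
  qed (use assms in simp)
  then show "L2_set (\<lambda>i. cmod (\<Sum>j\<in>I. A i j * x j)) I \<le> c"
    by (simp add: N_def v_def)
qed

lemma mat_norm_cnj:
  assumes "finite I"
  shows "mat_norm I (\<lambda>i j. cnj (A i j)) \<le> mat_norm I A"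
proof (rule mat_norm_leI)
  fix x :: "'a \<Rightarrow> complex" assume "L2_set (\<lambda>j. cmod (x j)) I \<le> 1"
  then have "L2_set (\<lambda>i. cmod (\<Sum>j\<in>I. A i j * cnj (x j))) I \<le> mat_norm I A"
    by (intro mat_norm_upper assms) simp
  moreover have "cmod (\<Sum>j\<in>I. cnj (A i j) * x j) = cmod (\<Sum>j\<in>I. A i j * cnj (x j))" for i
    by (subst complex_mod_cnj[symmetric]) (simp add: cnj_sum)
  ultimately show "L2_set (\<lambda>i. cmod (\<Sum>j\<in>I. cnj (A i j) * x j)) I \<le> mat_norm I A"
    by simp
qed

lemma mat_norm_tendsto_le:
  assumes "finite I"
    and lim: "\<And>i j. i \<in> I \<Longrightarrow> j \<in> I \<Longrightarrow> (\<lambda>k. A k i j) \<longlonglongrightarrow> B i j"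
    and le: "\<And>k :: nat. mat_norm I (A k) \<le> c"
  shows "mat_norm I B \<le> c"
proof (rule mat_norm_leI)
  fix x :: "'a \<Rightarrow> complex" assume x: "L2_set (\<lambda>j. cmod (x j)) I \<le> 1"
  have "(\<lambda>k. L2_set (\<lambda>i. cmod (\<Sum>j\<in>I. A k i j * x j)) I) \<longlonglongrightarrow>
      L2_set (\<lambda>i. cmod (\<Sum>j\<in>I. B i j * x j)) I"
    unfolding L2_set_def using lim by (intro tendsto_intros) auto
  moreover have "L2_set (\<lambda>i. cmod (\<Sum>j\<in>I. A k i j * x j)) I \<le> c" for k
    using mat_norm_upper[OF assms(1) x] le order_trans by blast
  ultimately show "L2_set (\<lambda>i. cmod (\<Sum>j\<in>I. B i j * x j)) I \<le> c"
    by (intro LIMSEQ_le_const2[where a = c]) auto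
qed

lemma mat_norm_scale:
  assumes "finite I" "0 \<le> c"
  shows "mat_norm I (\<lambda>i j. of_real c * A i j) \<le> c * mat_norm I A"
proof (rule mat_norm_leI)
  fix x :: "'a \<Rightarrow> complex" assume x: "L2_set (\<lambda>j. cmod (x j)) I \<le> 1"
  have "cmod (\<Sum>j\<in>I. of_real c * A i j * x j) = c * cmod (\<Sum>j\<in>I. A i j * x j)" for i
    using assms(2) by (simp add: mult.assoc norm_mult flip: sum_distrib_left)
  then have "L2_set (\<lambda>i. cmod (\<Sum>j\<in>I. of_real c * A i j * x j)) I = c * L2_set (\<lambda>i. cmod (\<Sum>j\<in>I. A i j * x j)) I"
    using L2_set_right_distrib[OF assms(2), of "\<lambda>i. cmod (\<Sum>j\<in>I. A i j * x j)" I] by (simp only:)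
  also have "\<dots> \<le> c * mat_norm I A"
    by (intro mult_left_mono mat_norm_upper assms x)
  finally show "L2_set (\<lambda>i. cmod (\<Sum>j\<in>I. of_real c * A i j * x j)) I \<le> c * mat_norm I A" .
qed

lemma sum_one_times:
  fixes h :: "'a \<Rightarrow> 'b::comm_monoid_add"
  shows "(\<Sum>u\<in>{..<1::nat} \<times> I. h (snd u)) = (\<Sum>i\<in>I. h i)"
  by (rule sum.reindex_bij_witness[where i = "\<lambda>i. (0, i)" and j = snd]) auto

text \<open>Identifies \<open>M\<^sub>n\<close> with \<open>M\<^sub>1(M\<^sub>n)\<close>; at level \<open>1\<close> the completely bounded norm of a map into \<open>M\<^sub>n\<close> is
  expressed through the latter form of the norm.\<close>

lemma mat_norm_one_times:
  assumes "finite I"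
  shows "mat_norm I A \<le> mat_norm ({..<1::nat} \<times> I) (\<lambda>(p, i) (q, j). A i j)"
proof (rule mat_norm_leI)
  have L2: "L2_set (\<lambda>u. h (snd u)) ({..<1::nat} \<times> I) = L2_set h I" for h
    unfolding L2_set_def by (simp only: sum_one_times[of "\<lambda>i. (h i)\<^sup>2"])
  fix x :: "'a \<Rightarrow> complex" assume x: "L2_set (\<lambda>j. cmod (x j)) I \<le> 1"
  have "L2_set (\<lambda>u. cmod (\<Sum>v\<in>{..<1::nat} \<times> I. (\<lambda>(p, i) (q, j). A i j) u v * x (snd v))) ({..<1::nat} \<times> I)
      \<le> mat_norm ({..<1::nat} \<times> I) (\<lambda>(p, i) (q, j). A i j)"
    using x L2[of "\<lambda>j. cmod (x j)"] assms by (intro mat_norm_upper) auto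
  moreover have "(\<Sum>v\<in>{..<1::nat} \<times> I. (\<lambda>(p, i) (q, j). A i j) u v * x (snd v)) = (\<Sum>j\<in>I. A (snd u) j * x j)" for u :: "nat \<times> 'a"
    unfolding case_prod_unfold by (rule sum_one_times)
  ultimately show "L2_set (\<lambda>i. cmod (\<Sum>j\<in>I. A i j * x j)) I \<le> mat_norm ({..<1::nat} \<times> I) (\<lambda>(p, i) (q, j). A i j)"
    using L2[of "\<lambda>i. cmod (\<Sum>j\<in>I. A i j * x j)"] by simp
qed

lemma mat_norm_singleton: "mat_norm {..<1::nat} (\<lambda>i j. c) \<le> cmod c"
proof (rule mat_norm_leI)
  fix x :: "nat \<Rightarrow> complex" assume "L2_set (\<lambda>j. cmod (x j)) {..<1} \<le> 1"
  then have "cmod (x 0) \<le> 1" by (simp add: L2_set_def lessThan_Suc)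
  then have "cmod c * cmod (x 0) \<le> cmod c" by (intro mult_left_le) auto
  then show "L2_set (\<lambda>i. cmod (\<Sum>j\<in>{..<1}. c * x j)) {..<1::nat} \<le> cmod c"
    by (simp add: L2_set_def lessThan_Suc norm_mult)
qed

lemma L1_contraction_iff:
  "mnorm (L1_os M) n f \<le> 1 \<longleftrightarrow>
    (\<forall>m g. (\<forall>p<m. \<forall>q<m. g p q \<in> elems (Linf_os M)) \<longrightarrow> mnorm (Linf_os M) m g \<le> 1 \<longrightarrow>
      mat_norm ({..<m} \<times> {..<n}) (\<lambda>(p, i) (q, j). LINT t|M. f i j t * g p q t) \<le> 1)"
  unfolding L1_os_def cb_norm_def matrix_os_def op_space.simps SUP_le_iff ennreal_le_1
  by blast

text \<open>The unit ball of \<open>M\<^sub>n(L\<^sup>1)\<close> consists of the complete contractions from \<open>L\<^sup>\<infinity>\<close> into \<open>M\<^sub>n\<close>. This is the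
  only way in which the operator space structure of \<open>L\<^sup>1\<close> enters the upper bound.\<close>

lemma L1_contractionD:
  assumes "mnorm (L1_os M) n f \<le> 1"
    and "\<And>p q. p < m \<Longrightarrow> q < m \<Longrightarrow> g p q \<in> elems (Linf_os M)" "mnorm (Linf_os M) m g \<le> 1"
  shows "mat_norm ({..<m} \<times> {..<n}) (\<lambda>(p, i) (q, j). LINT t|M. f i j t * g p q t) \<le> 1"
  using assms unfolding L1_contraction_iff by blast

lemma Linf_mnorm_leI:
  assumes "AE t in M. mat_norm {..<n} (\<lambda>i j. g i j t) \<le> c" "0 \<le> c"
  shows "mnorm (Linf_os M) n g \<le> ennreal c"
  unfolding Linf_os_def op_space.simps using assms by (intro INF_lower) simp

text \<open>The norm is an infimum of essential bounds, so a strictly larger constant gives an essential bound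
  without discussing whether the infimum is attained.\<close>

lemma Linf_mnorm_leD:
  assumes "mnorm (Linf_os M) n g \<le> 1" "1 < c"
  shows "AE t in M. mat_norm {..<n} (\<lambda>i j. g i j t) \<le> c"
proof -
  have "1 < ennreal c"
    using assms(2) ennreal_less_iff[of 1 c] by simp
  with assms(1) have "mnorm (Linf_os M) n g < ennreal c"
    by (rule le_less_trans)
  then have "(INF c\<in>{c. 0 \<le> c \<and> (AE t in M. mat_norm {..<n} (\<lambda>i j. g i j t) \<le> c)}. ennreal c) < ennreal c"
    unfolding Linf_os_def by simp
  then obtain c' where c': "0 \<le> c'" "AE t in M. mat_norm {..<n} (\<lambda>i j. g i j t) \<le> c'" "ennreal c' < ennreal c"
    by (auto simp: INF_less_iff)
  then have "c' \<le> c"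
    using assms by (auto simp: ennreal_less_iff)
  show ?thesis
    by (rule eventually_mono[OF c'(2)]) (use \<open>c' \<le> c\<close> in linarith)
qed

section \<open>Infinite sums, products and integrals\<close>

text \<open>Dominated convergence for unordered sums: integrating the tail estimate for \<open>b\<close> bounds the error of every
  finite partial sum by the corresponding tail times the integral of \<open>w\<close>.\<close>

lemma has_sum_integral:
  fixes F :: "'i \<Rightarrow> 'a \<Rightarrow> complex"
  assumes F: "\<And>i. i \<in> A \<Longrightarrow> F i \<in> borel_measurable M"
    and S: "S \<in> borel_measurable M"
    and w: "integrable M w" and b: "b summable_on A"
    and bound: "\<And>i t. i \<in> A \<Longrightarrow> t \<in> space M \<Longrightarrow> norm (F i t) \<le> b i * w t"
    and sum: "\<And>t. t \<in> space M \<Longrightarrow> ((\<lambda>i. F i t) has_sum S t) A"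
  shows "integrable M S" "((\<lambda>i. LINT t|M. F i t) has_sum (LINT t|M. S t)) A"
proof -
  obtain T where T: "(b has_sum T) A"
    using b by (auto simp: summable_on_def)
  have tail: "norm (S t - (\<Sum>i\<in>B. F i t)) \<le> (T - sum b B) * w t"
    if "finite B" "B \<subseteq> A" "t \<in> space M" for B t
  proof (rule norm_infsum_le[where f = "\<lambda>i. F i t" and g = "\<lambda>i. b i * w t" and X = "A - B"])
    show "((\<lambda>i. F i t) has_sum S t - (\<Sum>i\<in>B. F i t)) (A - B)"
      using that sum by (intro has_sum_Diff has_sum_finite) auto
    have "(b has_sum T - sum b B) (A - B)"
      using that T by (intro has_sum_Diff has_sum_finite) auto
    then show "((\<lambda>i. b i * w t) has_sum (T - sum b B) * w t) (A - B)"
      by (rule has_sum_cmult_left)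
  qed (use bound that in auto)
  have iF: "integrable M (F i)" if "i \<in> A" for i
  proof (rule Bochner_Integration.integrable_bound)
    show "integrable M (\<lambda>t. b i * w t)" using w by simp
    show "AE t in M. norm (F i t) \<le> norm (b i * w t)"
      using bound[OF that] by (intro AE_I2) (smt (verit) real_norm_def)
  qed (use F that in auto)
  show iS: "integrable M S"
  proof (rule Bochner_Integration.integrable_bound)
    show "integrable M (\<lambda>t. T * w t)" using w by simp
    show "AE t in M. norm (S t) \<le> norm (T * w t)"
      using tail[of "{}"] by (intro AE_I2) (force simp: abs_le_iff)
  qed (use S in auto)
  have *: "norm ((\<Sum>i\<in>B. LINT t|M. F i t) - (LINT t|M. S t)) \<le> (T - sum b B) * (LINT t|M. w t)"
    if "finite B" "B \<subseteq> A" for B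
  proof -
    have "(\<Sum>i\<in>B. LINT t|M. F i t) - (LINT t|M. S t) = - (LINT t|M. S t - (\<Sum>i\<in>B. F i t))"
      using that iF iS
      by (subst Bochner_Integration.integral_diff)
         (auto simp: subset_iff Bochner_Integration.integral_sum intro!: Bochner_Integration.integrable_sum)
    also have "norm \<dots> \<le> (LINT t|M. norm (S t - (\<Sum>i\<in>B. F i t)))"
      by (simp only: norm_minus_cancel integral_norm_bound)
    also have "\<dots> \<le> (LINT t|M. (T - sum b B) * w t)"
      using that iF iS w tail
      by (intro integral_mono)
         (auto simp: subset_iff intro!: integrable_norm Bochner_Integration.integrable_diff Bochner_Integration.integrable_sum)
    finally show ?thesis by simp
  qed
  have "((\<lambda>B. (T - sum b B) * (LINT t|M. w t)) \<longlongrightarrow> (T - T) * (LINT t|M. w t)) (finite_subsets_at_top A)"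
    using T unfolding has_sum_def by (intro tendsto_intros)
  then have "((\<lambda>B. (T - sum b B) * (LINT t|M. w t)) \<longlongrightarrow> 0) (finite_subsets_at_top A)"
    by simp
  with eventually_finite_subsets_at_top_weakI[OF *]
  have "((\<lambda>B. (\<Sum>i\<in>B. LINT t|M. F i t) - (LINT t|M. S t)) \<longlongrightarrow> 0) (finite_subsets_at_top A)"
    by (rule Lim_null_comparison)
  then show "((\<lambda>i. LINT t|M. F i t) has_sum (LINT t|M. S t)) A"
    unfolding has_sum_def by (rule LIM_zero_cancel)
qed

lemma has_sum_prod_PiE:
  fixes f :: "'i \<Rightarrow> 'b \<Rightarrow> complex"
  assumes "finite I" and "\<And>i. i \<in> I \<Longrightarrow> countable (B i)"
    and sum: "\<And>i. i \<in> I \<Longrightarrow> (f i has_sum s i) (B i)"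
  shows "((\<lambda>g. \<Prod>i\<in>I. f i (g i)) has_sum (\<Prod>i\<in>I. s i)) (PiE I B)"
    and "(\<lambda>g. \<Prod>i\<in>I. cmod (f i (g i))) summable_on PiE I B"
proof -
  have abs: "Infinite_Sum.abs_summable_on (f i) (B i)" if "i \<in> I" for i
    using sum[OF that] summable_on_iff_abs_summable_on_complex summable_on_def by blast
  have "Infinite_Set_Sum.abs_summable_on (\<lambda>g. \<Prod>i\<in>I. f i (g i)) (PiE I B)"
    using assms abs by (intro abs_summable_on_prod_PiE) (auto simp: abs_summable_equivalent)
  then have s: "(\<lambda>g. norm (\<Prod>i\<in>I. f i (g i))) summable_on (PiE I B)"
    by (simp add: abs_summable_equivalent)
  then show "(\<lambda>g. \<Prod>i\<in>I. cmod (f i (g i))) summable_on PiE I B"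
    by (simp add: prod_norm)
  have "infsum (\<lambda>g. \<Prod>i\<in>I. f i (g i)) (PiE I B) = (\<Prod>i\<in>I. infsum (f i) (B i))"
    using assms(1) abs by (rule infsum_prod_PiE_abs)
  also have "\<dots> = (\<Prod>i\<in>I. s i)"
    using sum by (intro prod.cong) (auto intro: infsumI)
  finally show "((\<lambda>g. \<Prod>i\<in>I. f i (g i)) has_sum (\<Prod>i\<in>I. s i)) (PiE I B)"
    using abs_summable_summable[OF s] by (simp add: has_sum_iff)
qed

lemma sum_Times:
  fixes k :: "'x \<times> 'y \<Rightarrow> 'b::comm_monoid_add"
  shows "(\<Sum>u\<in>A \<times> B. k u) = (\<Sum>a\<in>A. \<Sum>b\<in>B. k (a, b))"
  unfolding sum.cartesian_product by simp

section \<open>Area integrals of monomials over the disc\<close>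

lemma borel_measurable_Complex [measurable]:
  assumes [measurable]: "f \<in> borel_measurable M" "h \<in> borel_measurable M"
  shows "(\<lambda>x. Complex (f x) (h x)) \<in> borel_measurable M"
proof -
  have "(\<lambda>x. Complex (f x) (h x)) = (\<lambda>x. complex_of_real (f x) + \<i> * complex_of_real (h x))"
    by (auto simp: complex_eq_iff)
  then show ?thesis by simp
qed

lemma measurable_case_prod_Complex [measurable]:
  "(\<lambda>(x, y). Complex x y) \<in> borel_measurable (lborel \<Otimes>\<^sub>M lborel)"
  unfolding case_prod_unfold by measurable

lemma lborel_complex_eq: "lborel = distr (lborel \<Otimes>\<^sub>M lborel) borel (\<lambda>(x, y). Complex x y)"
proof (rule lborel_eqI)
  fix l u :: complex assume le: "\<And>b. b \<in> Basis \<Longrightarrow> l \<bullet> b \<le> u \<bullet> b"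
  have *: "Re l \<le> Re u" "Im l \<le> Im u"
    using le[of 1] le[of \<i>] by (auto simp: Basis_complex_def)
  have "(\<lambda>(x, y). Complex x y) -` box l u \<inter> space (lborel \<Otimes>\<^sub>M lborel) = {Re l<..<Re u} \<times> {Im l<..<Im u}"
    by (auto simp: box_def Basis_complex_def space_pair_measure)
  then have "emeasure (distr (lborel \<Otimes>\<^sub>M lborel) borel (\<lambda>(x, y). Complex x y)) (box l u) =
      emeasure (lborel \<Otimes>\<^sub>M lborel) ({Re l<..<Re u} \<times> {Im l<..<Im u})"
    by (subst emeasure_distr) auto
  also have "\<dots> = ennreal (Re u - Re l) * ennreal (Im u - Im l)"
    using * by (subst lborel.emeasure_pair_measure_Times) auto
  also have "\<dots> = ennreal (\<Prod>b\<in>Basis. (u - l) \<bullet> b)"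
    using * by (simp add: Basis_complex_def complex_eq_iff flip: ennreal_mult')
  finally show "emeasure (distr (lborel \<Otimes>\<^sub>M lborel) borel (\<lambda>(x, y). Complex x y)) (box l u) =
      ennreal (\<Prod>b\<in>Basis. (u - l) \<bullet> b)" .
qed simp

text \<open>By Fubini's theorem, a shear acts on each line parallel to an axis as a translation.\<close>

lemma nn_integral_shear:
  fixes g :: "complex \<Rightarrow> ennreal"
  assumes [measurable]: "g \<in> borel_measurable borel"
  shows "(\<integral>\<^sup>+z. g (Complex (Re z + a * Im z) (Im z)) \<partial>lborel) = (\<integral>\<^sup>+z. g z \<partial>lborel)"
    and "(\<integral>\<^sup>+z. g (Complex (Re z) (Im z + a * Re z)) \<partial>lborel) = (\<integral>\<^sup>+z. g z \<partial>lborel)"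
proof -
  have D: "(\<integral>\<^sup>+z. h z \<partial>lborel) = (\<integral>\<^sup>+p. h (Complex (fst p) (snd p)) \<partial>(lborel \<Otimes>\<^sub>M lborel))"
    if [measurable]: "h \<in> borel_measurable borel" for h :: "complex \<Rightarrow> ennreal"
    by (subst lborel_complex_eq, subst nn_integral_distr) (auto simp: case_prod_unfold)
  have 1: "(\<integral>\<^sup>+z. h z \<partial>lborel) = (\<integral>\<^sup>+y. \<integral>\<^sup>+x. h (Complex x y) \<partial>lborel \<partial>lborel)"
    if [measurable]: "h \<in> borel_measurable borel" for h :: "complex \<Rightarrow> ennreal"
    unfolding D[OF that] by (subst lborel_pair.nn_integral_snd[symmetric]) auto
  have 2: "(\<integral>\<^sup>+z. h z \<partial>lborel) = (\<integral>\<^sup>+x. \<integral>\<^sup>+y. h (Complex x y) \<partial>lborel \<partial>lborel)"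
    if [measurable]: "h \<in> borel_measurable borel" for h :: "complex \<Rightarrow> ennreal"
    unfolding D[OF that] by (subst lborel.nn_integral_fst[symmetric]) auto
  have sh: "(\<integral>\<^sup>+x. h (x + t) \<partial>lborel) = (\<integral>\<^sup>+x. h x \<partial>lborel)"
    if "h \<in> borel_measurable borel" for h :: "real \<Rightarrow> ennreal" and t :: real
    using nn_integral_real_affine[of h 1 t] that by (simp add: add.commute)
  show "(\<integral>\<^sup>+z. g (Complex (Re z + a * Im z) (Im z)) \<partial>lborel) = (\<integral>\<^sup>+z. g z \<partial>lborel)"
    by (simp add: 1 sh[of "\<lambda>x. g (Complex x _)"])
  show "(\<integral>\<^sup>+z. g (Complex (Re z) (Im z + a * Re z)) \<partial>lborel) = (\<integral>\<^sup>+z. g z \<partial>lborel)"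
    by (simp add: 2 sh[of "\<lambda>y. g (Complex _ y)"])
qed

text \<open>A rotation other than a half turn is a product of three shears: if \<open>u = cos \<theta> + \<i> sin \<theta>\<close>, the outer
  two are parallel to the real axis with parameter \<open>- tan (\<theta>/2)\<close>, the middle one is parallel to the
  imaginary axis with parameter \<open>sin \<theta>\<close>.\<close>

lemma nn_integral_rotate:
  fixes g :: "complex \<Rightarrow> ennreal"
  assumes [measurable]: "g \<in> borel_measurable borel" and u: "cmod u = 1" "Im u \<noteq> 0"
  shows "(\<integral>\<^sup>+z. g (u * z) \<partial>lborel) = (\<integral>\<^sup>+z. g z \<partial>lborel)"
proof -
  define a where "a = (Re u - 1) / Im u"
  have circ: "(Re u)\<^sup>2 + (Im u)\<^sup>2 = 1"
    using u by (metis cmod_power2 one_power2)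
  have eq1: "1 + a * Im u = Re u" using u by (simp add: a_def)
  have "Im u * (a + a * Re u) = Im u * - Im u"
  proof -
    have "Im u * (a + a * Re u) = (a * Im u) * (1 + Re u)" by (simp add: algebra_simps)
    also have "\<dots> = (Re u - 1) * (1 + Re u)" using u by (simp add: a_def)
    also have "\<dots> = Im u * - Im u" using circ by (simp add: algebra_simps power2_eq_square)
    finally show ?thesis .
  qed
  (* eq1 and eq2 are the entries of the product of the shears below. *)
  then have eq2: "a + a * Re u = - Im u"
    unfolding mult_cancel_left using u by blast
  define S where "S z = Complex (Re z + a * Im z) (Im z)" for z
  define T where "T z = Complex (Re z) (Im z + Im u * Re z)" for z
  have [measurable]: "S \<in> borel_measurable borel" "T \<in> borel_measurable borel"
    unfolding S_def T_def by measurable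
  have "S (T (S z)) = u * z" for z
  proof -
    have "Im z + Im u * (Re z + a * Im z) = (1 + a * Im u) * Im z + Im u * Re z"
      by (simp add: algebra_simps)
    then have 1: "Im (S (T (S z))) = Re u * Im z + Im u * Re z"
      by (simp add: S_def T_def eq1)
    have "Re z + a * Im z + a * (Im z + Im u * (Re z + a * Im z)) =
        (1 + a * Im u) * Re z + (a + a * (1 + a * Im u)) * Im z"
      by (simp add: algebra_simps)
    then have 2: "Re (S (T (S z))) = Re u * Re z - Im u * Im z"
      by (simp add: S_def T_def eq1 eq2)
    show ?thesis using 1 2 by (simp add: complex_eq_iff)
  qed
  then have "(\<integral>\<^sup>+z. g (u * z) \<partial>lborel) = (\<integral>\<^sup>+z. g (S (T (S z))) \<partial>lborel)"
    by simp
  also have "\<dots> = (\<integral>\<^sup>+z. g (S (T z)) \<partial>lborel)"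
    using nn_integral_shear(1)[of "\<lambda>z. g (S (T z))" a] by (simp flip: S_def)
  also have "\<dots> = (\<integral>\<^sup>+z. g (S z) \<partial>lborel)"
    using nn_integral_shear(2)[of "\<lambda>z. g (S z)" "Im u"] by (simp flip: T_def)
  also have "\<dots> = (\<integral>\<^sup>+z. g z \<partial>lborel)"
    using nn_integral_shear(1)[of "\<lambda>z. g z" a] by (simp flip: S_def)
  finally show ?thesis .
qed

lemma space_disk_measure [simp]: "space disk_measure = ball 0 1"
  by (simp add: disk_measure_def space_scale_measure space_restrict_space)

lemma sets_disk_measure: "sets disk_measure = sets (restrict_space borel (ball 0 1))"
  by (simp add: disk_measure_def sets_restrict_space)

lemma borel_measurable_disk [measurable (raw)]:
  "f \<in> borel_measurable borel \<Longrightarrow> f \<in> borel_measurable disk_measure"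
  by (subst measurable_cong_sets[OF sets_disk_measure refl]) (rule measurable_restrict_space1)

lemma emeasure_disk_measure:
  assumes "A \<in> sets borel" "A \<subseteq> ball 0 1"
  shows "emeasure disk_measure A = ennreal (1 / pi) * emeasure lborel A"
  using assms by (simp add: disk_measure_def emeasure_restrict_space)

lemma sets_disk_measureD: "A \<in> sets disk_measure \<Longrightarrow> A \<in> sets borel \<and> A \<subseteq> ball 0 1"
  by (auto simp: sets_disk_measure sets_restrict_space)

lemma disk_measure_rotate:
  assumes u: "cmod u = 1" "Im u \<noteq> 0"
  shows "distr disk_measure disk_measure ((*) u) = disk_measure"
proof (rule measure_eqI)
  have meas: "(*) u \<in> measurable disk_measure disk_measure"
    unfolding measurable_cong_sets[OF sets_disk_measure sets_disk_measure]
    using u by (intro measurable_restrict_space3) (auto simp: norm_mult)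
  fix A assume "A \<in> sets (distr disk_measure disk_measure ((*) u))"
  then have A: "A \<in> sets disk_measure" by simp
  have A' [measurable]: "A \<in> sets borel" and "A \<subseteq> ball 0 1"
    using sets_disk_measureD[OF A] by auto
  have sub: "(*) u -` A \<subseteq> ball 0 1"
    using \<open>A \<subseteq> ball 0 1\<close> u by (fastforce simp: norm_mult)
  have B: "(*) u -` A \<in> sets borel"
    using measurable_sets[of "(*) u" borel borel A] by simp
  have "emeasure (distr disk_measure disk_measure ((*) u)) A = emeasure disk_measure ((*) u -` A)"
    using sub by (subst emeasure_distr[OF meas A]) (simp add: Int_absorb2)
  also have "\<dots> = ennreal (1 / pi) * emeasure lborel ((*) u -` A)"
    by (rule emeasure_disk_measure[OF B sub])
  also have "emeasure lborel ((*) u -` A) = (\<integral>\<^sup>+z. indicator A (u * z) \<partial>lborel)"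
  proof -
    have "(\<integral>\<^sup>+z. indicator A (u * z) \<partial>lborel) = (\<integral>\<^sup>+z. indicator ((*) u -` A) z \<partial>lborel)"
      by (intro nn_integral_cong) (simp add: indicator_def)
    also have "\<dots> = emeasure lborel ((*) u -` A)"
      using B by (intro nn_integral_indicator) simp
    finally show ?thesis ..
  qed
  also have "\<dots> = emeasure lborel A"
    by (subst nn_integral_rotate[OF _ u]) auto
  also have "ennreal (1 / pi) * emeasure lborel A = emeasure disk_measure A"
    using \<open>A \<subseteq> ball 0 1\<close> by (simp add: emeasure_disk_measure)
  finally show "emeasure (distr disk_measure disk_measure ((*) u)) A = emeasure disk_measure A" .
qed simp

lemma emeasure_disk_ball:
  assumes "0 \<le> r" "r \<le> 1"
  shows "emeasure disk_measure (ball 0 r) = ennreal (r\<^sup>2)"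
proof -
  have "emeasure lborel (ball 0 r :: complex set) = ennreal (pi * r\<^sup>2)"
    using assms by (simp add: emeasure_ball unit_ball_vol_2)
  then show ?thesis
    using assms by (subst emeasure_disk_measure) (auto simp flip: ennreal_mult')
qed

text \<open>The disc of radius \<open>sqrt x\<close> has normalized area \<open>x\<close>. For radial integrands this takes the
  place of polar coordinates.\<close>

lemma distr_disk_norm_square:
  "distr disk_measure borel (\<lambda>z. (cmod z)\<^sup>2) = uniform_measure lborel {0..1}"
proof (rule measure_eqI_lessThan)
  have m: "(\<lambda>z. (cmod z)\<^sup>2) \<in> borel_measurable disk_measure" by measurable
  show eq: "emeasure (distr disk_measure borel (\<lambda>z. (cmod z)\<^sup>2)) {x<..} = emeasure (uniform_measure lborel {0..1}) {x<..}" for x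
  proof -
    have fin: "emeasure lborel (cball 0 (sqrt x) :: complex set) = ennreal (pi * x)" if "0 \<le> x"
      using that by (simp add: emeasure_cball unit_ball_vol_2)
    have one: "emeasure lborel (ball 0 1 :: complex set) = ennreal pi"
      by (simp add: emeasure_ball unit_ball_vol_2)
    have "emeasure disk_measure ((\<lambda>z. (cmod z)\<^sup>2) -` {x<..} \<inter> space disk_measure) = ennreal (1 - max 0 (min 1 x))"
    proof (cases "x < 0 \<or> x \<ge> 1")
      case True
      then consider "x < 0" | "x \<ge> 1" by blast
      then show ?thesis
      proof cases
        case 1
        then have "(\<lambda>z. (cmod z)\<^sup>2) -` {x<..} \<inter> space disk_measure = ball 0 1"
          by (auto intro: less_le_trans[OF _ zero_le_power2])
        with 1 show ?thesis using emeasure_disk_ball[of 1] by simp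
      next
        case 2
        have "(cmod z)\<^sup>2 < 1" if "cmod z < 1" for z
          using that by (simp add: power_less_one_iff)
        with 2 have "(\<lambda>z. (cmod z)\<^sup>2) -` {x<..} \<inter> space disk_measure = {}"
          by (fastforce simp: dist_norm)
        with 2 show ?thesis by simp
      qed
    next
      case False
      then have x: "0 \<le> x" "x < 1" by auto
      have "x < (cmod z)\<^sup>2 \<longleftrightarrow> \<not> cmod z \<le> sqrt x" for z
        using x by (smt (verit) norm_ge_zero real_le_rsqrt real_less_rsqrt real_sqrt_less_iff real_sqrt_unique sqrt_le_D)
      then have "(\<lambda>z. (cmod z)\<^sup>2) -` {x<..} \<inter> space disk_measure = ball 0 1 - cball 0 (sqrt x)"
        by auto
      moreover have "cball 0 (sqrt x) \<subseteq> (ball 0 1 :: complex set)"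
        using le_less_trans[of _ "sqrt x" 1] x by auto
      moreover have "ennreal (1 / pi) * emeasure lborel (ball 0 1 - cball 0 (sqrt x) :: complex set) = ennreal (1 - x)"
        using x calculation(2) by (subst emeasure_Diff)
          (auto simp: one fin ennreal_minus algebra_simps divide_simps simp flip: ennreal_mult')
      ultimately show ?thesis
        using x by (subst emeasure_disk_measure) auto
    qed
    moreover have "emeasure lborel ({0..1} \<inter> {x<..}) = ennreal (1 - max 0 (min 1 x))"
    proof -
      have *: "{0..1} \<inter> {x<..} = (if x < 0 then {0..1} else {x<..1})" by auto
      show ?thesis unfolding * by (cases "x \<le> 1") auto
    qed
    ultimately show ?thesis
      by (simp add: emeasure_distr[OF m] divide_ennreal_def)
  qed
  show "emeasure (distr disk_measure borel (\<lambda>z. (cmod z)\<^sup>2)) {x<..} < \<infinity>" for x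
  proof -
    have "emeasure lborel ({0..1} \<inter> {x<..}) \<le> emeasure lborel {0..1::real}"
      by (intro emeasure_mono) auto
    then show ?thesis
      unfolding eq by (simp add: divide_ennreal_def le_less_trans[of _ 1])
  qed
qed auto

text \<open>Rotating by \<open>u\<close> multiplies the integral by \<open>u\<^sup>m\<^sup>-\<^sup>n\<close>. The angle is chosen such that this factor
  is \<open>\<i>\<close>, which also keeps \<open>u\<close> away from the real axis, where the factorization into shears breaks down.\<close>

lemma integral_disk_monomials_diff:
  fixes m n :: nat
  assumes "m \<noteq> n"
  shows "(LINT z|disk_measure. z ^ m * cnj z ^ n * of_real (g (cmod z))) = 0"
proof -
  let ?f = "\<lambda>z. z ^ m * cnj z ^ n * complex_of_real (g (cmod z))"
  have base: "(LINT z|disk_measure. ?f z) = 0"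
    if "\<exists>u. cmod u = 1 \<and> Im u \<noteq> 0 \<and> u ^ m * cnj u ^ n \<noteq> 1"
  proof -
    from that obtain u where u: "cmod u = 1" "Im u \<noteq> 0" "u ^ m * cnj u ^ n \<noteq> 1"
      by blast
    have meas: "(*) u \<in> measurable disk_measure disk_measure"
      unfolding measurable_cong_sets[OF sets_disk_measure sets_disk_measure]
      using u by (intro measurable_restrict_space3) (auto simp: norm_mult)
    show ?thesis
    proof (cases "?f \<in> borel_measurable disk_measure")
      case True
      have "(LINT z|disk_measure. ?f z) = (LINT z|distr disk_measure disk_measure ((*) u). ?f z)"
        using disk_measure_rotate[OF u(1,2)] by simp
      also have "\<dots> = (LINT z|disk_measure. ?f (u * z))"
        by (rule integral_distr[OF meas True])
      also have "\<dots> = (LINT z|disk_measure. (u ^ m * cnj u ^ n) * ?f z)"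
        using u by (intro Bochner_Integration.integral_cong) (auto simp: norm_mult power_mult_distrib)
      also have "\<dots> = (u ^ m * cnj u ^ n) * (LINT z|disk_measure. ?f z)"
        by simp
      finally show ?thesis using u(3) by simp
    next
      case False
      then show ?thesis
        using not_integrable_integral_eq borel_measurable_integrable by blast
    qed
  qed
  define k where "k = real m - real n"
  define \<theta> where "\<theta> = pi / (2 * k)"
  have k: "\<bar>k\<bar> \<ge> 1" using assms by (auto simp: k_def)
  have "\<bar>\<theta>\<bar> \<le> pi / 2" "\<theta> \<noteq> 0"
    using k by (auto simp: \<theta>_def abs_mult divide_simps mult_left_le)
  then have s: "sin \<theta> \<noteq> 0"
    using sin_gt_zero[of \<theta>] sin_gt_zero[of "- \<theta>"] pi_gt_zero by (cases "\<theta> > 0") auto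
  have "cis \<theta> ^ m * cnj (cis \<theta>) ^ n = cis (k * \<theta>)"
    by (simp add: cis_cnj Complex.DeMoivre cis_mult k_def algebra_simps)
  also have "k * \<theta> = pi / 2" using k by (auto simp: \<theta>_def)
  finally have "cis \<theta> ^ m * cnj (cis \<theta>) ^ n \<noteq> 1"
    by (simp add: complex_eq_iff)
  with s show ?thesis
    by (intro base exI[of _ "cis \<theta>"]) auto
qed

lemma finite_measure_disk: "finite_measure disk_measure"
  using emeasure_disk_ball[of 1] by (intro finite_measureI) simp

lemma integral_disk_moment:
  assumes "0 \<le> \<rho>" "\<rho> \<le> 1"
  shows "(LINT z|disk_measure. cmod z ^ (2 * m) * indicator {..<\<rho>} (cmod z)) = \<rho> ^ (2 * m + 2) / (m + 1)"
proof -
  have "(LINT z|disk_measure. cmod z ^ (2 * m) * indicator {..<\<rho>} (cmod z)) =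
      (LINT z|disk_measure. ((cmod z)\<^sup>2) ^ m * indicator {..<\<rho>\<^sup>2} ((cmod z)\<^sup>2))"
    using assms by (intro Bochner_Integration.integral_cong)
      (auto simp: indicator_def power_mult abs_less_iff intro!: power_strict_mono dest: power_less_imp_less_base)
  also have "\<dots> = (LINT u|distr disk_measure borel (\<lambda>z. (cmod z)\<^sup>2). u ^ m * indicator {..<\<rho>\<^sup>2} u)"
    by (subst integral_distr) auto
  also have "\<dots> = (LINT u|density lborel (indicator {0..1}). u ^ m * indicator {..<\<rho>\<^sup>2} u)"
    by (simp add: distr_disk_norm_square uniform_measure_def divide_ennreal_def)
  also have "\<dots> = (LINT u|lborel. indicator {0..1} u *\<^sub>R (u ^ m * indicator {..<\<rho>\<^sup>2} u))"
  proof -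
    have "density lborel (indicator {0..1} :: real \<Rightarrow> ennreal) = density lborel (\<lambda>u. ennreal (indicator {0..1::real} u))"
      by (simp add: ennreal_indicator)
    then show ?thesis by (simp add: integral_density)
  qed
  also have "\<dots> = (LINT u|lborel. indicator {0..\<rho>\<^sup>2} u *\<^sub>R u ^ m)"
  proof (rule integral_cong_AE)
    have r: "\<rho>\<^sup>2 \<le> 1" using assms by (simp add: power_le_one)
    show "AE u in lborel. indicator {0..1} u *\<^sub>R (u ^ m * indicator {..<\<rho>\<^sup>2} u) = indicator {0..\<rho>\<^sup>2} u *\<^sub>R u ^ m"
      using AE_lborel_singleton[of "\<rho>\<^sup>2"] by eventually_elim (use r in \<open>auto simp: indicator_def\<close>)
  qed auto
  also have "\<dots> = (\<rho>\<^sup>2) ^ (m + 1) / (m + 1)"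
    using integral_power[of 0 "\<rho>\<^sup>2" m] by (simp add: mult.commute)
  also have "(\<rho>\<^sup>2) ^ (m + 1) = \<rho> ^ (2 * m + 2)"
    by (subst power_mult[symmetric]) simp
  finally show ?thesis .
qed

text \<open>The norm of \<open>z\<^sup>m\<close> in the Bergman space is the source of the weights \<open>1/(m + 1)\<close>. The truncation to
  radius \<open>\<rho>\<close> damps them by powers of \<open>\<rho>\<^sup>2\<close>.\<close>

lemma integral_disk_monomials:
  assumes "0 \<le> \<rho>" "\<rho> \<le> 1"
  shows "(LINT z|disk_measure. z ^ m * cnj z ^ n * of_real (indicator {..<\<rho>} (cmod z))) =
    (if m = n then of_real (\<rho> ^ (2 * m + 2) / (m + 1)) else 0)"
proof (cases "m = n")
  case False
  then show ?thesis
    using integral_disk_monomials_diff[OF False, of "indicator {..<\<rho>}"] by simp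
next
  case True
  have "z ^ m * cnj z ^ m * of_real (indicator {..<\<rho>} (cmod z)) =
      complex_of_real (cmod z ^ (2 * m) * indicator {..<\<rho>} (cmod z))" for z
    by (auto simp: indicator_def power_mult complex_norm_square[symmetric] simp flip: power_mult_distrib of_real_power)
  with True show ?thesis
    by (simp only: integral_complex_of_real integral_disk_moment[OF assms] if_True simp_thms)
qed

section \<open>Monomials on the torus\<close>

lemma space_circle_measure [simp]: "space circle_measure = sphere 0 1"
  by (simp add: circle_measure_def space_restrict_space)

lemma sets_circle_measure: "sets circle_measure = sets (restrict_space borel (sphere 0 1))"
  by (simp add: circle_measure_def)

lemma borel_measurable_circle [measurable (raw)]:
  "f \<in> borel_measurable borel \<Longrightarrow> f \<in> borel_measurable circle_measure"
  by (subst measurable_cong_sets[OF sets_circle_measure refl]) (rule measurable_restrict_space1)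

lemma measurable_cis_sphere:
  "cis \<in> measurable (uniform_measure lborel {0..<2 * pi}) (restrict_space borel (sphere 0 1))"
proof (rule measurable_restrict_space2)
  have "continuous_on UNIV cis"
    by (intro continuous_intros)
  then show "cis \<in> measurable (uniform_measure lborel {0..<2 * pi}) borel"
    unfolding measurable_cong_sets[OF sets_uniform_measure refl]
    by (simp add: borel_measurable_continuous_onI)
qed auto

lemma integral_circle:
  fixes f :: "complex \<Rightarrow> complex"
  assumes "f \<in> borel_measurable borel"
  shows "(LINT t|circle_measure. f t) = (LINT \<theta>|lborel. indicator {0..2 * pi} \<theta> *\<^sub>R f (cis \<theta>)) / (2 * pi)"
proof -
  have [measurable]: "cis \<in> borel_measurable borel"
    by (intro borel_measurable_continuous_onI continuous_intros)
  have [measurable]: "f \<in> borel_measurable borel" by fact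
  have "(LINT t|circle_measure. f t) = (LINT \<theta>|uniform_measure lborel {0..<2 * pi}. f (cis \<theta>))"
    unfolding circle_measure_def
    by (intro integral_distr measurable_cis_sphere measurable_restrict_space1 assms)
  also have "uniform_measure lborel {0..<2 * pi} = density lborel (\<lambda>\<theta>. ennreal (indicator {0..<2 * pi} \<theta> / (2 * pi)))"
    unfolding uniform_measure_def
    by (intro density_cong) (auto simp: indicator_def divide_ennreal simp flip: ennreal_1)
  also have "(LINT \<theta>|\<dots>. f (cis \<theta>)) = (LINT \<theta>|lborel. (indicator {0..<2 * pi} \<theta> / (2 * pi)) *\<^sub>R f (cis \<theta>))"
    by (intro integral_density) auto
  also have "\<dots> = (LINT \<theta>|lborel. (indicator {0..2 * pi} \<theta> *\<^sub>R f (cis \<theta>)) / (2 * pi))"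
    using AE_lborel_singleton[of "2 * pi"]
    by (intro integral_cong_AE; (measurable | eventually_elim))
      (auto simp: indicator_def scaleR_conv_of_real)
  finally show ?thesis by simp
qed

lemma borel_measurable_power_int [measurable (raw)]:
  assumes "f \<in> borel_measurable M"
  shows "(\<lambda>t. f t powi n :: complex) \<in> borel_measurable M"
  using assms unfolding power_int_def by (cases "n \<ge> 0") simp_all

text \<open>The primitive \<open>cis (n \<theta>) / (\<i> n)\<close> is periodic.\<close>

lemma integral_circle_power_int:
  "(LINT t|circle_measure. t powi n) = (if n = 0 then 1 else 0)"
proof (cases "n = 0")
  case True
  then show ?thesis
    by (subst integral_circle) (simp_all add: scaleR_conv_of_real)
next
  case False
  have cont: "continuous_on {0..2 * pi} (\<lambda>\<theta>. cis (n * \<theta>))"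
    by (intro continuous_intros)
  have "cis \<theta> powi n = cis (n * \<theta>)" for \<theta> :: real
    by (simp add: cis_power_int)
  then have "(LINT \<theta>|lborel. indicator {0..2 * pi} \<theta> *\<^sub>R (cis \<theta> powi n)) =
      (LINT \<theta>|lborel. indicator {0..2 * pi} \<theta> *\<^sub>R cis (n * \<theta>))"
    by simp
  also have "\<dots> = cis (n * (2 * pi)) / (\<i> * n) - cis (real_of_int n * 0) / (\<i> * n)"
  proof (rule integral_FTC_atLeastAtMost)
    fix \<theta> :: real
    have "((\<lambda>\<theta>. cis (n * \<theta>) / (\<i> * n)) has_vector_derivative cis (n * \<theta>)) (at \<theta>)"
      using False unfolding has_vector_derivative_def
      by (auto intro!: derivative_eq_intros simp: fun_eq_iff scaleR_conv_of_real field_simps)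
    then show "((\<lambda>\<theta>. cis (n * \<theta>) / (\<i> * n)) has_vector_derivative cis (n * \<theta>)) (at \<theta> within {0..2 * pi})"
      by (rule has_vector_derivative_at_within)
  qed (use cont in auto)
  also have "cis (n * (2 * pi)) = 1"
    using cis_multiple_2pi[of "of_int n"] by (simp add: mult_ac)
  finally show ?thesis
    using False by (subst integral_circle) simp_all
qed

lemma finite_measure_circle: "finite_measure circle_measure"
proof
  have "emeasure circle_measure (space circle_measure) = emeasure (uniform_measure lborel {0..<2 * pi}) (cis -` sphere 0 1)"
    unfolding circle_measure_def
    by (subst emeasure_distr[OF measurable_cis_sphere]) (auto simp: space_restrict_space sets_restrict_space)
  also have "cis -` sphere 0 1 = UNIV" by auto
  finally show "emeasure circle_measure (space circle_measure) \<noteq> \<infinity>"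
    by (simp add: divide_ennreal flip: ennreal_numeral ennreal_mult)
qed

interpretation circle: product_sigma_finite "\<lambda>_ :: nat. circle_measure"
  by standard (rule finite_measure.axioms(1)[OF finite_measure_circle, THEN sigma_finite_measure.sigma_finite_countable])

lemma space_torus_measure: "space (torus_measure d) = {..<d} \<rightarrow>\<^sub>E sphere 0 1"
  by (simp add: torus_measure_def space_PiM)

lemma norm_torus: "t \<in> space (torus_measure d) \<Longrightarrow> j < d \<Longrightarrow> cmod (t j) = 1"
  by (auto simp: space_torus_measure PiE_iff)

lemma measurable_torus_component [measurable (raw)]:
  assumes "f \<in> borel_measurable borel" "j < d"
  shows "(\<lambda>t. f (t j)) \<in> borel_measurable (torus_measure d)"
  unfolding torus_measure_def
proof (rule measurable_compose[OF _ borel_measurable_circle[OF assms(1)]])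
  show "(\<lambda>t. t j) \<in> measurable (PiM {..<d} (\<lambda>_. circle_measure)) circle_measure"
    using assms(2) by (intro measurable_component_singleton) simp
qed

lemma integrable_circle_power_int: "integrable circle_measure (\<lambda>t. t powi n)"
proof (rule finite_measure.integrable_const_bound[OF finite_measure_circle, where B = 1])
  show "AE x in circle_measure. norm (x powi n) \<le> 1"
    by (intro AE_I2) (simp add: norm_power_int)
qed auto

lemma integral_torus_monomial:
  "(LINT t|torus_measure d. (\<Prod>j<d. t j powi a j)) = (if \<forall>j<d. a j = 0 then 1 else 0)"
  unfolding torus_measure_def
  by (subst circle.product_integral_prod)
    (auto simp: integrable_circle_power_int integral_circle_power_int)

lemma integrable_torus_monomial: "integrable (torus_measure d) (\<lambda>t. \<Prod>j<d. t j powi a j)"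
  unfolding torus_measure_def
  by (rule circle.product_integrable_prod) (auto simp: integrable_circle_power_int)

lemma finite_measure_torus: "finite_measure (torus_measure d)"
proof -
  have "integrable (torus_measure d) (\<lambda>t. 1 :: complex)"
    using integrable_torus_monomial[of d "\<lambda>_. 0"] by simp
  then show ?thesis
    by (intro finite_measureI) (simp add: integrable_iff_bounded less_top)
qed

section \<open>Hilbert's symbol and the form on the torus\<close>

text \<open>For \<open>r \<rightarrow> 1\<close> and \<open>u = cis \<theta>\<close> with \<open>0 < \<theta> < 2 \<pi>\<close> this tends to \<open>\<i> (\<pi> - \<theta>) cis (- \<theta>)\<close>, the bounded function whose
  Fourier coefficients are \<open>1/(n + 1)\<close> for \<open>n \<noteq> -1\<close>.\<close>

definition hilbert_kernel :: "real \<Rightarrow> complex \<Rightarrow> complex" where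
  "hilbert_kernel r u = cnj u * (Ln (1 - of_real r * cnj u) - Ln (1 - of_real r * u))"

text \<open>At \<open>n = -1\<close> the value is \<open>0\<close>, since division by zero yields zero.\<close>

definition hilbert_coeff :: "real \<Rightarrow> int \<Rightarrow> real" where
  "hilbert_coeff r n = r ^ nat \<bar>n + 1\<bar> / (n + 1)"

lemma Re_one_minus_pos:
  assumes "0 < r" "r < 1" "cmod u = 1"
  shows "0 < Re (1 - of_real r * u)"
proof -
  have "r * Re u \<le> r * 1"
    using assms complex_Re_le_cmod[of u] by (intro mult_left_mono) auto
  also have "\<dots> < 1" using assms by simp
  finally show ?thesis by simp
qed

text \<open>The difference of the two logarithms is \<open>-2\<i>\<close> times the argument of \<open>1 - r u\<close>, and
  this number lies in the right half plane. So the bound \<open>\<pi>\<close> holds uniformly in \<open>r\<close>.\<close>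

lemma norm_hilbert_kernel:
  assumes r: "0 < r" "r < 1" and u: "cmod u = 1"
  shows "cmod (hilbert_kernel r u) \<le> pi"
proof -
  define w where "w = 1 - of_real r * u"
  have w: "0 < Re w" unfolding w_def using assms by (rule Re_one_minus_pos)
  then have "w \<notin> \<real>\<^sub>\<le>\<^sub>0" by (auto simp: complex_nonpos_Reals_iff)
  then have "Ln (1 - of_real r * cnj u) = cnj (Ln w)"
    by (simp add: cnj_Ln w_def)
  then have "hilbert_kernel r u = cnj u * (- 2 * \<i> * of_real (Im (Ln w)))"
    unfolding hilbert_kernel_def w_def[symmetric] by (simp add: complex_eq_iff)
  then have "cmod (hilbert_kernel r u) = 2 * \<bar>Im (Ln w)\<bar>"
    using u by (simp add: norm_mult)
  also have "\<dots> \<le> pi"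
    using Re_Ln_pos_lt_imp[OF w] by simp
  finally show ?thesis .
qed

lemma hilbert_kernel_measurable:
  assumes "0 < r" "r < 1"
  shows "hilbert_kernel r \<in> borel_measurable (restrict_space borel (sphere 0 1))"
proof (rule borel_measurable_continuous_on_restrict)
  have "1 - of_real r * u \<notin> \<real>\<^sub>\<le>\<^sub>0" if "cmod u = 1" for u
    using Re_one_minus_pos[OF assms that] by (auto simp: complex_nonpos_Reals_iff)
  from this[of "cnj _"] this show "continuous_on (sphere 0 1) (hilbert_kernel r)"
    unfolding hilbert_kernel_def by (intro continuous_intros) auto
qed

text \<open>The logarithmic series in \<open>u\<close> gives the frequencies \<open>m \<ge> 1\<close>, the one in \<open>cnj u\<close> the frequencies
  \<open>m \<le> -1\<close>, with coefficient \<open>r\<^sup>\<bar>\<^sup>m\<^sup>\<bar>/m\<close> in both cases; the factor \<open>cnj u\<close> shifts \<open>m\<close> to \<open>n = m - 1\<close>.\<close>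

lemma hilbert_kernel_has_sum:
  assumes r: "0 < r" "r < 1" and u: "cmod u = 1"
  shows "((\<lambda>n. of_real (hilbert_coeff r n) * u powi n) has_sum hilbert_kernel r u) UNIV"
proof -
  have log: "((\<lambda>m::nat. (of_real r * v) ^ m / of_nat m) has_sum - Ln (1 - of_real r * v)) {1..}"
    if v: "cmod v = 1" for v
  proof -
    have n: "cmod (of_real r * v) = r" using r v by (simp add: norm_mult)
    have "(\<lambda>m. - (- (((of_real r * v) ^ m) / of_nat m))) sums - Ln (1 - of_real r * v)"
      using Ln_series'[of "- (of_real r * v)"] n r by (intro sums_minus) simp
    then have s: "(\<lambda>m. ((of_real r * v) ^ m) / of_nat m) sums - Ln (1 - of_real r * v)"
      by simp
    have "summable (\<lambda>m. cmod ((of_real r * v) ^ m / of_nat m))"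
    proof (rule summable_comparison_test_ev)
      show "\<forall>\<^sub>F m in sequentially. norm (cmod ((of_real r * v) ^ m / of_nat m)) \<le> r ^ m"
      proof (intro always_eventually allI)
        fix m show "norm (cmod ((of_real r * v) ^ m / of_nat m)) \<le> r ^ m"
        proof (cases "m = 0")
          case False
          have "norm (cmod ((of_real r * v) ^ m / of_nat m)) = r ^ m / m"
            by (simp only: norm_divide norm_power n norm_of_nat real_norm_def abs_norm_cancel)
              (use r in simp)
          also have "\<dots> \<le> r ^ m / 1"
            using False r by (intro divide_left_mono) auto
          finally show ?thesis by simp
        qed simp
      qed
      show "summable (\<lambda>m. r ^ m)" using r by (intro summable_geometric) simp
    qed
    from norm_summable_imp_has_sum[OF this s]
    show ?thesis
      by (rule has_sum_cong_neutral[THEN iffD1, rotated -1]) auto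
  qed
  define G where "G m = of_real (r ^ nat \<bar>m\<bar> / of_int m) * u powi m" for m :: int
  have "u \<noteq> 0" using u by auto
  have "u * cnj u = 1"
    using complex_norm_square[of u] u by simp
  then have cu: "cnj u = inverse u"
    by (rule inverse_unique[symmetric])
  have pos: "(G has_sum - Ln (1 - of_real r * u)) {1..}"
  proof -
    have *: "{1..} = int ` {1..}"
      by (auto intro!: image_eqI[of _ _ "nat _"])
    have "(G has_sum - Ln (1 - of_real r * u)) (int ` {1..})"
      using log[OF u] by (subst has_sum_reindex)
        (auto simp: inj_on_def G_def o_def power_mult_distrib)
    then show ?thesis by (simp only: *)
  qed
  have neg: "(G has_sum Ln (1 - of_real r * cnj u)) {..-1}"
  proof -
    have *: "{..-1} = (\<lambda>m. - int m) ` {1..}"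
      by (auto intro!: image_eqI[of _ _ "nat (- _)"])
    have l: "((\<lambda>m::nat. - ((of_real r * cnj u) ^ m / of_nat m)) has_sum - (- Ln (1 - of_real r * cnj u))) {1..}"
      using log[of "cnj u"] u by (subst has_sum_uminus) simp
    have "(G has_sum Ln (1 - of_real r * cnj u)) ((\<lambda>m. - int m) ` {1..})"
    proof (subst has_sum_reindex)
      have "G (- int m) = - ((of_real r * cnj u) ^ m / of_nat m)" for m
        by (simp add: G_def cu power_mult_distrib power_int_minus power_inverse)
      then show "(G \<circ> (\<lambda>m. - int m) has_sum Ln (1 - of_real r * cnj u)) {1..}"
        using l by (simp add: o_def)
    qed (auto simp: inj_on_def)
    then show ?thesis by (simp only: *)
  qed
  have "(G has_sum (- Ln (1 - of_real r * u) + Ln (1 - of_real r * cnj u))) ({1..} \<union> {..-1})"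
    by (rule has_sum_Un_disjoint[OF pos neg]) auto
  then have "(G has_sum (Ln (1 - of_real r * cnj u) - Ln (1 - of_real r * u))) UNIV"
  proof (subst has_sum_cong_neutral[of "{1..} \<union> {..-1}" UNIV G G])
    fix m :: int assume "m \<in> UNIV - ({1..} \<union> {..-1})"
    then have "m = 0" by auto
    then show "G m = 0" by (simp add: G_def)
  qed (auto simp: algebra_simps)
  moreover have "bij_betw (\<lambda>n::int. n + 1) UNIV UNIV"
    by (rule bij_betwI[where g = "\<lambda>n. n - 1"]) auto
  ultimately have "((\<lambda>n. G (n + 1)) has_sum (Ln (1 - of_real r * cnj u) - Ln (1 - of_real r * u))) UNIV"
    by (subst has_sum_reindex_bij_betw)
  then have "((\<lambda>n. cnj u * G (n + 1)) has_sum hilbert_kernel r u) UNIV"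
    unfolding hilbert_kernel_def by (rule has_sum_cmult_right)
  moreover have "cnj u * G (n + 1) = of_real (hilbert_coeff r n) * u powi n" for n
    using \<open>u \<noteq> 0\<close> by (simp add: G_def hilbert_coeff_def cu power_int_add)
  ultimately show ?thesis by simp
qed

lemma (in pair_sigma_finite) integral_pair_mult:
  fixes a :: "'a \<Rightarrow> complex" and b :: "'b \<Rightarrow> complex"
  assumes "integrable M1 a" "integrable M2 b"
  shows "integrable (M1 \<Otimes>\<^sub>M M2) (\<lambda>(x, y). a x * b y)"
    and "(LINT p|(M1 \<Otimes>\<^sub>M M2). a (fst p) * b (snd p)) = (LINT x|M1. a x) * (LINT y|M2. b y)"
proof -
  have [measurable]: "a \<in> borel_measurable M1" "b \<in> borel_measurable M2"
    using assms by auto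
  show i: "integrable (M1 \<Otimes>\<^sub>M M2) (\<lambda>(x, y). a x * b y)"
  proof (rule Fubini_integrable)
    show "integrable M1 (\<lambda>x. LINT y|M2. norm (case (x, y) of (x, y) \<Rightarrow> a x * b y))"
      using assms by (simp add: norm_mult)
  qed (use assms in auto)
  have "(LINT p|(M1 \<Otimes>\<^sub>M M2). a (fst p) * b (snd p)) = (LINT x|M1. LINT y|M2. a x * b y)"
    using integral_fst'[OF i] by (simp add: case_prod_unfold)
  also have "\<dots> = (LINT x|M1. a x) * (LINT y|M2. b y)"
    by simp
  finally show "(LINT p|(M1 \<Otimes>\<^sub>M M2). a (fst p) * b (snd p)) = (LINT x|M1. a x) * (LINT y|M2. b y)" .
qed

definition torus_kernel :: "nat \<Rightarrow> real \<Rightarrow> (nat \<Rightarrow> complex) \<Rightarrow> (nat \<Rightarrow> complex) \<Rightarrow> complex" where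
  "torus_kernel d r s t = (\<Prod>j<d. hilbert_kernel r (cnj (s j) * t j))"

lemma norm_torus_kernel:
  assumes "0 < r" "r < 1" "s \<in> space (torus_measure d)" "t \<in> space (torus_measure d)"
  shows "cmod (torus_kernel d r s t) \<le> pi ^ d"
proof -
  have "cmod (torus_kernel d r s t) = (\<Prod>j<d. cmod (hilbert_kernel r (cnj (s j) * t j)))"
    by (simp add: torus_kernel_def prod_norm)
  also have "\<dots> \<le> (\<Prod>j<d. pi)"
    using assms by (intro prod_mono conjI norm_ge_zero norm_hilbert_kernel)
      (auto simp: norm_mult norm_torus)
  finally show ?thesis by simp
qed

lemma sigma_finite_torus: "sigma_finite_measure (torus_measure d)"
  using finite_measure_torus finite_measure.axioms(1) by blast

interpretation torus_pair: pair_sigma_finite "torus_measure d" "torus_measure d" for d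
  by (intro pair_sigma_finite.intro sigma_finite_torus)

lemma torus_kernel_measurable:
  assumes r: "0 < r" "r < 1"
  shows "(\<lambda>(s, t). torus_kernel d r s t) \<in> borel_measurable (torus_measure d \<Otimes>\<^sub>M torus_measure d)"
  unfolding torus_kernel_def case_prod_unfold
proof (rule borel_measurable_prod, simp)
  fix j assume j: "j < d"
  have [measurable]: "(\<lambda>t. t j) \<in> borel_measurable (torus_measure d)"
    using measurable_torus_component[of "\<lambda>z. z" j d] j by simp
  have "(\<lambda>p. cnj (fst p j) * snd p j) \<in> measurable (torus_measure d \<Otimes>\<^sub>M torus_measure d) (restrict_space borel (sphere 0 1))"
    using j by (intro measurable_restrict_space2)
      (auto simp: space_pair_measure norm_mult norm_torus intro!: borel_measurable_times
        measurable_compose[OF measurable_fst] measurable_compose[OF measurable_snd] borel_measurable_cnj)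
  from measurable_compose[OF this hilbert_kernel_measurable[OF r]]
  show "(\<lambda>p. hilbert_kernel r (cnj (fst p j) * snd p j)) \<in> borel_measurable (torus_measure d \<Otimes>\<^sub>M torus_measure d)" .
qed

lemma torus_kernel_has_sum:
  assumes "0 < r" "r < 1" "s \<in> space (torus_measure d)" "t \<in> space (torus_measure d)"
  shows "((\<lambda>\<alpha>. \<Prod>j<d. of_real (hilbert_coeff r (\<alpha> j)) * (cnj (s j) * t j) powi \<alpha> j) has_sum torus_kernel d r s t)
    ({..<d} \<rightarrow>\<^sub>E UNIV)"
  unfolding torus_kernel_def using assms
  by (intro has_sum_prod_PiE(1) hilbert_kernel_has_sum) (auto simp: norm_mult norm_torus)

lemma norm_torus_monomial:
  "t \<in> space (torus_measure d) \<Longrightarrow> cmod (\<Prod>j<d. t j powi a j) = 1"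
  by (simp add: prod_norm[symmetric] norm_power_int norm_torus)

lemma integrable_torus_mult_monomial:
  assumes "integrable (torus_measure d) f"
  shows "integrable (torus_measure d) (\<lambda>t. f t * cnj (\<Prod>j<d. t j powi a j))"
proof (rule Bochner_Integration.integrable_bound[OF assms])
  have [measurable]: "f \<in> borel_measurable (torus_measure d)" using assms by auto
  have [measurable]: "(\<lambda>t. \<Prod>j<d. t j powi a j) \<in> borel_measurable (torus_measure d)"
    by (rule borel_measurable_integrable[OF integrable_torus_monomial])
  show "(\<lambda>t. f t * cnj (\<Prod>j<d. t j powi a j)) \<in> borel_measurable (torus_measure d)"
    by measurable
  show "AE t in torus_measure d. norm (f t * cnj (\<Prod>j<d. t j powi a j)) \<le> norm (f t)"
    by (intro AE_I2) (simp add: norm_mult norm_torus_monomial del: cnj_prod)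
qed

text \<open>The kernel is a function of \<open>cnj (s\<^sub>j) t\<^sub>j\<close>, so integrating its Fourier series term by term against
  \<open>f(s) cnj (g(t))\<close> pairs the Fourier coefficients of \<open>f\<close> and \<open>g\<close> at equal frequencies, with the coefficients of the
  symbol as weights.\<close>

lemma torus_form_has_sum_int:
  assumes f: "integrable (torus_measure d) f" and g: "integrable (torus_measure d) g"
    and r: "0 < r" "r < 1"
  shows "integrable (torus_measure d \<Otimes>\<^sub>M torus_measure d) (\<lambda>p. f (fst p) * cnj (g (snd p)) * torus_kernel d r (fst p) (snd p))"
    and "((\<lambda>\<alpha>. (\<Prod>j<d. of_real (hilbert_coeff r (\<alpha> j))) * (fourier_coeff d f \<alpha> * cnj (fourier_coeff d g \<alpha>))) has_sum
      (LINT p|(torus_measure d \<Otimes>\<^sub>M torus_measure d). f (fst p) * cnj (g (snd p)) * torus_kernel d r (fst p) (snd p)))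
      ({..<d} \<rightarrow>\<^sub>E UNIV)"
proof -
  let ?T = "torus_measure d"
  define F where "F \<alpha> p = (\<Prod>j<d. of_real (hilbert_coeff r (\<alpha> j))) *
    ((f (fst p) * cnj (\<Prod>j<d. fst p j powi \<alpha> j)) * cnj (g (snd p) * cnj (\<Prod>j<d. snd p j powi \<alpha> j)))"
    for \<alpha> :: "nat \<Rightarrow> int" and p
  define w where "w p = cmod (f (fst p)) * cmod (g (snd p))" for p
  define b where "b \<alpha> = (\<Prod>j<d. cmod (of_real (hilbert_coeff r (\<alpha> j)) * 1 powi \<alpha> j))" for \<alpha> :: "nat \<Rightarrow> int"
  define S where "S p = f (fst p) * cnj (g (snd p)) * torus_kernel d r (fst p) (snd p)" for p
  have int: "integrable (?T \<Otimes>\<^sub>M ?T) (F \<alpha>)"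
    and eq: "(LINT p|(?T \<Otimes>\<^sub>M ?T). F \<alpha> p) =
      (\<Prod>j<d. of_real (hilbert_coeff r (\<alpha> j))) * (fourier_coeff d f \<alpha> * cnj (fourier_coeff d g \<alpha>))" for \<alpha>
  proof -
    have a: "integrable ?T (\<lambda>s. f s * cnj (\<Prod>j<d. s j powi \<alpha> j))"
      using f by (rule integrable_torus_mult_monomial)
    have b: "integrable ?T (\<lambda>t. cnj (g t * cnj (\<Prod>j<d. t j powi \<alpha> j)))"
      using integrable_torus_mult_monomial[OF g] by (rule integrable_bounded_linear[OF bounded_linear_cnj])
    show "integrable (?T \<Otimes>\<^sub>M ?T) (F \<alpha>)"
      using torus_pair.integral_pair_mult(1)[OF a b] unfolding F_def
      by (intro integrable_mult_right) (simp add: case_prod_unfold)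
    have "(LINT p|(?T \<Otimes>\<^sub>M ?T). F \<alpha> p) = (\<Prod>j<d. of_real (hilbert_coeff r (\<alpha> j))) *
      (LINT p|(?T \<Otimes>\<^sub>M ?T). (f (fst p) * cnj (\<Prod>j<d. fst p j powi \<alpha> j)) * cnj (g (snd p) * cnj (\<Prod>j<d. snd p j powi \<alpha> j)))"
      unfolding F_def by (rule integral_mult_right_zero)
    also note torus_pair.integral_pair_mult(2)[OF a b]
    also note Bochner_Integration.integral_cnj
    finally show "(LINT p|(?T \<Otimes>\<^sub>M ?T). F \<alpha> p) =
      (\<Prod>j<d. of_real (hilbert_coeff r (\<alpha> j))) * (fourier_coeff d f \<alpha> * cnj (fourier_coeff d g \<alpha>))"
      unfolding fourier_coeff_def .
  qed
  have mf [measurable]: "f \<in> borel_measurable ?T" "g \<in> borel_measurable ?T" using f g by auto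
  have iw: "integrable (?T \<Otimes>\<^sub>M ?T) w"
    using integrable_norm[OF torus_pair.integral_pair_mult(1)[OF f g]]
    by (simp add: w_def[abs_def] case_prod_unfold norm_mult)
  have sb: "b summable_on ({..<d} \<rightarrow>\<^sub>E UNIV)"
    unfolding b_def
    using has_sum_prod_PiE(2)[of "{..<d}" "\<lambda>_. UNIV" "\<lambda>_ n. of_real (hilbert_coeff r n) * 1 powi n"
        "\<lambda>_. hilbert_kernel r 1"] hilbert_kernel_has_sum[OF r, of 1] by simp
  have S: "S \<in> borel_measurable (?T \<Otimes>\<^sub>M ?T)"
    using torus_kernel_measurable[OF r, of d] unfolding S_def case_prod_unfold
    by (intro borel_measurable_times borel_measurable_cnj) auto
  have sum: "((\<lambda>\<alpha>. F \<alpha> p) has_sum S p) ({..<d} \<rightarrow>\<^sub>E UNIV)" if "p \<in> space (?T \<Otimes>\<^sub>M ?T)" for p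
  proof -
    have p: "fst p \<in> space ?T" "snd p \<in> space ?T"
      using that by (auto simp: space_pair_measure)
    have "cnj (z powi n) = cnj z powi n" for z n
      by (simp add: power_int_def)
    then have "F \<alpha> p = f (fst p) * cnj (g (snd p)) *
        (\<Prod>j<d. of_real (hilbert_coeff r (\<alpha> j)) * (cnj (fst p j) * snd p j) powi \<alpha> j)" for \<alpha>
      by (simp add: F_def power_int_mult_distrib prod.distrib)
    then show ?thesis
      unfolding S_def by (simp only:) (intro has_sum_cmult_right torus_kernel_has_sum r p)
  qed
  have bd: "cmod (F \<alpha> p) \<le> b \<alpha> * w p" if "p \<in> space (?T \<Otimes>\<^sub>M ?T)" for \<alpha> p
  proof -
    have p: "fst p \<in> space ?T" "snd p \<in> space ?T"
      using that by (auto simp: space_pair_measure)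
    show ?thesis
      using p by (simp add: F_def b_def w_def norm_mult norm_torus_monomial del: cnj_prod of_real_prod)
        (simp add: prod_norm[symmetric])
  qed
  note * = has_sum_integral[of "{..<d} \<rightarrow>\<^sub>E UNIV" F "?T \<Otimes>\<^sub>M ?T" S w b, OF _ S iw sb bd sum]
  show "integrable (?T \<Otimes>\<^sub>M ?T) (\<lambda>p. f (fst p) * cnj (g (snd p)) * torus_kernel d r (fst p) (snd p))"
    using *(1) int by (auto simp: S_def[abs_def])
  show "((\<lambda>\<alpha>. (\<Prod>j<d. of_real (hilbert_coeff r (\<alpha> j))) * (fourier_coeff d f \<alpha> * cnj (fourier_coeff d g \<alpha>))) has_sum
      (LINT p|(?T \<Otimes>\<^sub>M ?T). f (fst p) * cnj (g (snd p)) * torus_kernel d r (fst p) (snd p))) ({..<d} \<rightarrow>\<^sub>E UNIV)"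
    using *(2) int by (auto simp: S_def eq)
qed

definition taylor_coeff :: "nat \<Rightarrow> ((nat \<Rightarrow> complex) \<Rightarrow> complex) \<Rightarrow> (nat \<Rightarrow> nat) \<Rightarrow> complex" where
  "taylor_coeff d f \<alpha> = fourier_coeff d f (\<lambda>j. int (\<alpha> j))"

text \<open>For functions in the Hardy space only the frequencies in \<open>\<nat>\<^sup>d\<close> survive. This is what makes the values
  of the symbol at the negative frequencies, and with them its boundedness, a matter of choice.\<close>

lemma torus_form_has_sum:
  assumes f: "f \<in> hardy1 d" and g: "g \<in> hardy1 d" and r: "0 < r" "r < 1"
  shows "((\<lambda>\<alpha>. (\<Prod>j<d. of_real (r ^ (\<alpha> j + 1) / (\<alpha> j + 1))) * (taylor_coeff d f \<alpha> * cnj (taylor_coeff d g \<alpha>))) has_sum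
      (LINT p|(torus_measure d \<Otimes>\<^sub>M torus_measure d). f (fst p) * cnj (g (snd p)) * torus_kernel d r (fst p) (snd p)))
      ({..<d} \<rightarrow>\<^sub>E (UNIV :: nat set))"
proof -
  let ?I = "LINT p|(torus_measure d \<Otimes>\<^sub>M torus_measure d). f (fst p) * cnj (g (snd p)) * torus_kernel d r (fst p) (snd p)"
  define G where "G \<alpha> = (\<Prod>j<d. complex_of_real (hilbert_coeff r (\<alpha> j))) * (fourier_coeff d f \<alpha> * cnj (fourier_coeff d g \<alpha>))"
    for \<alpha>
  define h where "h \<alpha> = restrict (\<lambda>j. int (\<alpha> j)) {..<d}" for \<alpha> :: "nat \<Rightarrow> nat"
  have inj: "inj_on h ({..<d} \<rightarrow>\<^sub>E UNIV)"
    by (rule inj_onI, rule ext) (metis PiE_arb h_def of_nat_eq_iff restrict_apply)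
  have "(G has_sum ?I) ({..<d} \<rightarrow>\<^sub>E UNIV)"
    unfolding G_def[abs_def] using f g r by (intro torus_form_has_sum_int(2)) (auto simp: hardy1_def)
  then have "(G has_sum ?I) (h ` ({..<d} \<rightarrow>\<^sub>E UNIV))"
  proof (rule has_sum_cong_neutral[THEN iffD1, rotated -1])
    fix \<alpha> assume \<alpha>: "\<alpha> \<in> ({..<d} \<rightarrow>\<^sub>E UNIV) - h ` ({..<d} \<rightarrow>\<^sub>E UNIV)"
    have "\<exists>j<d. \<alpha> j < 0"
    proof (rule ccontr)
      assume "\<not> ?thesis"
      then have "\<alpha> = h (restrict (\<lambda>j. nat (\<alpha> j)) {..<d})"
        using \<alpha> by (auto simp: h_def fun_eq_iff PiE_iff extensional_def restrict_def)
      with \<alpha> show False by auto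
    qed
    then show "G \<alpha> = 0" using f by (simp add: G_def hardy1_def)
  qed (auto simp: h_def)
  then have "((G \<circ> h) has_sum ?I) ({..<d} \<rightarrow>\<^sub>E UNIV)"
    by (subst (asm) has_sum_reindex[OF inj])
  moreover have "(G \<circ> h) = (\<lambda>\<alpha>. (\<Prod>j<d. of_real (r ^ (\<alpha> j + 1) / (\<alpha> j + 1))) * (taylor_coeff d f \<alpha> * cnj (taylor_coeff d g \<alpha>)))"
  proof (rule ext)
    fix \<alpha>
    have "fourier_coeff d k (h \<alpha>) = taylor_coeff d k \<alpha>" for k
      unfolding fourier_coeff_def taylor_coeff_def h_def by simp
    moreover have "hilbert_coeff r (int n) = r ^ (n + 1) / (n + 1)" for n
      by (simp add: hilbert_coeff_def nat_add_distrib)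
    ultimately show "(G \<circ> h) \<alpha> = (\<Prod>j<d. of_real (r ^ (\<alpha> j + 1) / (\<alpha> j + 1))) * (taylor_coeff d f \<alpha> * cnj (taylor_coeff d g \<alpha>))"
      by (simp add: G_def h_def)
  qed
  ultimately show ?thesis by (simp only:)
qed

lemma norm_taylor_coeff_le:
  assumes "integrable (torus_measure d) f"
  shows "cmod (taylor_coeff d f \<alpha>) \<le> (LINT t|torus_measure d. cmod (f t))"
proof -
  have "cmod (taylor_coeff d f \<alpha>) \<le> (LINT t|torus_measure d. cmod (f t * cnj (\<Prod>j<d. t j powi int (\<alpha> j))))"
    unfolding taylor_coeff_def fourier_coeff_def by (rule integral_norm_bound)
  also have "\<dots> = (LINT t|torus_measure d. cmod (f t))"
    by (intro Bochner_Integration.integral_cong) (simp_all only: norm_mult complex_mod_cnj norm_torus_monomial mult_1_right)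
  finally show ?thesis .
qed

section \<open>Power series on the polydisc\<close>

definition power_series :: "nat \<Rightarrow> ((nat \<Rightarrow> nat) \<Rightarrow> complex) \<Rightarrow> (nat \<Rightarrow> complex) \<Rightarrow> complex" where
  "power_series d a z = (\<Sum>\<^sub>\<infinity>\<alpha>\<in>{..<d} \<rightarrow>\<^sub>E UNIV. a \<alpha> * (\<Prod>j<d. z j ^ \<alpha> j))"

lemma multi_geometric_summable:
  fixes \<rho> C :: real and d :: nat
  assumes "0 \<le> \<rho>" "\<rho> < 1"
  shows "(\<lambda>\<alpha>. C * (\<Prod>j<d. \<rho> ^ \<alpha> j)) summable_on ({..<d} \<rightarrow>\<^sub>E (UNIV :: nat set))"
proof -
  have s: "((\<lambda>n. complex_of_real \<rho> ^ n) has_sum 1 / (1 - of_real \<rho>)) (UNIV :: nat set)"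
    using assms
    by (intro norm_summable_imp_has_sum geometric_sums) (auto simp: norm_power intro!: summable_geometric)
  have "(\<lambda>\<alpha>. \<Prod>j<d. cmod (complex_of_real \<rho> ^ \<alpha> j)) summable_on ({..<d} \<rightarrow>\<^sub>E (UNIV :: nat set))"
    using has_sum_prod_PiE(2)[of "{..<d}" "\<lambda>_. UNIV" "\<lambda>_ n. complex_of_real \<rho> ^ n", OF _ _ s] by simp
  then show ?thesis
    using assms by (intro summable_on_cmult_right) (simp add: norm_power)
qed

lemma norm_monomial_le:
  assumes "\<And>j. j < d \<Longrightarrow> cmod (z j) \<le> \<rho>"
  shows "cmod (\<Prod>j<d. z j ^ \<alpha> j) \<le> (\<Prod>j<d. \<rho> ^ \<alpha> j)"
  using assms by (auto simp: prod_norm[symmetric] norm_power intro!: prod_mono power_mono)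

lemma norm_power_series_term_le:
  assumes "\<And>\<alpha>. cmod (a \<alpha>) \<le> C" "\<And>j. j < d \<Longrightarrow> cmod (z j) \<le> \<rho>"
  shows "cmod (a \<alpha> * (\<Prod>j<d. z j ^ \<alpha> j)) \<le> C * (\<Prod>j<d. \<rho> ^ \<alpha> j)"
  unfolding norm_mult
  using order_trans[OF norm_ge_zero assms(1)]
  by (intro mult_mono assms(1) norm_monomial_le assms(2)) auto

lemma power_series_uniform_limit:
  assumes "\<And>\<alpha>. cmod (a \<alpha>) \<le> C" "0 \<le> \<rho>" "\<rho> < 1" "\<And>z j. z \<in> Z \<Longrightarrow> j < d \<Longrightarrow> cmod (z j) \<le> \<rho>"
  shows "uniform_limit Z (\<lambda>X z. \<Sum>\<alpha>\<in>X. a \<alpha> * (\<Prod>j<d. z j ^ \<alpha> j)) (power_series d a)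
    (finite_subsets_at_top ({..<d} \<rightarrow>\<^sub>E UNIV))"
  unfolding power_series_def
  by (rule Weierstrass_m_test_general[OF norm_power_series_term_le multi_geometric_summable])
    (use assms in auto)

lemma polydisc_radius:
  fixes d :: nat
  assumes "\<And>j. j < d \<Longrightarrow> cmod (z j) < 1"
  obtains \<rho> where "0 < \<rho>" "\<rho> < 1" "\<And>j. j < d \<Longrightarrow> cmod (z j) < \<rho>"
proof -
  define m where "m = Max (insert 0 ((\<lambda>j. cmod (z j)) ` {..<d}))"
  have m: "m < 1" "0 \<le> m" "\<And>j. j < d \<Longrightarrow> cmod (z j) \<le> m"
    using assms by (auto simp: m_def intro!: Max_ge)
  obtain \<rho> where "m < \<rho>" "\<rho> < 1" using dense[OF m(1)] by blast
  then show ?thesis using m by (intro that[of \<rho>]) (auto intro: le_less_trans)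
qed

text \<open>Absolute convergence by comparison with a geometric series in \<open>\<rho>\<close>, where \<open>\<rho> < 1\<close> exceeds the moduli of
  all coordinates.\<close>

lemma power_series_has_sum:
  assumes "\<And>\<alpha>. cmod (a \<alpha>) \<le> C" "\<And>j. j < d \<Longrightarrow> cmod (z j) < 1"
  shows "((\<lambda>\<alpha>. a \<alpha> * (\<Prod>j<d. z j ^ \<alpha> j)) has_sum power_series d a z) ({..<d} \<rightarrow>\<^sub>E UNIV)"
proof -
  obtain \<rho> where \<rho>: "0 < \<rho>" "\<rho> < 1" "\<And>j. j < d \<Longrightarrow> cmod (z j) < \<rho>"
    using polydisc_radius[of d z] assms(2) by blast
  have "(\<lambda>\<alpha>. norm (a \<alpha> * (\<Prod>j<d. z j ^ \<alpha> j))) summable_on ({..<d} \<rightarrow>\<^sub>E UNIV)"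
    using \<rho> assms(1)
    by (intro Infinite_Sum.abs_summable_on_comparison_test'[OF multi_geometric_summable[of \<rho> C]]
        norm_power_series_term_le) (auto intro: less_imp_le)
  then show ?thesis
    unfolding power_series_def by (simp add: abs_summable_summable)
qed

text \<open>Near each point the series converges uniformly, namely on the neighbourhood of all \<open>z\<close> with
  \<open>\<bar>z\<^sub>j\<bar> < \<rho>\<close> for \<open>j < d\<close>, which is open in the product topology.\<close>

lemma continuous_on_power_series:
  assumes a: "\<And>\<alpha>. cmod (a \<alpha>) \<le> C"
  shows "continuous_on (polydisc d) (power_series d a)"
proof (intro continuous_at_imp_continuous_on ballI)
  fix z assume "z \<in> polydisc d"
  then have "\<And>j. j < d \<Longrightarrow> cmod (z j) < 1" by (auto simp: polydisc_def PiE_iff)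
  then obtain \<rho> where \<rho>: "0 < \<rho>" "\<rho> < 1" "\<And>j. j < d \<Longrightarrow> cmod (z j) < \<rho>"
    using polydisc_radius by blast
  define U where "U = {z :: nat \<Rightarrow> complex. \<forall>j\<in>{..<d}. cmod (z j) < \<rho>}"
  have "U = (\<Inter>j\<in>{..<d}. {z. cmod (z j) < \<rho>})" by (auto simp: U_def)
  then have U: "open U"
    by (auto intro!: open_INT open_Collect_less continuous_intros)
  have "uniform_limit U (\<lambda>X z. \<Sum>\<alpha>\<in>X. a \<alpha> * (\<Prod>j<d. z j ^ \<alpha> j)) (power_series d a)
      (finite_subsets_at_top ({..<d} \<rightarrow>\<^sub>E UNIV))"
    using \<rho> by (intro power_series_uniform_limit[OF a, of \<rho>]) (auto simp: U_def intro: less_imp_le)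
  then have "continuous_on U (power_series d a)"
  proof (rule uniform_limit_theorem[rotated])
    have "continuous_on U (\<lambda>z. z j)" for j
      by (rule continuous_on_subset[OF continuous_on_product_coordinates]) simp
    then show "\<forall>\<^sub>F X in finite_subsets_at_top ({..<d} \<rightarrow>\<^sub>E UNIV).
        continuous_on U (\<lambda>z. \<Sum>\<alpha>\<in>X. a \<alpha> * (\<Prod>j<d. z j ^ \<alpha> j))"
      by (intro always_eventually allI continuous_intros)
  qed simp
  moreover have "z \<in> U" using \<rho> by (auto simp: U_def)
  ultimately show "continuous (at z) (power_series d a)"
    using U continuous_on_eq_continuous_at by blast
qed

lemma power_series_holomorphic:
  assumes a: "\<And>\<alpha>. cmod (a \<alpha>) \<le> C" and z: "z \<in> polydisc d" and "i < d"
  shows "(\<lambda>w. power_series d a (z(i := w))) holomorphic_on ball 0 1"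
  unfolding holomorphic_on_def
proof
  fix w0 :: complex assume "w0 \<in> ball 0 1"
  then obtain r where r: "cmod w0 < r" "r < 1" using dense[of "cmod w0" 1] by auto
  have "\<And>j. j < d \<Longrightarrow> cmod (z j) < 1" using z by (auto simp: polydisc_def PiE_iff)
  then obtain \<rho>' where \<rho>': "0 < \<rho>'" "\<rho>' < 1" "\<And>j. j < d \<Longrightarrow> cmod (z j) < \<rho>'"
    using polydisc_radius by blast
  define \<rho> where "\<rho> = max \<rho>' r"
  have "uniform_limit ((\<lambda>w. z(i := w)) ` cball 0 r) (\<lambda>X z. \<Sum>\<alpha>\<in>X. a \<alpha> * (\<Prod>j<d. z j ^ \<alpha> j)) (power_series d a)
      (finite_subsets_at_top ({..<d} \<rightarrow>\<^sub>E UNIV))"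
  proof (rule power_series_uniform_limit[OF a, of \<rho>])
    fix y j assume "y \<in> (\<lambda>w. z(i := w)) ` cball 0 r" "j < d"
    then show "cmod (y j) \<le> \<rho>" using \<rho>'(3)[of j] by (auto simp: \<rho>_def)
  qed (use \<rho>' r in \<open>auto simp: \<rho>_def\<close>)
  then have lim: "uniform_limit (cball 0 r) (\<lambda>X w. \<Sum>\<alpha>\<in>X. a \<alpha> * (\<Prod>j<d. (z(i := w)) j ^ \<alpha> j)) (\<lambda>w. power_series d a (z(i := w)))
      (finite_subsets_at_top ({..<d} \<rightarrow>\<^sub>E UNIV))"
    by (auto simp: uniform_limit_iff)
  have hol: "(\<lambda>w. \<Sum>\<alpha>\<in>X. a \<alpha> * (\<Prod>j<d. (z(i := w)) j ^ \<alpha> j)) holomorphic_on UNIV" for X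
  proof (intro holomorphic_intros)
    show "(\<lambda>w. (z(i := w)) j) holomorphic_on UNIV" for j
      by (cases "j = i") (auto intro!: holomorphic_intros)
  qed
  have "\<forall>\<^sub>F X in finite_subsets_at_top ({..<d} \<rightarrow>\<^sub>E (UNIV :: nat set)).
      continuous_on (cball 0 r) (\<lambda>w. \<Sum>\<alpha>\<in>X. a \<alpha> * (\<Prod>j<d. (z(i := w)) j ^ \<alpha> j)) \<and>
      (\<lambda>w. \<Sum>\<alpha>\<in>X. a \<alpha> * (\<Prod>j<d. (z(i := w)) j ^ \<alpha> j)) holomorphic_on ball 0 r"
    by (intro always_eventually allI conjI holomorphic_on_imp_continuous_on; rule holomorphic_on_subset[OF hol]) simp_all
  from holomorphic_uniform_limit[OF this lim finite_subsets_at_top_neq_bot]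
  have "(\<lambda>w. power_series d a (z(i := w))) holomorphic_on ball 0 r"
    by blast
  then have "(\<lambda>w. power_series d a (z(i := w))) field_differentiable at w0"
    using r by (intro holomorphic_on_imp_differentiable_at) auto
  then show "(\<lambda>w. power_series d a (z(i := w))) field_differentiable at w0 within ball 0 1"
    by (rule field_differentiable_at_within)
qed

interpretation disk: product_sigma_finite "\<lambda>_ :: nat. disk_measure"
  by standard (rule finite_measure.axioms(1)[OF finite_measure_disk, THEN sigma_finite_measure.sigma_finite_countable])

lemma space_polydisc_measure: "space (polydisc_measure d) = polydisc d"
  by (simp add: polydisc_measure_def space_PiM polydisc_def)

lemma measurable_polydisc_component [measurable (raw)]:
  assumes "f \<in> borel_measurable borel" "j < d"
  shows "(\<lambda>z. f (z j)) \<in> borel_measurable (polydisc_measure d)"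
  unfolding polydisc_measure_def
proof (rule measurable_compose[OF _ borel_measurable_disk[OF assms(1)]])
  show "(\<lambda>z. z j) \<in> measurable (PiM {..<d} (\<lambda>_. disk_measure)) disk_measure"
    using assms(2) by (intro measurable_component_singleton) simp
qed

text \<open>The sums over the boxes \<open>{..<n}\<^sup>d\<close> are a countable subfamily of the finite partial sums that is cofinal
  among them.\<close>

lemma borel_measurable_power_series:
  assumes a: "\<And>\<alpha>. cmod (a \<alpha>) \<le> C"
  shows "power_series d a \<in> borel_measurable (polydisc_measure d)"
proof (rule borel_measurable_LIMSEQ_metric)
  let ?A = "{..<d} \<rightarrow>\<^sub>E (UNIV :: nat set)" and ?F = "\<lambda>n :: nat. {..<d} \<rightarrow>\<^sub>E {..<n}"
  have lim: "filterlim ?F (finite_subsets_at_top ?A) sequentially"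
    unfolding filterlim_finite_subsets_at_top
  proof (intro allI impI)
    fix X assume X: "finite X \<and> X \<subseteq> ?A"
    define N where "N = Suc (Max (insert 0 (\<Union>\<alpha>\<in>X. \<alpha> ` {..<d})))"
    have "\<alpha> j < N" if "\<alpha> \<in> X" "j < d" for \<alpha> j
      using X that unfolding N_def less_Suc_eq_le by (intro Max_ge) auto
    then have "X \<subseteq> ?F n" if "N \<le> n" for n
    proof (intro subsetI PiE_I)
      fix \<alpha> j assume "\<alpha> \<in> X" "j \<in> {..<d}"
      then show "\<alpha> j \<in> {..<n}"
        using \<open>\<And>j \<alpha>. \<alpha> \<in> X \<Longrightarrow> j < d \<Longrightarrow> \<alpha> j < N\<close>[of \<alpha> j] that by simp
    next
      fix \<alpha> j assume "\<alpha> \<in> X" "j \<notin> {..<d}"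
      then show "\<alpha> j = undefined" using X by (auto simp: PiE_iff extensional_def)
    qed
    then show "\<forall>\<^sub>F n in sequentially. finite (?F n) \<and> X \<subseteq> ?F n \<and> ?F n \<subseteq> ?A"
      by (intro eventually_sequentiallyI[of N]) (auto intro!: finite_PiE simp: PiE_iff)
  qed
  show "(\<lambda>n. \<Sum>\<alpha>\<in>?F n. a \<alpha> * (\<Prod>j<d. z j ^ \<alpha> j)) \<longlonglongrightarrow> power_series d a z"
    if "z \<in> space (polydisc_measure d)" for z
  proof -
    have "((\<lambda>\<alpha>. a \<alpha> * (\<Prod>j<d. z j ^ \<alpha> j)) has_sum power_series d a z) ?A"
      using that by (intro power_series_has_sum[OF a]) (auto simp: space_polydisc_measure polydisc_def PiE_iff)
    then show ?thesis
      unfolding has_sum_def by (rule filterlim_compose[OF _ lim])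
  qed
  show "(\<lambda>z. \<Sum>\<alpha>\<in>?F n. a \<alpha> * (\<Prod>j<d. z j ^ \<alpha> j)) \<in> borel_measurable (polydisc_measure d)" for n
    by (intro borel_measurable_sum borel_measurable_times borel_measurable_const borel_measurable_prod
        measurable_polydisc_component) auto
qed

text \<open>The indicator function of the polydisc of radius \<open>\<rho>\<close>, as a product so that Fubini's theorem applies
  coordinatewise.\<close>

definition cutoff :: "nat \<Rightarrow> real \<Rightarrow> (nat \<Rightarrow> complex) \<Rightarrow> real" where
  "cutoff d \<rho> z = (\<Prod>j<d. indicator {..<\<rho>} (cmod (z j)))"

lemma cutoff_eq: "cutoff d \<rho> z = (if \<forall>j<d. cmod (z j) < \<rho> then 1 else 0)"
  unfolding cutoff_def by (auto simp: indicator_def)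

lemma borel_measurable_cutoff [measurable]: "cutoff d \<rho> \<in> borel_measurable (polydisc_measure d)"
  unfolding cutoff_def[abs_def]
  by (intro borel_measurable_prod measurable_polydisc_component) auto

lemma integral_polydisc_monomials:
  assumes "0 < \<rho>" "\<rho> \<le> 1"
  shows "integrable (polydisc_measure d) (\<lambda>z. (\<Prod>j<d. z j ^ \<alpha> j) * cnj (\<Prod>j<d. z j ^ \<beta> j) * of_real (cutoff d \<rho> z))" (is ?I)
    and "(LINT z|polydisc_measure d. (\<Prod>j<d. z j ^ \<alpha> j) * cnj (\<Prod>j<d. z j ^ \<beta> j) * of_real (cutoff d \<rho> z)) =
     (if \<forall>j<d. \<alpha> j = \<beta> j then of_real (\<Prod>j<d. \<rho> ^ (2 * \<alpha> j + 2) / (\<alpha> j + 1)) else 0)" (is ?E)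
proof -
  have eq: "(\<Prod>j<d. z j ^ \<alpha> j) * cnj (\<Prod>j<d. z j ^ \<beta> j) * of_real (cutoff d \<rho> z) =
      (\<Prod>j<d. z j ^ \<alpha> j * cnj (z j) ^ \<beta> j * of_real (indicator {..<\<rho>} (cmod (z j))))" for z
    by (simp add: cutoff_def prod.distrib)
  have int: "integrable disk_measure (\<lambda>z. z ^ m * cnj z ^ n * complex_of_real (indicator {..<\<rho>} (cmod z)))" for m n
  proof (rule finite_measure.integrable_const_bound[OF finite_measure_disk, where B = 1])
    have "cmod (x ^ m * cnj x ^ n * complex_of_real (indicator {..<\<rho>} (cmod x))) \<le> 1" if "cmod x < 1" for x
      using that by (auto simp: norm_mult norm_power indicator_def intro!: mult_le_one power_le_one)
    then show "AE x in disk_measure. norm (x ^ m * cnj x ^ n * complex_of_real (indicator {..<\<rho>} (cmod x))) \<le> 1"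
      by (intro AE_I2) auto
  qed measurable
  show ?I
    unfolding eq polydisc_measure_def by (intro disk.product_integrable_prod int) simp
  have "(\<Prod>j<d. if \<alpha> j = \<beta> j then complex_of_real (\<rho> ^ (2 * \<alpha> j + 2) / (\<alpha> j + 1)) else 0) =
      (if \<forall>j<d. \<alpha> j = \<beta> j then of_real (\<Prod>j<d. \<rho> ^ (2 * \<alpha> j + 2) / (\<alpha> j + 1)) else 0)"
    by auto
  then show ?E
    unfolding eq polydisc_measure_def
    using assms by (subst disk.product_integral_prod[OF _ int]) (simp_all add: integral_disk_monomials)
qed

lemma polydisc_series_monomial:
  assumes a: "\<And>\<alpha>. cmod (a \<alpha>) \<le> C" and \<rho>: "0 < \<rho>" "\<rho> < 1" and \<beta>: "\<beta> \<in> {..<d} \<rightarrow>\<^sub>E UNIV"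
  shows "integrable (polydisc_measure d) (\<lambda>z. power_series d a z * cnj (\<Prod>j<d. z j ^ \<beta> j) * of_real (cutoff d \<rho> z))" (is ?I)
    and "(LINT z|polydisc_measure d. power_series d a z * cnj (\<Prod>j<d. z j ^ \<beta> j) * of_real (cutoff d \<rho> z)) =
      a \<beta> * of_real (\<Prod>j<d. \<rho> ^ (2 * \<beta> j + 2) / (\<beta> j + 1))" (is "?L = ?R")
proof -
  let ?A = "{..<d} \<rightarrow>\<^sub>E (UNIV :: nat set)"
  define E where "E \<alpha> z = a \<alpha> * ((\<Prod>j<d. z j ^ \<alpha> j) * cnj (\<Prod>j<d. z j ^ \<beta> j) * of_real (cutoff d \<rho> z))" for \<alpha> z
  define S where "S z = power_series d a z * cnj (\<Prod>j<d. z j ^ \<beta> j) * of_real (cutoff d \<rho> z)" for z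
  have E: "E \<alpha> \<in> borel_measurable (polydisc_measure d)" for \<alpha>
    using integral_polydisc_monomials(1)[OF \<rho>(1) less_imp_le[OF \<rho>(2)], of d \<alpha> \<beta>] unfolding E_def by (intro borel_measurable_times) auto
  have S: "S \<in> borel_measurable (polydisc_measure d)"
    unfolding S_def
    by (intro borel_measurable_times borel_measurable_power_series[OF a] borel_measurable_cnj borel_measurable_prod
        borel_measurable_of_real borel_measurable_cutoff measurable_polydisc_component) auto
  have w: "integrable (polydisc_measure d) (\<lambda>z. 1 :: real)"
  proof -
    have "integrable (polydisc_measure d) (\<lambda>z. \<Prod>j<d. (1 :: real))"
      unfolding polydisc_measure_def
      by (intro disk.product_integrable_prod finite_measure.integrable_const[OF finite_measure_disk]) simp
    then show ?thesis by simp
  qed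
  have b: "(\<lambda>\<alpha>. C * (\<Prod>j<d. \<rho> ^ \<alpha> j)) summable_on ?A"
    using \<rho> by (intro multi_geometric_summable) auto
  have bd: "cmod (E \<alpha> z) \<le> (C * (\<Prod>j<d. \<rho> ^ \<alpha> j)) * 1" if "z \<in> space (polydisc_measure d)" for \<alpha> z
  proof (cases "\<forall>j<d. cmod (z j) < \<rho>")
    case True
    have "cmod (\<Prod>j<d. z j ^ \<beta> j) \<le> (\<Prod>j<d. \<rho> ^ \<beta> j)"
      using True by (intro norm_monomial_le) (auto intro: less_imp_le)
    also have "\<dots> \<le> 1"
      using \<rho> by (intro prod_le_1) (auto intro: power_le_one)
    finally have 1: "cmod (\<Prod>j<d. z j ^ \<beta> j) \<le> 1" .
    have 2: "cmod (a \<alpha> * (\<Prod>j<d. z j ^ \<alpha> j)) \<le> C * (\<Prod>j<d. \<rho> ^ \<alpha> j)"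
      using True by (intro norm_power_series_term_le[OF a]) (auto intro: less_imp_le)
    have "cmod (E \<alpha> z) = cmod (a \<alpha> * (\<Prod>j<d. z j ^ \<alpha> j)) * cmod (\<Prod>j<d. z j ^ \<beta> j)"
      using True by (simp add: E_def norm_mult cutoff_eq del: cnj_prod)
    also have "\<dots> \<le> (C * (\<Prod>j<d. \<rho> ^ \<alpha> j)) * 1"
      using 1 2 by (intro mult_mono) (auto intro: order_trans[OF norm_ge_zero])
    finally show ?thesis .
  next
    case False
    then have "E \<alpha> z = 0" by (auto simp: E_def cutoff_eq)
    moreover have "0 \<le> C * (\<Prod>j<d. \<rho> ^ \<alpha> j)"
      using \<rho> order_trans[OF norm_ge_zero a] by (intro mult_nonneg_nonneg prod_nonneg) auto
    ultimately show ?thesis by simp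
  qed
  have sum: "((\<lambda>\<alpha>. E \<alpha> z) has_sum S z) ?A" if "z \<in> space (polydisc_measure d)" for z
  proof -
    have "((\<lambda>\<alpha>. a \<alpha> * (\<Prod>j<d. z j ^ \<alpha> j) * (cnj (\<Prod>j<d. z j ^ \<beta> j) * of_real (cutoff d \<rho> z))) has_sum
        power_series d a z * (cnj (\<Prod>j<d. z j ^ \<beta> j) * of_real (cutoff d \<rho> z))) ?A"
      using that by (intro has_sum_cmult_left power_series_has_sum[OF a])
        (auto simp: space_polydisc_measure polydisc_def PiE_iff)
    then show ?thesis by (simp add: E_def S_def mult.assoc)
  qed
  note * = has_sum_integral[of ?A E "polydisc_measure d" S "\<lambda>_. 1" "\<lambda>\<alpha>. C * (\<Prod>j<d. \<rho> ^ \<alpha> j)", OF E S w b bd sum]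
  show ?I using *(1) by (simp add: S_def[abs_def])
  have "((\<lambda>\<alpha>. LINT z|polydisc_measure d. E \<alpha> z) has_sum ?L) ?A"
    using *(2) by (simp add: S_def)
  moreover have "((\<lambda>\<alpha>. LINT z|polydisc_measure d. E \<alpha> z) has_sum ?R) ?A"
  proof -
    have int: "(LINT z|polydisc_measure d. E \<alpha> z) = (if \<alpha> = \<beta> then ?R else 0)" if "\<alpha> \<in> ?A" for \<alpha>
    proof -
      have "(\<forall>j<d. \<alpha> j = \<beta> j) \<longleftrightarrow> \<alpha> = \<beta>"
        using that \<beta> by (auto intro: PiE_ext)
      moreover have "(LINT z|polydisc_measure d. E \<alpha> z) = a \<alpha> *
         (if \<forall>j<d. \<alpha> j = \<beta> j then of_real (\<Prod>j<d. \<rho> ^ (2 * \<alpha> j + 2) / (\<alpha> j + 1)) else 0)"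
        unfolding E_def integral_mult_right_zero integral_polydisc_monomials(2)[OF \<rho>(1) less_imp_le[OF \<rho>(2)]] ..
      ultimately show ?thesis by auto
    qed
    have "((\<lambda>\<alpha>. LINT z|polydisc_measure d. E \<alpha> z) has_sum (\<Sum>\<alpha>\<in>{\<beta>}. LINT z|polydisc_measure d. E \<alpha> z)) ?A"
      by (rule has_sum_finite_neutralI[of "{\<beta>}"]) (use \<beta> int in auto)
    then show ?thesis using int[OF \<beta>] by simp
  qed
  ultimately show "?L = ?R" by (rule has_sum_unique)
qed

text \<open>Both series are integrated term by term, one after the other: the inner products with a fixed monomial
  are \<open>polydisc_series_monomial\<close>, and the second series is dominated by a multiple of the first factor.\<close>

lemma polydisc_form_has_sum:
  assumes a: "\<And>\<alpha>. cmod (a \<alpha>) \<le> C" and b: "\<And>\<alpha>. cmod (b \<alpha>) \<le> D" and \<rho>: "0 < \<rho>" "\<rho> < 1"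
  shows "integrable (polydisc_measure d) (\<lambda>z. power_series d a z * cnj (power_series d b z) * of_real (cutoff d \<rho> z))" (is ?I)
    and "((\<lambda>\<beta>. (\<Prod>j<d. of_real ((\<rho>\<^sup>2) ^ (\<beta> j + 1) / (\<beta> j + 1))) * (a \<beta> * cnj (b \<beta>))) has_sum
      (LINT z|polydisc_measure d. power_series d a z * cnj (power_series d b z) * of_real (cutoff d \<rho> z)))
      ({..<d} \<rightarrow>\<^sub>E UNIV)" (is ?S)
proof -
  let ?A = "{..<d} \<rightarrow>\<^sub>E (UNIV :: nat set)"
  define E where "E \<beta> z = cnj (b \<beta>) * (power_series d a z * cnj (\<Prod>j<d. z j ^ \<beta> j) * of_real (cutoff d \<rho> z))" for \<beta> z
  define S where "S z = power_series d a z * cnj (power_series d b z) * of_real (cutoff d \<rho> z)" for z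
  define w where "w z = cmod (power_series d a z * of_real (cutoff d \<rho> z))" for z
  have E: "E \<beta> \<in> borel_measurable (polydisc_measure d)" if "\<beta> \<in> ?A" for \<beta>
    using borel_measurable_integrable[OF polydisc_series_monomial(1)[where a = a and C = C, OF a \<rho> that]]
    unfolding E_def by (rule borel_measurable_times[OF borel_measurable_const])
  have S: "S \<in> borel_measurable (polydisc_measure d)"
    unfolding S_def
    by (intro borel_measurable_times borel_measurable_power_series[OF a] borel_measurable_power_series[OF b]
        borel_measurable_cnj borel_measurable_of_real borel_measurable_cutoff) auto
  have w: "integrable (polydisc_measure d) w"
    using integrable_norm[OF polydisc_series_monomial(1)[where a = a and C = C, OF a \<rho>, of "restrict (\<lambda>_. 0) {..<d}" d]]
    by (simp add: w_def[abs_def] norm_mult)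
  have s: "(\<lambda>\<alpha>. D * (\<Prod>j<d. \<rho> ^ \<alpha> j)) summable_on ?A"
    using \<rho> by (intro multi_geometric_summable) auto
  have bd: "cmod (E \<beta> z) \<le> (D * (\<Prod>j<d. \<rho> ^ \<beta> j)) * w z" if "z \<in> space (polydisc_measure d)" for \<beta> z
  proof (cases "\<forall>j<d. cmod (z j) < \<rho>")
    case True
    have 2: "cmod (b \<beta> * (\<Prod>j<d. z j ^ \<beta> j)) \<le> D * (\<Prod>j<d. \<rho> ^ \<beta> j)"
      using True by (intro norm_power_series_term_le[OF b]) (auto intro: less_imp_le)
    have "cmod (E \<beta> z) = cmod (b \<beta> * (\<Prod>j<d. z j ^ \<beta> j)) * w z"
      by (simp add: E_def w_def norm_mult del: cnj_prod)
    also have "\<dots> \<le> (D * (\<Prod>j<d. \<rho> ^ \<beta> j)) * w z"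
      using 2 by (intro mult_right_mono) (auto simp: w_def)
    finally show ?thesis .
  qed (auto simp: E_def w_def cutoff_eq)
  have sum: "((\<lambda>\<beta>. E \<beta> z) has_sum S z) ?A" if "z \<in> space (polydisc_measure d)" for z
  proof -
    have "((\<lambda>\<beta>. b \<beta> * (\<Prod>j<d. z j ^ \<beta> j)) has_sum power_series d b z) ?A"
      using that by (intro power_series_has_sum[OF b]) (auto simp: space_polydisc_measure polydisc_def PiE_iff)
    then have "((\<lambda>\<beta>. cnj (b \<beta> * (\<Prod>j<d. z j ^ \<beta> j)) * (power_series d a z * of_real (cutoff d \<rho> z))) has_sum
        cnj (power_series d b z) * (power_series d a z * of_real (cutoff d \<rho> z))) ?A"
      by (intro has_sum_cmult_left has_sum_bounded_linear[OF bounded_linear_cnj])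
    then show ?thesis by (simp add: E_def S_def mult_ac)
  qed
  note * = has_sum_integral[of ?A E "polydisc_measure d" S w "\<lambda>\<alpha>. D * (\<Prod>j<d. \<rho> ^ \<alpha> j)", OF E S w s bd sum]
  show ?I using *(1) by (simp add: S_def[abs_def])
  have "((\<lambda>\<beta>. LINT z|polydisc_measure d. E \<beta> z) has_sum
      (LINT z|polydisc_measure d. power_series d a z * cnj (power_series d b z) * of_real (cutoff d \<rho> z))) ?A"
    using *(2) by (simp add: S_def)
  moreover have "(LINT z|polydisc_measure d. E \<beta> z) =
      (\<Prod>j<d. of_real ((\<rho>\<^sup>2) ^ (\<beta> j + 1) / (\<beta> j + 1))) * (a \<beta> * cnj (b \<beta>))" if "\<beta> \<in> ?A" for \<beta>
  proof -
    have "(\<rho>\<^sup>2) ^ (n + 1) = \<rho> ^ (2 * n + 2)" for n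
      by (subst power_mult[symmetric]) simp
    then show ?thesis
      unfolding E_def integral_mult_right_zero polydisc_series_monomial(2)[where a = a and C = C, OF a \<rho> that]
      by (simp only: of_real_prod mult_ac)
  qed
  ultimately show ?S
    by (subst (asm) has_sum_cong) auto
qed

section \<open>The upper bound\<close>

lemma hol_ext_eq: "hol_ext d f = power_series d (taylor_coeff d f)"
  by (rule ext) (simp add: hol_ext_def power_series_def taylor_coeff_def)

lemma hardy1_integrable: "f \<in> hardy1 d \<Longrightarrow> integrable (torus_measure d) f"
  by (simp add: hardy1_def)

text \<open>Both sides are the sum of \<open>a\<^sub>\<alpha> cnj (b\<^sub>\<alpha>) \<Prod>\<^sub>j (\<rho>\<^sup>2)\<^sup>k / k\<close> with \<open>k = \<alpha>\<^sub>j + 1\<close> over \<open>\<alpha> \<in> \<nat>\<^sup>d\<close>, where \<open>a\<^sub>\<alpha>\<close> and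
  \<open>b\<^sub>\<alpha>\<close> are the Fourier coefficients of \<open>f\<close> and \<open>g\<close>.\<close>

lemma hol_ext_form_eq:
  assumes f: "f \<in> hardy1 d" and g: "g \<in> hardy1 d" and \<rho>: "0 < \<rho>" "\<rho> < 1"
  shows "(LINT z|polydisc_measure d. hol_ext d f z * cnj (hol_ext d g z) * of_real (cutoff d \<rho> z)) =
    (LINT p|(torus_measure d \<Otimes>\<^sub>M torus_measure d). f (fst p) * cnj (g (snd p)) * torus_kernel d (\<rho>\<^sup>2) (fst p) (snd p))"
proof -
  have r: "0 < \<rho>\<^sup>2" "\<rho>\<^sup>2 < 1" using \<rho> by (simp_all add: power_less_one_iff)
  show ?thesis
    unfolding hol_ext_eq
    using polydisc_form_has_sum(2)[where a = "taylor_coeff d f" and b = "taylor_coeff d g",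
        OF norm_taylor_coeff_le[OF hardy1_integrable[OF f]] norm_taylor_coeff_le[OF hardy1_integrable[OF g]] \<rho>]
      torus_form_has_sum[OF f g r]
    by (rule has_sum_unique)
qed

lemma hol_ext_form_integrable:
  assumes f: "f \<in> hardy1 d" and g: "g \<in> hardy1 d" and \<rho>: "0 < \<rho>" "\<rho> < 1"
  shows "integrable (polydisc_measure d) (\<lambda>z. hol_ext d f z * cnj (hol_ext d g z) * of_real (cutoff d \<rho> z))"
  unfolding hol_ext_eq
  using polydisc_form_has_sum(1)[where a = "taylor_coeff d f" and b = "taylor_coeff d g",
      OF norm_taylor_coeff_le[OF hardy1_integrable[OF f]] norm_taylor_coeff_le[OF hardy1_integrable[OF g]] \<rho>] .

lemma torus_form_bound:
  assumes f: "integrable (torus_measure d) f" and g: "integrable (torus_measure d) g" and r: "0 < r" "r < 1"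
  shows "cmod (LINT p|(torus_measure d \<Otimes>\<^sub>M torus_measure d). f (fst p) * cnj (g (snd p)) * torus_kernel d r (fst p) (snd p))
    \<le> pi ^ d * ((LINT t|torus_measure d. cmod (f t)) * (LINT t|torus_measure d. cmod (g t)))"
proof -
  let ?T = "torus_measure d"
  have i: "integrable (?T \<Otimes>\<^sub>M ?T) (\<lambda>p. cmod (f (fst p)) * cmod (g (snd p)))"
    using integrable_norm[OF torus_pair.integral_pair_mult(1)[OF f g]]
    by (simp add: case_prod_unfold norm_mult)
  have "cmod (LINT p|(?T \<Otimes>\<^sub>M ?T). f (fst p) * cnj (g (snd p)) * torus_kernel d r (fst p) (snd p)) \<le>
      (LINT p|(?T \<Otimes>\<^sub>M ?T). cmod (f (fst p) * cnj (g (snd p)) * torus_kernel d r (fst p) (snd p)))"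
    by (rule integral_norm_bound)
  also have "\<dots> \<le> (LINT p|(?T \<Otimes>\<^sub>M ?T). pi ^ d * (cmod (f (fst p)) * cmod (g (snd p))))"
  proof (rule integral_mono)
    show "integrable (?T \<Otimes>\<^sub>M ?T) (\<lambda>p. cmod (f (fst p) * cnj (g (snd p)) * torus_kernel d r (fst p) (snd p)))"
      by (intro integrable_norm torus_form_has_sum_int(1) f g r)
    show "integrable (?T \<Otimes>\<^sub>M ?T) (\<lambda>p. pi ^ d * (cmod (f (fst p)) * cmod (g (snd p))))"
      using i by simp
    fix p assume "p \<in> space (?T \<Otimes>\<^sub>M ?T)"
    then have "cmod (torus_kernel d r (fst p) (snd p)) \<le> pi ^ d"
      by (intro norm_torus_kernel r) (auto simp: space_pair_measure)
    then have "(cmod (f (fst p)) * cmod (g (snd p))) * cmod (torus_kernel d r (fst p) (snd p)) \<le>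
        (cmod (f (fst p)) * cmod (g (snd p))) * pi ^ d"
      by (intro mult_left_mono) auto
    then show "cmod (f (fst p) * cnj (g (snd p)) * torus_kernel d r (fst p) (snd p)) \<le>
        pi ^ d * (cmod (f (fst p)) * cmod (g (snd p)))"
      by (simp add: norm_mult mult_ac)
  qed
  also have "\<dots> = pi ^ d * (LINT p|(?T \<Otimes>\<^sub>M ?T). cmod (f (fst p)) * cmod (g (snd p)))"
    by simp
  also have "(LINT p|(?T \<Otimes>\<^sub>M ?T). cmod (f (fst p)) * cmod (g (snd p))) =
      (LINT s|?T. LINT t|?T. cmod (f s) * cmod (g t))"
    using torus_pair.integral_fst'[OF i] by simp
  also have "\<dots> = (LINT t|?T. cmod (f t)) * (LINT t|?T. cmod (g t))"
    by simp
  finally show ?thesis .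
qed

definition radius :: "nat \<Rightarrow> real" where
  "radius k = 1 - 1 / (k + 2)"

lemma radius: "0 < radius k" "radius k < 1"
  by (simp_all add: radius_def)

lemma cutoff_radius_eventually:
  assumes "z \<in> polydisc d"
  shows "\<forall>\<^sub>F k in sequentially. cutoff d (radius k) z = 1"
proof -
  have "radius \<longlonglongrightarrow> 1"
    unfolding radius_def by real_asymp
  have "\<And>j. j < d \<Longrightarrow> cmod (z j) < 1" using assms by (auto simp: polydisc_def PiE_iff)
  then obtain \<rho> where \<rho>: "\<rho> < 1" "\<And>j. j < d \<Longrightarrow> cmod (z j) < \<rho>"
    using polydisc_radius by blast
  have "\<forall>\<^sub>F k in sequentially. \<rho> < radius k"
    using order_tendstoD(1)[OF \<open>radius \<longlonglongrightarrow> 1\<close> \<rho>(1)] .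
  then show ?thesis
    by eventually_elim (use \<rho>(2) in \<open>force simp: cutoff_eq\<close>)
qed

text \<open>The kernel bound controls the square integrals over the smaller polydiscs by \<open>\<pi>\<^sup>d \<parallel>f\<parallel>\<^sub>1\<^sup>2\<close>, uniformly in the
  radius; Fatou's lemma passes to the whole polydisc.\<close>

lemma hol_ext_in_bergman2:
  assumes f: "f \<in> hardy1 d"
  shows "hol_ext d f \<in> bergman2 d"
proof -
  define C where "C = (LINT t|torus_measure d. cmod (f t))"
  have C: "cmod (taylor_coeff d f \<alpha>) \<le> C" for \<alpha>
    unfolding C_def by (rule norm_taylor_coeff_le[OF hardy1_integrable[OF f]])
  let ?h = "hol_ext d f" and ?M = "polydisc_measure d"
  have meas [measurable]: "?h \<in> borel_measurable ?M"
    unfolding hol_ext_eq by (rule borel_measurable_power_series[OF C])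
  have hol: "holomorphic_on_polydisc d ?h"
    unfolding hol_ext_eq holomorphic_on_polydisc_def
    using continuous_on_power_series[of "taylor_coeff d f", OF C] power_series_holomorphic[of "taylor_coeff d f", OF C] by blast
  have bound: "(\<integral>\<^sup>+z. ennreal ((cmod (?h z))\<^sup>2 * cutoff d (radius k) z) \<partial>?M) \<le> ennreal (pi ^ d * (C * C))" for k
  proof -
    have eq: "?h z * cnj (?h z) * of_real (cutoff d (radius k) z) = of_real ((cmod (?h z))\<^sup>2 * cutoff d (radius k) z)" for z
      unfolding of_real_mult complex_norm_square ..
    have int: "integrable ?M (\<lambda>z. (cmod (?h z))\<^sup>2 * cutoff d (radius k) z)"
      using hol_ext_form_integrable[OF f f radius[of k]] unfolding eq complex_of_real_integrable_eq .
    have nn: "0 \<le> (cmod (?h z))\<^sup>2 * cutoff d (radius k) z" for z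
      by (simp add: cutoff_eq)
    have r: "0 < (radius k)\<^sup>2" "(radius k)\<^sup>2 < 1" using radius[of k] by (simp_all add: power_less_one_iff)
    have "cmod (LINT z|?M. ?h z * cnj (?h z) * of_real (cutoff d (radius k) z)) \<le> pi ^ d * (C * C)"
      unfolding hol_ext_form_eq[OF f f radius] C_def
      by (intro torus_form_bound hardy1_integrable f r)
    then have "(LINT z|?M. (cmod (?h z))\<^sup>2 * cutoff d (radius k) z) \<le> pi ^ d * (C * C)"
      unfolding eq integral_complex_of_real by simp
    then show ?thesis
      using nn int by (subst nn_integral_eq_integral) auto
  qed
  have "(\<integral>\<^sup>+z. ennreal ((cmod (?h z))\<^sup>2) \<partial>?M) = (\<integral>\<^sup>+z. liminf (\<lambda>k. ennreal ((cmod (?h z))\<^sup>2 * cutoff d (radius k) z)) \<partial>?M)"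
  proof (intro nn_integral_cong)
    fix z assume "z \<in> space ?M"
    then have "\<forall>\<^sub>F k in sequentially. ennreal ((cmod (?h z))\<^sup>2 * cutoff d (radius k) z) = ennreal ((cmod (?h z))\<^sup>2)"
      using cutoff_radius_eventually[of z d]
      by (auto simp: space_polydisc_measure elim: eventually_mono)
    then have "(\<lambda>k. ennreal ((cmod (?h z))\<^sup>2 * cutoff d (radius k) z)) \<longlonglongrightarrow> ennreal ((cmod (?h z))\<^sup>2)"
      by (rule tendsto_eventually)
    then show "ennreal ((cmod (?h z))\<^sup>2) = liminf (\<lambda>k. ennreal ((cmod (?h z))\<^sup>2 * cutoff d (radius k) z))"
      using lim_imp_Liminf[OF sequentially_bot] by metis
  qed
  also have "\<dots> \<le> liminf (\<lambda>k. \<integral>\<^sup>+z. ennreal ((cmod (?h z))\<^sup>2 * cutoff d (radius k) z) \<partial>?M)"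
    by (rule nn_integral_liminf) measurable
  also have "\<dots> \<le> liminf (\<lambda>k::nat. ennreal (pi ^ d * (C * C)))"
    by (intro Liminf_mono always_eventually allI bound)
  also have "\<dots> = ennreal (pi ^ d * (C * C))"
    by (intro Liminf_const) simp
  finally have "integrable ?M (\<lambda>z. (cmod (?h z))\<^sup>2)"
    by (simp add: integrable_iff_bounded le_less_trans)
  then show ?thesis
    using meas hol by (simp add: bergman2_def L2_space_def)
qed

lemma hol_ext_form_tendsto:
  assumes f: "f \<in> hardy1 d" and g: "g \<in> hardy1 d"
  shows "(\<lambda>k. LINT z|polydisc_measure d. hol_ext d f z * cnj (hol_ext d g z) * of_real (cutoff d (radius k) z))
    \<longlonglongrightarrow> (LINT z|polydisc_measure d. hol_ext d f z * cnj (hol_ext d g z))"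
proof -
  have L2: "hol_ext d f \<in> L2_space (polydisc_measure d)" "hol_ext d g \<in> L2_space (polydisc_measure d)"
    using hol_ext_in_bergman2 f g by (auto simp: bergman2_def)
  note int = integrable_L2_mult_cnj[OF L2]
  show ?thesis
  proof (rule integral_dominated_convergence)
    show "integrable (polydisc_measure d) (\<lambda>z. norm (hol_ext d f z * cnj (hol_ext d g z)))"
      using int by (rule integrable_norm)
    show "(\<lambda>z. hol_ext d f z * cnj (hol_ext d g z)) \<in> borel_measurable (polydisc_measure d)"
      by (rule borel_measurable_integrable[OF int])
    show "(\<lambda>z. hol_ext d f z * cnj (hol_ext d g z) * of_real (cutoff d (radius k) z)) \<in> borel_measurable (polydisc_measure d)" for k
      by (rule borel_measurable_integrable[OF hol_ext_form_integrable[OF f g radius]])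
    show "AE z in polydisc_measure d. norm (hol_ext d f z * cnj (hol_ext d g z) * of_real (cutoff d (radius k) z)) \<le>
        norm (hol_ext d f z * cnj (hol_ext d g z))" for k
      by (intro AE_I2) (simp add: cutoff_eq)
    show "AE z in polydisc_measure d. (\<lambda>k. hol_ext d f z * cnj (hol_ext d g z) * of_real (cutoff d (radius k) z))
        \<longlonglongrightarrow> hol_ext d f z * cnj (hol_ext d g z)"
    proof (rule AE_I2)
      fix z assume "z \<in> space (polydisc_measure d)"
      then have "\<forall>\<^sub>F k in sequentially. hol_ext d f z * cnj (hol_ext d g z) * of_real (cutoff d (radius k) z) =
          hol_ext d f z * cnj (hol_ext d g z)"
        using cutoff_radius_eventually[of z d]
        by (auto simp: space_polydisc_measure elim: eventually_mono)
      then show "(\<lambda>k. hol_ext d f z * cnj (hol_ext d g z) * of_real (cutoff d (radius k) z))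
        \<longlonglongrightarrow> hol_ext d f z * cnj (hol_ext d g z)"
        by (rule tendsto_eventually)
    qed
  qed
qed

text \<open>The core of the upper bound. The matrix \<open>f\<close> is used twice as a complete contraction on \<open>L\<^sup>\<infinity>\<close>: for
  each \<open>t\<close> on the kernel, divided by \<open>\<pi>\<^sup>d\<close>, as a scalar function of \<open>s\<close>, which yields a function \<open>G\<close> with values in the unit
  ball of \<open>M\<^sub>n\<close>, and then on the function \<open>cnj G\<close> in \<open>M\<^sub>n(L\<^sup>\<infinity>)\<close>. The conjugations are harmless because
  entrywise conjugation preserves the norm of a matrix.\<close>

lemma torus_form_matrix_bound:
  assumes f: "\<And>i j. i < n \<Longrightarrow> j < n \<Longrightarrow> integrable (torus_measure d) (f i j)"
    and norm: "mnorm (L1_os (torus_measure d)) n f \<le> 1"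
    and r: "0 < r" "r < 1"
  shows "mat_norm ({..<n} \<times> {..<n}) (\<lambda>(p, i) (q, j). LINT u|(torus_measure d \<Otimes>\<^sub>M torus_measure d).
    f p q (fst u) * cnj (f i j (snd u)) * torus_kernel d r (fst u) (snd u)) \<le> pi ^ d"
proof -
  let ?T = "torus_measure d"
  define \<Phi> where "\<Phi> s t = torus_kernel d r s t / of_real (pi ^ d)" for s t
  define G where "G p q t = (LINT s|?T. f p q s * \<Phi> s t)" for p q t
  have \<Phi>_meas: "(\<lambda>u. \<Phi> (fst u) (snd u)) \<in> borel_measurable (?T \<Otimes>\<^sub>M ?T)"
    using torus_kernel_measurable[OF r, of d] unfolding \<Phi>_def case_prod_unfold
    by (intro borel_measurable_divide) auto
  have \<Phi>_bound: "cmod (\<Phi> s t) \<le> 1" if "s \<in> space ?T" "t \<in> space ?T" for s t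
    using norm_torus_kernel[OF r that] by (simp add: \<Phi>_def norm_divide norm_power)
  have sect: "(\<lambda>s. \<Phi> s t) \<in> borel_measurable ?T" if "t \<in> space ?T" for t
  proof -
    have "(\<lambda>s. (s, t)) \<in> measurable ?T (?T \<Otimes>\<^sub>M ?T)"
      using that by (rule measurable_Pair2')
    from measurable_compose[OF this \<Phi>_meas] show ?thesis by simp
  qed
  (* A scalar function of s is a 1 x 1 matrix over L-infinity, so the norm of f is used at level 1. *)
  have lev1: "mat_norm {..<n} (\<lambda>p q. cnj (G p q t)) \<le> 1" if t: "t \<in> space ?T" for t
  proof -
    have "mat_norm ({..<1::nat} \<times> {..<n}) (\<lambda>(p, i) (q, j). LINT s|?T. f i j s * \<Phi> s t) \<le> 1"
    proof (rule L1_contractionD[OF norm, of 1 "\<lambda>_ _ s. \<Phi> s t"])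
      show "(\<lambda>s. \<Phi> s t) \<in> elems (Linf_os ?T)"
        using sect[OF t] \<Phi>_bound t by (auto simp: Linf_os_def intro!: exI[of _ 1] AE_I2)
      have "mnorm (Linf_os ?T) 1 (\<lambda>_ _ s. \<Phi> s t) \<le> ennreal 1"
      proof (rule Linf_mnorm_leI)
        show "AE s in ?T. mat_norm {..<1::nat} (\<lambda>i j. \<Phi> s t) \<le> 1"
          by (intro AE_I2 order_trans[OF mat_norm_singleton \<Phi>_bound] t)
      qed simp
      then show "mnorm (Linf_os ?T) 1 (\<lambda>_ _ s. \<Phi> s t) \<le> 1" by simp
    qed
    then have "mat_norm {..<n} (\<lambda>p q. G p q t) \<le> 1"
      using mat_norm_one_times[of "{..<n}" "\<lambda>p q. G p q t"] unfolding G_def by simp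
    then show ?thesis
      using mat_norm_cnj[of "{..<n}" "\<lambda>p q. G p q t"] by simp
  qed
  have G_int: "integrable (?T \<Otimes>\<^sub>M ?T) (\<lambda>u. f p q (fst u) * cnj (f i j (snd u)) * \<Phi> (fst u) (snd u))"
    if "p < n" "q < n" "i < n" "j < n" for p q i j
    using torus_form_has_sum_int(1)[OF f[OF that(1,2)] f[OF that(3,4)] r] unfolding \<Phi>_def
    by (simp add: field_simps)
  have G_meas: "G p q \<in> borel_measurable ?T" if "p < n" "q < n" for p q
  proof -
    have [measurable]: "f p q \<in> borel_measurable ?T" by (rule borel_measurable_integrable[OF f[OF that]])
    have [measurable]: "(\<lambda>u. \<Phi> (fst u) (snd u)) \<in> borel_measurable (?T \<Otimes>\<^sub>M ?T)" by (rule \<Phi>_meas)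
    have "(\<lambda>u. f p q (fst u) * \<Phi> (fst u) (snd u)) \<in> borel_measurable (?T \<Otimes>\<^sub>M ?T)" by measurable
    from measurable_compose[OF measurable_pair_swap' this]
    have "(\<lambda>(t, s). f p q s * \<Phi> s t) \<in> borel_measurable (?T \<Otimes>\<^sub>M ?T)"
      by (simp add: case_prod_unfold)
    then show ?thesis
      unfolding G_def
      by (rule sigma_finite_measure.borel_measurable_lebesgue_integral[OF sigma_finite_torus])
  qed
  have G_bound: "cmod (G p q t) \<le> (LINT s|?T. cmod (f p q s))" if "p < n" "q < n" "t \<in> space ?T" for p q t
  proof -
    have 1: "cmod (f p q s * \<Phi> s t) \<le> cmod (f p q s)" if "s \<in> space ?T" for s
      using \<Phi>_bound[OF that \<open>t \<in> space ?T\<close>] by (simp add: norm_mult mult_left_le)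
    have m: "(\<lambda>s. f p q s * \<Phi> s t) \<in> borel_measurable ?T"
      using f[OF that(1,2)] sect[OF that(3)] by (intro borel_measurable_times) auto
    have "cmod (G p q t) \<le> (LINT s|?T. cmod (f p q s * \<Phi> s t))"
      unfolding G_def by (rule integral_norm_bound)
    also have "\<dots> \<le> (LINT s|?T. cmod (f p q s))"
      using 1 by (intro integral_mono integrable_norm f that
          Bochner_Integration.integrable_bound[OF f[OF that(1,2)] m] AE_I2)
    finally show ?thesis .
  qed
  (* Now cnj G is itself an n x n matrix over L-infinity, of norm at most 1 by lev1. *)
  have levn: "mat_norm ({..<n} \<times> {..<n}) (\<lambda>(p, i) (q, j). LINT t|?T. f i j t * cnj (G p q t)) \<le> 1"
  proof (rule L1_contractionD[OF norm, of n "\<lambda>p q t. cnj (G p q t)"])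
    fix p q assume "p < n" "q < n"
    then show "(\<lambda>t. cnj (G p q t)) \<in> elems (Linf_os ?T)"
      using G_meas[of p q] G_bound[of p q]
      by (auto simp: Linf_os_def intro!: exI[of _ "LINT s|?T. cmod (f p q s)"] AE_I2 borel_measurable_cnj)
  next
    have "mnorm (Linf_os ?T) n (\<lambda>p q t. cnj (G p q t)) \<le> ennreal 1"
      using lev1 by (intro Linf_mnorm_leI AE_I2) auto
    then show "mnorm (Linf_os ?T) n (\<lambda>p q t. cnj (G p q t)) \<le> 1" by simp
  qed
  have entry: "(LINT u|(?T \<Otimes>\<^sub>M ?T). f p q (fst u) * cnj (f i j (snd u)) * torus_kernel d r (fst u) (snd u)) =
      of_real (pi ^ d) * cnj (LINT t|?T. f i j t * cnj (G p q t))"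
    if "p < n" "q < n" "i < n" "j < n" for p q i j
  proof -
    have "(LINT u|(?T \<Otimes>\<^sub>M ?T). f p q (fst u) * cnj (f i j (snd u)) * torus_kernel d r (fst u) (snd u)) =
        (LINT u|(?T \<Otimes>\<^sub>M ?T). of_real (pi ^ d) * (f p q (fst u) * cnj (f i j (snd u)) * \<Phi> (fst u) (snd u)))"
      by (simp add: \<Phi>_def)
    also have "\<dots> = of_real (pi ^ d) * (LINT u|(?T \<Otimes>\<^sub>M ?T). f p q (fst u) * cnj (f i j (snd u)) * \<Phi> (fst u) (snd u))"
      by (rule integral_mult_right_zero)
    also have "(LINT u|(?T \<Otimes>\<^sub>M ?T). f p q (fst u) * cnj (f i j (snd u)) * \<Phi> (fst u) (snd u)) =
        (LINT t|?T. LINT s|?T. f p q s * cnj (f i j t) * \<Phi> s t)"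
      using torus_pair.integral_snd[where f = "\<lambda>s t. f p q s * cnj (f i j t) * \<Phi> s t"] G_int[OF that]
      by (simp add: case_prod_unfold)
    also have "\<dots> = (LINT t|?T. cnj (f i j t * cnj (G p q t)))"
    proof (intro Bochner_Integration.integral_cong refl)
      fix t
      have "(LINT s|?T. f p q s * cnj (f i j t) * \<Phi> s t) = (LINT s|?T. cnj (f i j t) * (f p q s * \<Phi> s t))"
        by (simp add: mult_ac)
      also have "\<dots> = cnj (f i j t) * G p q t"
        unfolding G_def by (rule integral_mult_right_zero)
      finally show "(LINT s|?T. f p q s * cnj (f i j t) * \<Phi> s t) = cnj (f i j t * cnj (G p q t))"
        by simp
    qed
    also have "\<dots> = cnj (LINT t|?T. f i j t * cnj (G p q t))"
      by (rule Bochner_Integration.integral_cnj)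
    finally show ?thesis .
  qed
  let ?B = "\<lambda>(p, i) (q, j). LINT t|?T. f i j t * cnj (G p q t)"
  have "mat_norm ({..<n} \<times> {..<n}) (\<lambda>(p, i) (q, j). LINT u|(?T \<Otimes>\<^sub>M ?T).
      f p q (fst u) * cnj (f i j (snd u)) * torus_kernel d r (fst u) (snd u)) =
      mat_norm ({..<n} \<times> {..<n}) (\<lambda>a b. of_real (pi ^ d) * cnj (?B a b))"
    using entry by (intro mat_norm_cong) auto
  also have "\<dots> \<le> pi ^ d * mat_norm ({..<n} \<times> {..<n}) (\<lambda>a b. cnj (?B a b))"
    by (rule mat_norm_scale) auto
  also have "\<dots> \<le> pi ^ d * mat_norm ({..<n} \<times> {..<n}) ?B"
    by (intro mult_left_mono mat_norm_cnj) auto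
  also have "\<dots> \<le> pi ^ d * 1"
    by (intro mult_left_mono levn) auto
  finally show ?thesis by simp
qed

lemma hol_ext_matrix_bound:
  assumes f: "\<And>i j. i < n \<Longrightarrow> j < n \<Longrightarrow> f i j \<in> hardy1 d"
    and norm: "mnorm (L1_os (torus_measure d)) n f \<le> 1"
  shows "mat_norm ({..<n} \<times> {..<n}) (\<lambda>(p, i) (q, j).
    LINT z|polydisc_measure d. hol_ext d (f p q) z * cnj (hol_ext d (f i j) z)) \<le> pi ^ d"
proof (rule mat_norm_tendsto_le)
  let ?A = "\<lambda>k (p, i) (q, j). LINT z|polydisc_measure d.
    hol_ext d (f p q) z * cnj (hol_ext d (f i j) z) * of_real (cutoff d (radius k) z)"
  show "mat_norm ({..<n} \<times> {..<n}) (?A k) \<le> pi ^ d" for k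
  proof -
    have r: "0 < (radius k)\<^sup>2" "(radius k)\<^sup>2 < 1" using radius[of k] by (simp_all add: power_less_one_iff)
    have "mat_norm ({..<n} \<times> {..<n}) (?A k) = mat_norm ({..<n} \<times> {..<n}) (\<lambda>(p, i) (q, j). LINT u|(torus_measure d \<Otimes>\<^sub>M torus_measure d).
        f p q (fst u) * cnj (f i j (snd u)) * torus_kernel d ((radius k)\<^sup>2) (fst u) (snd u))"
      using f radius by (intro mat_norm_cong) (auto simp: hol_ext_form_eq)
    also have "\<dots> \<le> pi ^ d"
      using f by (intro torus_form_matrix_bound norm r hardy1_integrable)
    finally show ?thesis .
  qed
qed (use f in \<open>auto intro!: hol_ext_form_tendsto\<close>)

section \<open>Finite sections of the Hilbert matrix\<close>

text \<open>The Taylor coefficients of \<open>(1 - x)\<^sup>-\<^sup>1\<^sup>/\<^sup>2\<close>, that is, \<open>(2j choose j) / 4\<^sup>j\<close>. They behave like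
  \<open>1/sqrt (\<pi> j)\<close>, the critical decay for the Hilbert matrix, and both the
  Hilbert form and the square norm can be estimated by harmonic numbers with them.\<close>

definition central_coeff :: "nat \<Rightarrow> real" where
  "central_coeff j = (-1) ^ j * ((- 1 / 2) gchoose j)"

lemma central_coeff_0 [simp]: "central_coeff 0 = 1"
  by (simp add: central_coeff_def)

lemma central_coeff_Suc: "central_coeff (Suc j) = central_coeff j * (2 * j + 1) / (2 * j + 2)"
  by (simp add: central_coeff_def gbinomial_prod_rev field_simps)

lemma central_coeff_pos: "0 < central_coeff j"
  by (induction j) (simp_all add: central_coeff_Suc)

text \<open>The coefficients of \<open>(1 - x)\<^sup>-\<^sup>1\<^sup>/\<^sup>2 (1 - x)\<^sup>-\<^sup>1\<^sup>/\<^sup>2 = 1/(1 - x)\<close>, by Vandermonde's identity.\<close>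

lemma central_coeff_convolution: "(\<Sum>k\<le>n. central_coeff k * central_coeff (n - k)) = 1"
proof -
  have "(\<Sum>k\<le>n. central_coeff k * central_coeff (n - k)) =
      (\<Sum>k\<le>n. (-1) ^ n * (((- 1 / 2) gchoose k) * ((- 1 / 2) gchoose (n - k))))"
    by (intro sum.cong refl) (simp add: central_coeff_def flip: power_add)
  also have "\<dots> = (-1) ^ n * ((- 1 / 2 + - 1 / 2 :: real) gchoose n)"
    by (simp only: gbinomial_Vandermonde[symmetric] atLeast0AtMost sum_distrib_left)
  also have "\<dots> = 1"
    using gbinomial_minus[of "1 :: real" n] by (simp add: binomial_gbinomial[symmetric] flip: power_add power_mult)
  finally show ?thesis .
qed

lemma central_coeff_wallis:
  "(central_coeff n)\<^sup>2 * (2 * n + 1) = inverse (\<Prod>k=1..n. (4 * real k ^ 2) / (4 * real k ^ 2 - 1))"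
proof (induction n)
  case (Suc n)
  have p: "4 * real (Suc n) ^ 2 - 1 = (2 * real n + 1) * (2 * real n + 3)"
    by (simp add: power2_eq_square algebra_simps)
  have "(central_coeff (Suc n))\<^sup>2 * (2 * Suc n + 1) =
      ((central_coeff n)\<^sup>2 * (2 * n + 1)) * ((2 * n + 1) * (2 * n + 3) / (4 * real (Suc n) ^ 2))"
    by (simp add: central_coeff_Suc power2_eq_square field_simps)
  also have "\<dots> = inverse (\<Prod>k=1..Suc n. (4 * real k ^ 2) / (4 * real k ^ 2 - 1))"
  proof -
    have "(2 * real n + 1) * (2 * real n + 3) / (4 * real (Suc n) ^ 2) =
        inverse (4 * real (Suc n) ^ 2 / (4 * real (Suc n) ^ 2 - 1))"
      by (simp only: p inverse_divide)
    moreover have "(2 * n + 1) * (2 * n + 3) / (4 * real (Suc n) ^ 2) = (2 * real n + 1) * (2 * real n + 3) / (4 * real (Suc n) ^ 2)"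
      by (simp add: algebra_simps)
    moreover have "(\<Prod>k=1..Suc n. (4 * real k ^ 2) / (4 * real k ^ 2 - 1)) =
        (\<Prod>k=1..n. (4 * real k ^ 2) / (4 * real k ^ 2 - 1)) * (4 * real (Suc n) ^ 2 / (4 * real (Suc n) ^ 2 - 1))"
      by (subst prod.cl_ivl_Suc) simp
    ultimately show ?thesis
      unfolding Suc by (simp only: inverse_mult_distrib)
  qed
  finally show ?case .
qed simp

text \<open>The left-hand side increases with \<open>n\<close>, and its limit is given by Wallis's product.\<close>

lemma central_coeff_square_le: "n * (central_coeff n)\<^sup>2 \<le> 1 / pi"
proof (rule incseq_le[where X = "\<lambda>n. real n * (central_coeff n)\<^sup>2"])
  show "incseq (\<lambda>n. n * (central_coeff n)\<^sup>2)"
  proof (rule incseq_SucI)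
    fix n
    have "real n * (2 * n + 2)\<^sup>2 \<le> real (Suc n) * (2 * n + 1)\<^sup>2"
      by (simp add: power2_eq_square algebra_simps)
    then have "real n \<le> real (Suc n) * ((2 * n + 1) / (2 * n + 2))\<^sup>2"
      by (simp add: power_divide pos_le_divide_eq)
    then have "(central_coeff n)\<^sup>2 * real n \<le> (central_coeff n)\<^sup>2 * (real (Suc n) * ((2 * n + 1) / (2 * n + 2))\<^sup>2)"
      by (intro mult_left_mono) auto
    then show "n * (central_coeff n)\<^sup>2 \<le> Suc n * (central_coeff (Suc n))\<^sup>2"
      by (simp add: central_coeff_Suc power_mult_distrib power_divide mult_ac)
  qed
  have 1: "(\<lambda>n. (central_coeff n)\<^sup>2 * (2 * n + 1)) \<longlonglongrightarrow> inverse (pi / 2)"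
    unfolding central_coeff_wallis by (intro tendsto_inverse wallis) simp
  have 2: "(\<lambda>n. real n / (2 * n + 1)) \<longlonglongrightarrow> 1 / 2"
    by real_asymp
  have "(\<lambda>n. (central_coeff n)\<^sup>2 * (2 * n + 1) * (real n / (2 * n + 1))) \<longlonglongrightarrow> inverse (pi / 2) * (1 / 2)"
    by (intro tendsto_mult 1 2)
  moreover have "(central_coeff n)\<^sup>2 * (2 * n + 1) * (real n / (2 * n + 1)) = n * (central_coeff n)\<^sup>2" for n
    by (simp add: add_pos_nonneg)
  ultimately show "(\<lambda>n. n * (central_coeff n)\<^sup>2) \<longlonglongrightarrow> 1 / pi"
    by (simp add: mult.commute)
qed

lemma central_coeff_sum_squares: "(\<Sum>j<N. (central_coeff j)\<^sup>2) \<le> 1 + harm N / pi"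
proof (induction N)
  case (Suc N)
  show ?case
  proof (cases "N = 0")
    case False
    have "(\<Sum>j<Suc N. (central_coeff j)\<^sup>2) \<le> 1 + (\<Sum>j=1..N. 1 / pi * inverse (real j))"
    proof -
      have "{..<Suc N} = insert 0 {1..N}" by auto
      then have "(\<Sum>j<Suc N. (central_coeff j)\<^sup>2) = 1 + (\<Sum>j=1..N. (central_coeff j)\<^sup>2)" by simp
      also have "\<dots> \<le> 1 + (\<Sum>j=1..N. 1 / pi * inverse (real j))"
        using central_coeff_square_le by (intro add_left_mono sum_mono) (simp add: field_simps)
      finally show ?thesis .
    qed
    also have "\<dots> = 1 + harm N / pi"
      by (simp add: harm_def sum_distrib_left[symmetric] mult.commute flip: sum_divide_distrib)
    also have "\<dots> \<le> 1 + harm (Suc N) / pi"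
      by (simp add: harm_Suc divide_right_mono)
    finally show ?thesis .
  qed (simp add: harm_expand)
qed (simp add: harm_expand)

text \<open>The entry \<open>1/(i + j + 1)\<close> is constant on antidiagonals, along which the products of coefficients sum to
  \<open>1\<close>. So the triangle \<open>i + j < N\<close> alone contributes a harmonic number.\<close>

lemma hilbert_form_central_coeff:
  "harm N \<le> (\<Sum>i<N. \<Sum>j<N. central_coeff i * central_coeff j / (i + j + 1))"
proof -
  have "harm N = (\<Sum>n<N. 1 / (n + 1))"
    by (induction N) (simp_all add: harm_Suc harm_expand field_simps)
  also have "\<dots> = (\<Sum>n<N. \<Sum>k\<le>n. central_coeff k * central_coeff (n - k) / (n + 1))"
    by (simp add: central_coeff_convolution flip: sum_divide_distrib)
  also have "\<dots> = (\<Sum>(n, k)\<in>(SIGMA n:{..<N}. {..n}). central_coeff k * central_coeff (n - k) / (n + 1))"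
    by (simp add: sum.Sigma)
  also have "\<dots> = (\<Sum>(i, j)\<in>{(i, j). i + j < N}. central_coeff i * central_coeff j / (i + j + 1))"
    by (rule sum.reindex_bij_witness[where i = "\<lambda>(i, j). (i + j, i)" and j = "\<lambda>(n, k). (k, n - k)"]) auto
  also have "\<dots> \<le> (\<Sum>(i, j)\<in>{..<N} \<times> {..<N}. central_coeff i * central_coeff j / (i + j + 1))"
    by (intro sum_mono2) (auto intro!: divide_nonneg_nonneg mult_nonneg_nonneg less_imp_le[OF central_coeff_pos])
  also have "\<dots> = (\<Sum>i<N. \<Sum>j<N. central_coeff i * central_coeff j / (i + j + 1))"
    by (simp add: sum.cartesian_product)
  finally show ?thesis .
qed

text \<open>The quotient of the Hilbert form and the square norm of the test vector is at least \<open>h / (1 + h/\<pi>)\<close> for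
  the harmonic number \<open>h\<close> of order \<open>N\<close>, and this tends to \<open>\<pi>\<close> as \<open>h\<close> grows.\<close>

lemma hilbert_matrix_lower_bound:
  assumes "0 \<le> c" "c < pi"
  obtains N where "N > 0"
    "c * (\<Sum>j<N. (central_coeff j)\<^sup>2) \<le> (\<Sum>i<N. \<Sum>j<N. central_coeff i * central_coeff j / (i + j + 1))"
proof -
  (* K is the solution h of h = c * (1 + h / pi). *)
  define K where "K = c / (1 - c / pi)"
  obtain N :: nat where N: "exp K < real N" using reals_Archimedean2 by blast
  have "N > 0" using N exp_gt_zero[of K] by (cases N) auto
  then have "K < ln (real N)" using N by (metis exp_less_cancel_iff exp_ln of_nat_0_less_iff)
  also have "\<dots> \<le> ln (real N + 1)" using \<open>N > 0\<close> by simp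
  also have "\<dots> \<le> harm N" by (rule ln_le_harm)
  finally have K: "K \<le> harm N" by simp
  have p: "0 < 1 - c / pi" using assms by simp
  have "c \<le> harm N * (1 - c / pi)"
    using K p unfolding K_def by (simp add: pos_divide_le_eq)
  then have "c * (1 + harm N / pi) \<le> harm N"
    by (simp add: algebra_simps)
  moreover have "c * (\<Sum>j<N. (central_coeff j)\<^sup>2) \<le> c * (1 + harm N / pi)"
    using assms(1) by (intro mult_left_mono central_coeff_sum_squares)
  ultimately show ?thesis
    using that[OF \<open>N > 0\<close>] hilbert_form_central_coeff[of N] by linarith
qed

section \<open>The lower bound\<close>

definition torus_monomial :: "nat \<Rightarrow> (nat \<Rightarrow> nat) \<Rightarrow> (nat \<Rightarrow> complex) \<Rightarrow> complex" where
  "torus_monomial d k t = (\<Prod>j<d. t j ^ k j)"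

lemma torus_monomial_power_int: "torus_monomial d k t = (\<Prod>j<d. t j powi int (k j))"
  by (simp add: torus_monomial_def)

lemma torus_monomial_add:
  "torus_monomial d (\<lambda>j. k j + l j) t = torus_monomial d k t * torus_monomial d l t"
  by (simp add: torus_monomial_def power_add prod.distrib)

lemma integrable_monomial: "integrable (torus_measure d) (torus_monomial d k)"
  using integrable_torus_monomial[of d "\<lambda>j. int (k j)"]
  by (simp add: torus_monomial_power_int[abs_def])

lemma norm_monomial: "t \<in> space (torus_measure d) \<Longrightarrow> cmod (torus_monomial d k t) = 1"
  by (simp add: torus_monomial_power_int norm_torus_monomial del: power_int_of_nat)

lemma fourier_coeff_monomial:
  "fourier_coeff d (torus_monomial d k) \<alpha> = (if \<forall>j<d. int (k j) = \<alpha> j then 1 else 0)"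
proof -
  have "fourier_coeff d (torus_monomial d k) \<alpha> = (LINT t|torus_measure d. (\<Prod>j<d. t j powi (int (k j) - \<alpha> j)))"
    unfolding fourier_coeff_def
  proof (intro Bochner_Integration.integral_cong refl)
    fix t assume t: "t \<in> space (torus_measure d)"
    have "t j powi int (k j) * cnj (t j powi \<alpha> j) = t j powi (int (k j) - \<alpha> j)" if "j < d" for j
    proof -
      have n: "cmod (t j) = 1" using norm_torus[OF t that] .
      then have "t j \<noteq> 0" by auto
      have "t j powi \<alpha> j * cnj (t j powi \<alpha> j) = 1"
        using complex_norm_square[of "t j powi \<alpha> j"] n by (simp add: norm_power_int)
      then have "cnj (t j powi \<alpha> j) = inverse (t j powi \<alpha> j)"
        by (rule inverse_unique[symmetric])
      then show ?thesis
        using \<open>t j \<noteq> 0\<close> by (simp add: power_int_diff divide_inverse)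
    qed
    then show "torus_monomial d k t * cnj (\<Prod>j<d. t j powi \<alpha> j) = (\<Prod>j<d. t j powi (int (k j) - \<alpha> j))"
      by (simp add: torus_monomial_power_int cnj_prod flip: prod.distrib del: power_int_of_nat)
  qed
  then show ?thesis
    by (simp add: integral_torus_monomial)
qed

lemma torus_monomial_in_hardy1: "torus_monomial d k \<in> hardy1 d"
  by (auto simp: hardy1_def integrable_monomial fourier_coeff_monomial)

lemma hol_ext_monomial: "hol_ext d (torus_monomial d k) z = (\<Prod>j<d. z j ^ k j)"
proof -
  define \<kappa> where "\<kappa> = restrict k {..<d}"
  have "taylor_coeff d (torus_monomial d k) \<alpha> = (if \<alpha> = \<kappa> then 1 else 0)" if "\<alpha> \<in> {..<d} \<rightarrow>\<^sub>E UNIV" for \<alpha>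
  proof -
    have "(\<forall>j<d. k j = \<alpha> j) \<longleftrightarrow> \<alpha> = \<kappa>"
      using that by (auto simp: \<kappa>_def fun_eq_iff PiE_iff extensional_def)
    then show ?thesis by (simp add: taylor_coeff_def fourier_coeff_monomial)
  qed
  then have "((\<lambda>\<alpha>. taylor_coeff d (torus_monomial d k) \<alpha> * (\<Prod>j<d. z j ^ \<alpha> j)) has_sum
      (\<Sum>\<alpha>\<in>{\<kappa>}. (\<Prod>j<d. z j ^ \<alpha> j))) ({..<d} \<rightarrow>\<^sub>E UNIV)"
    by (intro has_sum_finite_neutralI[of "{\<kappa>}"]) (auto simp: \<kappa>_def)
  then show ?thesis
    unfolding hol_ext_eq power_series_def by (subst infsumI) (auto simp: \<kappa>_def)
qed

lemma polydisc_monomial_inner: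
  "(LINT z|polydisc_measure d. (\<Prod>j<d. z j ^ k j) * cnj (\<Prod>j<d. z j ^ k j)) = of_real (\<Prod>j<d. 1 / (real (k j) + 1))"
proof -
  have "(LINT z|polydisc_measure d. (\<Prod>j<d. z j ^ k j) * cnj (\<Prod>j<d. z j ^ k j)) =
      (LINT z|polydisc_measure d. (\<Prod>j<d. z j ^ k j) * cnj (\<Prod>j<d. z j ^ k j) * of_real (cutoff d 1 z))"
    by (intro Bochner_Integration.integral_cong refl)
      (auto simp: cutoff_eq space_polydisc_measure polydisc_def PiE_iff)
  also have "\<dots> = of_real (\<Prod>j<d. 1 / (real (k j) + 1))"
    by (subst integral_polydisc_monomials(2)) (simp_all add: add.commute)
  finally show ?thesis .
qed

text \<open>Distinct exponents give orthonormal monomials. The hypothesis compares exponents only below \<open>d\<close>, since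
  the other values do not affect the monomial.\<close>

lemma torus_parseval:
  assumes "finite J" and inj: "\<And>i j. i \<in> J \<Longrightarrow> j \<in> J \<Longrightarrow> (\<forall>l<d. e i l = e j l) \<Longrightarrow> i = j"
  shows "integrable (torus_measure d) (\<lambda>t. (cmod (\<Sum>j\<in>J. a j * torus_monomial d (e j) t))\<^sup>2)"
    and "(LINT t|torus_measure d. (cmod (\<Sum>j\<in>J. a j * torus_monomial d (e j) t))\<^sup>2) = (\<Sum>j\<in>J. (cmod (a j))\<^sup>2)"
proof -
  let ?f = "\<lambda>t. \<Sum>i\<in>J. \<Sum>j\<in>J. a i * cnj (a j) * (torus_monomial d (e i) t * cnj (torus_monomial d (e j) t))"
  have eq: "of_real ((cmod (\<Sum>j\<in>J. a j * torus_monomial d (e j) t))\<^sup>2) = ?f t" for t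
    unfolding complex_norm_square by (simp add: cnj_sum sum_product mult_ac)
  have int: "integrable (torus_measure d) (\<lambda>t. torus_monomial d (e i) t * cnj (torus_monomial d (e j) t))" for i j
    using integrable_torus_mult_monomial[OF integrable_monomial, of d "e i" "\<lambda>l. int (e j l)"]
    by (simp only: torus_monomial_power_int)
  have val: "(LINT t|torus_measure d. torus_monomial d (e i) t * cnj (torus_monomial d (e j) t)) = (if i = j then 1 else 0)"
    if "i \<in> J" "j \<in> J" for i j
    using fourier_coeff_monomial[of d "e i" "\<lambda>l. int (e j l)"] inj[OF that]
    by (auto simp: fourier_coeff_def torus_monomial_def)
  have "integrable (torus_measure d) ?f"
    using int by (intro Bochner_Integration.integrable_sum integrable_mult_right)
  then show "integrable (torus_measure d) (\<lambda>t. (cmod (\<Sum>j\<in>J. a j * torus_monomial d (e j) t))\<^sup>2)"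
    unfolding eq[symmetric] complex_of_real_integrable_eq .
  have "complex_of_real (LINT t|torus_measure d. (cmod (\<Sum>j\<in>J. a j * torus_monomial d (e j) t))\<^sup>2) =
      (LINT t|torus_measure d. ?f t)"
    unfolding eq[symmetric] integral_complex_of_real ..
  also have "\<dots> = (\<Sum>i\<in>J. \<Sum>j\<in>J. a i * cnj (a j) * (LINT t|torus_measure d. torus_monomial d (e i) t * cnj (torus_monomial d (e j) t)))"
    using int by (subst Bochner_Integration.integral_sum; (intro Bochner_Integration.integrable_sum integrable_mult_right)?)
      (auto intro!: sum.cong simp: Bochner_Integration.integral_sum)
  also have "\<dots> = (\<Sum>i\<in>J. \<Sum>j\<in>J. if i = j then a i * cnj (a j) else 0)"
    by (intro sum.cong refl) (simp add: val)
  also have "\<dots> = (\<Sum>i\<in>J. a i * cnj (a i))"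
    using \<open>finite J\<close> by simp
  also have "\<dots> = complex_of_real (\<Sum>j\<in>J. (cmod (a j))\<^sup>2)"
    by (simp only: of_real_sum complex_norm_square)
  finally show "(LINT t|torus_measure d. (cmod (\<Sum>j\<in>J. a j * torus_monomial d (e j) t))\<^sup>2) = (\<Sum>j\<in>J. (cmod (a j))\<^sup>2)"
    by (simp only: of_real_eq_iff)
qed

text \<open>With \<open>X\<^sub>q = \<Sum>\<^sub>j x\<^sub>q\<^sub>j t\<^sup>e\<^sup>j\<close> and \<open>Y\<^sub>p = \<Sum>\<^sub>i y\<^sub>p\<^sub>i t\<^sup>e\<^sup>i\<close>, the bilinear form of the matrix to be estimated is the
  integral of \<open>\<Sum>\<^sub>p\<^sub>q Y\<^sub>p g\<^sub>p\<^sub>q X\<^sub>q\<close>. Pointwise this is at most \<open>\<parallel>g\<parallel> \<bar>X\<bar> \<bar>Y\<bar>\<close>, and by Parseval's identity the functions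
  \<open>\<bar>X\<bar>\<^sup>2\<close> and \<open>\<bar>Y\<bar>\<^sup>2\<close> have integral at most \<open>1\<close>.\<close>

lemma hankel_contraction:
  assumes inj: "\<And>i j. i < n \<Longrightarrow> j < n \<Longrightarrow> (\<forall>l<d. e i l = e j l) \<Longrightarrow> i = j"
  shows "mnorm (L1_os (torus_measure d)) n (\<lambda>i j. torus_monomial d (\<lambda>l. e i l + e j l)) \<le> 1"
  unfolding L1_contraction_iff
proof (intro allI impI)
  let ?T = "torus_measure d"
  fix m :: nat and g :: "nat \<Rightarrow> nat \<Rightarrow> (nat \<Rightarrow> complex) \<Rightarrow> complex"
  assume g: "\<forall>p<m. \<forall>q<m. g p q \<in> elems (Linf_os ?T)" and g1: "mnorm (Linf_os ?T) m g \<le> 1"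
  let ?F = "\<lambda>i j t. torus_monomial d (\<lambda>l. e i l + e j l) t"
  let ?I = "{..<m} \<times> {..<n}"
  let ?A = "\<lambda>(p, i) (q, j). LINT t|?T. ?F i j t * g p q t"
  have gint: "integrable ?T (\<lambda>t. ?F i j t * g p q t)" if "p < m" "q < m" for i j p q
  proof -
    from g that obtain c where gm: "g p q \<in> borel_measurable ?T" and c: "AE t in ?T. cmod (g p q t) \<le> c"
      by (fastforce simp: Linf_os_def)
    show ?thesis
    proof (rule finite_measure.integrable_const_bound[OF finite_measure_torus, where B = c])
      have "AE t in ?T. cmod (?F i j t) = 1"
        by (intro AE_I2 norm_monomial)
      with c show "AE t in ?T. norm (?F i j t * g p q t) \<le> c"
        by eventually_elim (simp add: norm_mult)
      show "(\<lambda>t. ?F i j t * g p q t) \<in> borel_measurable ?T"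
        using gm borel_measurable_integrable[OF integrable_monomial] by (rule borel_measurable_times[rotated])
    qed
  qed
  show "mat_norm ?I ?A \<le> 1"
  (* The essential bounds of g are only known for constants above 1. *)
  proof (rule field_le_epsilon)
    fix \<epsilon> :: real assume "0 < \<epsilon>"
    define c where "c = 1 + \<epsilon>"
    have c: "1 < c" using \<open>0 < \<epsilon>\<close> by (simp add: c_def)
    have "mat_norm ?I ?A \<le> c"
    proof (rule mat_norm_leI_bilinear)
      fix x y :: "nat \<times> nat \<Rightarrow> complex"
      assume x: "L2_set (\<lambda>j. cmod (x j)) ?I \<le> 1" and y: "L2_set (\<lambda>j. cmod (y j)) ?I \<le> 1"
      define X where "X q t = (\<Sum>j<n. x (q, j) * torus_monomial d (e j) t)" for q t
      define Y where "Y q t = (\<Sum>j<n. y (q, j) * torus_monomial d (e j) t)" for q t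
      define H where "H t = (\<Sum>p<m. \<Sum>q<m. Y p t * g p q t * X q t)" for t
      have sq: "integrable ?T (\<lambda>t. \<Sum>q<m. (cmod (\<Sum>j<n. v (q, j) * torus_monomial d (e j) t))\<^sup>2)"
        "(LINT t|?T. (\<Sum>q<m. (cmod (\<Sum>j<n. v (q, j) * torus_monomial d (e j) t))\<^sup>2)) \<le> 1"
        if "L2_set (\<lambda>j. cmod (v j)) ?I \<le> 1" for v :: "nat \<times> nat \<Rightarrow> complex"
      proof -
        have pars: "integrable ?T (\<lambda>t. (cmod (\<Sum>j<n. v (q, j) * torus_monomial d (e j) t))\<^sup>2)"
          "(LINT t|?T. (cmod (\<Sum>j<n. v (q, j) * torus_monomial d (e j) t))\<^sup>2) = (\<Sum>j<n. (cmod (v (q, j)))\<^sup>2)" for q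
          using torus_parseval[of "{..<n}" d e "\<lambda>j. v (q, j)"] inj by simp_all
        show "integrable ?T (\<lambda>t. \<Sum>q<m. (cmod (\<Sum>j<n. v (q, j) * torus_monomial d (e j) t))\<^sup>2)"
          by (intro Bochner_Integration.integrable_sum pars(1))
        have "(LINT t|?T. (\<Sum>q<m. (cmod (\<Sum>j<n. v (q, j) * torus_monomial d (e j) t))\<^sup>2)) =
            (\<Sum>q<m. \<Sum>j<n. (cmod (v (q, j)))\<^sup>2)"
          by (simp only: Bochner_Integration.integral_sum pars)
        also have "\<dots> = (\<Sum>u\<in>?I. (cmod (v u))\<^sup>2)"
          by (simp add: sum.cartesian_product)
        also have "\<dots> \<le> 1"
          using that by (simp add: L2_set_def)
        finally show "(LINT t|?T. (\<Sum>q<m. (cmod (\<Sum>j<n. v (q, j) * torus_monomial d (e j) t))\<^sup>2)) \<le> 1" .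
      qed
      have Heq: "H t = (\<Sum>u\<in>?I. \<Sum>v\<in>?I. y u * (?F (snd u) (snd v) t * g (fst u) (fst v) t) * x v)" for t
      proof -
        have "H t = (\<Sum>p<m. \<Sum>q<m. \<Sum>i<n. \<Sum>j<n. y (p, i) * (?F i j t * g p q t) * x (q, j))"
          unfolding H_def X_def Y_def
          by (simp add: sum_distrib_left sum_distrib_right torus_monomial_add mult_ac)
        also have "\<dots> = (\<Sum>p<m. \<Sum>i<n. \<Sum>q<m. \<Sum>j<n. y (p, i) * (?F i j t * g p q t) * x (q, j))"
          by (intro sum.cong refl sum.swap)
        also have "\<dots> = (\<Sum>u\<in>?I. \<Sum>v\<in>?I. y u * (?F (snd u) (snd v) t * g (fst u) (fst v) t) * x v)"
          by (simp only: sum_Times fst_conv snd_conv)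
        finally show ?thesis .
      qed
      have Hint: "integrable ?T H"
        unfolding Heq using gint
        by (intro Bochner_Integration.integrable_sum integrable_mult_left integrable_mult_right) auto
      have "(\<Sum>u\<in>?I. \<Sum>v\<in>?I. y u * ?A u v * x v) = (LINT t|?T. H t)"
      proof -
        have "(LINT t|?T. H t) = (\<Sum>u\<in>?I. LINT t|?T. (\<Sum>v\<in>?I. y u * (?F (snd u) (snd v) t * g (fst u) (fst v) t) * x v))"
          unfolding Heq using gint
          by (intro Bochner_Integration.integral_sum Bochner_Integration.integrable_sum integrable_mult_left integrable_mult_right) auto
        also have "\<dots> = (\<Sum>u\<in>?I. \<Sum>v\<in>?I. LINT t|?T. y u * (?F (snd u) (snd v) t * g (fst u) (fst v) t) * x v)"
          using gint
          by (intro sum.cong refl Bochner_Integration.integral_sum integrable_mult_left integrable_mult_right) auto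
        also have "\<dots> = (\<Sum>u\<in>?I. \<Sum>v\<in>?I. y u * ?A u v * x v)"
          by (simp add: case_prod_unfold)
        finally show ?thesis ..
      qed
      also have "cmod \<dots> \<le> (LINT t|?T. cmod (H t))"
        by (rule integral_norm_bound)
      also have "\<dots> \<le> (LINT t|?T. c / 2 * ((\<Sum>q<m. (cmod (X q t))\<^sup>2) + (\<Sum>q<m. (cmod (Y q t))\<^sup>2)))"
      proof (rule integral_mono_AE)
        show "integrable ?T (\<lambda>t. cmod (H t))" using Hint by (rule integrable_norm)
        show "integrable ?T (\<lambda>t. c / 2 * ((\<Sum>q<m. (cmod (X q t))\<^sup>2) + (\<Sum>q<m. (cmod (Y q t))\<^sup>2)))"
          using sq(1)[OF x] sq(1)[OF y] unfolding X_def Y_def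
          by (intro integrable_mult_right Bochner_Integration.integrable_add)
        show "AE t in ?T. cmod (H t) \<le> c / 2 * ((\<Sum>q<m. (cmod (X q t))\<^sup>2) + (\<Sum>q<m. (cmod (Y q t))\<^sup>2))"
          using Linf_mnorm_leD[OF g1 c]
        proof eventually_elim
          case (elim t)
          define a where "a = L2_set (\<lambda>q. cmod (X q t)) {..<m}"
          define b where "b = L2_set (\<lambda>q. cmod (Y q t)) {..<m}"
          have "cmod (H t) \<le> mat_norm {..<m} (\<lambda>p q. g p q t) * a * b"
            unfolding H_def a_def b_def by (rule mat_norm_bilinear) simp
          also have "\<dots> \<le> c * a * b"
            using elim by (intro mult_right_mono) (simp_all add: a_def b_def)
          also have "\<dots> = c * (a * b)" by simp
          also have "\<dots> \<le> c * ((a\<^sup>2 + b\<^sup>2) / 2)"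
            using c sum_squares_bound[of a b] by (intro mult_left_mono) auto
          also have "\<dots> = c / 2 * ((\<Sum>q<m. (cmod (X q t))\<^sup>2) + (\<Sum>q<m. (cmod (Y q t))\<^sup>2))"
            by (simp add: a_def b_def L2_set_def sum_nonneg)
          finally show ?case .
        qed
      qed
      also have "\<dots> = c / 2 * ((LINT t|?T. (\<Sum>q<m. (cmod (X q t))\<^sup>2)) + (LINT t|?T. (\<Sum>q<m. (cmod (Y q t))\<^sup>2)))"
        using sq(1)[OF x] sq(1)[OF y] unfolding X_def Y_def by simp
      also have "\<dots> \<le> c / 2 * (1 + 1)"
        using c sq(2)[OF x] sq(2)[OF y] unfolding X_def Y_def by (intro mult_left_mono add_mono) auto
      finally show "cmod (\<Sum>u\<in>?I. \<Sum>v\<in>?I. y u * ?A u v * x v) \<le> c" by simp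
    qed (use c in auto)
    then show "mat_norm ?I ?A \<le> 1 + \<epsilon>" by (simp add: c_def)
  qed
qed

lemma sum_PiE_prod:
  fixes F :: "nat \<Rightarrow> 'a \<Rightarrow> real"
  assumes "finite B"
  shows "(\<Sum>\<alpha>\<in>{..<d} \<rightarrow>\<^sub>E B. \<Prod>j<d. F j (\<alpha> j)) = (\<Prod>j<d. \<Sum>k\<in>B. F j k)"
  using assms by (subst prod_sum_PiE) auto

text \<open>For the entries \<open>z\<^sup>k\<^sup>+\<^sup>l\<close>, rows and columns of the matrix of inner products are pairs of multi-indices. The
  row \<open>(k, k)\<close> and the column \<open>(l, l)\<close> meet in \<open>\<Prod>\<^sub>j 1/(k\<^sub>j + l\<^sub>j + 1)\<close>, so that on the diagonal one finds the
  \<open>d\<close>-fold tensor power of a finite section of the Hilbert matrix; the tensor power of a test vector then gives the \<open>d\<close>-th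
  power of the quotient in one variable. The function \<open>e\<close> enumerates the multi-indices with entries below some \<open>N\<close>.\<close>

lemma hankel_hol_ext_lower_bound:
  assumes c: "0 \<le> c" "c < pi"
  obtains n e where "\<forall>i<n. \<forall>j<n. (\<forall>l<d. e i l = e j l) \<longrightarrow> i = (j :: nat)"
    "c ^ d \<le> mat_norm ({..<n} \<times> {..<n}) (\<lambda>(p, r) (q, s). LINT z|polydisc_measure d.
      hol_ext d (torus_monomial d (\<lambda>l. e p l + e q l)) z * cnj (hol_ext d (torus_monomial d (\<lambda>l. e r l + e s l)) z))"
proof -
  obtain N where N: "N > 0"
    and le: "c * (\<Sum>j<N. (central_coeff j)\<^sup>2) \<le> (\<Sum>i<N. \<Sum>j<N. central_coeff i * central_coeff j / (i + j + 1))"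
    using hilbert_matrix_lower_bound[OF c] .
  define A where "A = {..<d} \<rightarrow>\<^sub>E {..<N}"
  have "finite A" unfolding A_def by (intro finite_PiE) auto
  then obtain e where e: "bij_betw e {0..<card A} A" using ex_bij_betw_nat_finite by blast
  define n where "n = card A"
  have bij: "bij_betw e {..<n} A" using e by (simp add: n_def lessThan_atLeast0)
  define W where "W \<alpha> = (\<Prod>j<d. central_coeff (\<alpha> j))" for \<alpha> :: "nat \<Rightarrow> nat"
  define S where "S = (\<Sum>j<N. (central_coeff j)\<^sup>2)"
  define Q where "Q = (\<Sum>i<N. \<Sum>j<N. central_coeff i * central_coeff j / (i + j + 1))"
  have "S > 0"
    unfolding S_def by (intro sum_pos zero_less_power central_coeff_pos) (use N in auto)
  let ?h = "\<lambda>p q. hol_ext d (torus_monomial d (\<lambda>l. e p l + e q l))"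
  let ?A = "\<lambda>(p, r) (q, s). LINT z|polydisc_measure d. ?h p q z * cnj (?h r s z)"
  let ?I = "{..<n} \<times> {..<n}"
  define x where "x u = (if fst u = snd u then complex_of_real (W (e (fst u))) else 0)" for u :: "nat \<times> nat"
  have diag: "(\<Sum>u\<in>?I. if fst u = snd u then h u else 0) = (\<Sum>p<n. h (p, p))" for h :: "nat \<times> nat \<Rightarrow> complex"
  proof -
    have "(\<Sum>u\<in>?I. if fst u = snd u then h u else 0) = (\<Sum>p<n. \<Sum>q<n. if p = q then h (p, q) else 0)"
      by (simp only: sum_Times fst_conv snd_conv)
    then show ?thesis by simp
  qed
  have entry: "?A (p, p) (q, q) = of_real (\<Prod>j<d. 1 / (real (e p j + e q j) + 1))" for p q
    using polydisc_monomial_inner[of d "\<lambda>l. e p l + e q l"] by (simp add: hol_ext_monomial)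
  have "(\<Sum>u\<in>?I. \<Sum>v\<in>?I. x u * ?A u v * x v) =
      (\<Sum>u\<in>?I. if fst u = snd u then (\<Sum>v\<in>?I. if fst v = snd v then of_real (W (e (fst u))) * ?A u v * of_real (W (e (fst v))) else 0) else 0)"
    by (auto intro!: sum.cong simp: x_def)
  also have "\<dots> = (\<Sum>p<n. \<Sum>q<n. of_real (W (e p)) * ?A (p, p) (q, q) * of_real (W (e q)))"
    by (simp only: diag fst_conv)
  also have "\<dots> = of_real (\<Sum>p<n. \<Sum>q<n. \<Prod>j<d. central_coeff (e p j) * central_coeff (e q j) / (e p j + e q j + 1))"
    unfolding entry by (simp add: W_def prod.distrib prod_dividef mult_ac add_ac)
  also have "(\<Sum>p<n. \<Sum>q<n. \<Prod>j<d. central_coeff (e p j) * central_coeff (e q j) / (e p j + e q j + 1)) =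
      (\<Sum>\<alpha>\<in>A. \<Sum>\<beta>\<in>A. \<Prod>j<d. central_coeff (\<alpha> j) * central_coeff (\<beta> j) / (\<alpha> j + \<beta> j + 1))"
    using sum.reindex_bij_betw[OF bij, of "\<lambda>\<alpha>. \<Sum>\<beta>\<in>A. \<Prod>j<d. central_coeff (\<alpha> j) * central_coeff (\<beta> j) / (\<alpha> j + \<beta> j + 1)"]
      sum.reindex_bij_betw[OF bij, of "\<lambda>\<beta>. \<Prod>j<d. central_coeff (\<alpha> j) * central_coeff (\<beta> j) / (\<alpha> j + \<beta> j + 1)" for \<alpha>]
    by simp
  also have "\<dots> = (\<Sum>\<alpha>\<in>A. \<Prod>j<d. \<Sum>k<N. central_coeff (\<alpha> j) * central_coeff k / (\<alpha> j + k + 1))"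
    unfolding A_def by (intro sum.cong refl sum_PiE_prod) simp
  also have "\<dots> = (\<Prod>j<d. Q)"
    unfolding A_def Q_def by (rule sum_PiE_prod) simp
  finally have form: "(\<Sum>u\<in>?I. \<Sum>v\<in>?I. x u * ?A u v * x v) = of_real (Q ^ d)" by simp
  have normx: "(L2_set (\<lambda>u. cmod (x u)) ?I)\<^sup>2 = S ^ d"
  proof -
    have "(L2_set (\<lambda>u. cmod (x u)) ?I)\<^sup>2 = (\<Sum>u\<in>?I. (cmod (x u))\<^sup>2)"
      by (simp add: L2_set_def sum_nonneg)
    also have "complex_of_real \<dots> = (\<Sum>u\<in>?I. if fst u = snd u then of_real ((W (e (fst u)))\<^sup>2) else 0)"
      unfolding of_real_sum by (intro sum.cong refl) (simp add: x_def del: of_real_power)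
    also have "\<dots> = of_real (\<Sum>p<n. (W (e p))\<^sup>2)"
      unfolding diag by simp
    finally have "(L2_set (\<lambda>u. cmod (x u)) ?I)\<^sup>2 = (\<Sum>p<n. (W (e p))\<^sup>2)"
      by (simp only: of_real_eq_iff)
    also have "\<dots> = (\<Sum>\<alpha>\<in>A. (W \<alpha>)\<^sup>2)"
      by (rule sum.reindex_bij_betw[OF bij])
    also have "\<dots> = (\<Sum>\<alpha>\<in>A. \<Prod>j<d. (central_coeff (\<alpha> j))\<^sup>2)"
      by (simp add: W_def prod_power_distrib)
    also have "\<dots> = (\<Prod>j<d. S)"
      unfolding A_def S_def by (rule sum_PiE_prod) simp
    finally show ?thesis by simp
  qed
  have "Q ^ d \<le> mat_norm ?I ?A * S ^ d"
  proof -
    have "0 \<le> Q" unfolding Q_def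
      by (intro sum_nonneg divide_nonneg_nonneg mult_nonneg_nonneg less_imp_le[OF central_coeff_pos]) auto
    then have "Q ^ d = cmod (\<Sum>u\<in>?I. \<Sum>v\<in>?I. x u * ?A u v * x v)"
      unfolding form by (simp add: norm_power)
    also have "\<dots> \<le> mat_norm ?I ?A * L2_set (\<lambda>u. cmod (x u)) ?I * L2_set (\<lambda>u. cmod (x u)) ?I"
      by (rule mat_norm_bilinear) simp
    also have "\<dots> = mat_norm ?I ?A * S ^ d"
      using normx by (simp add: power2_eq_square)
    finally show ?thesis .
  qed
  moreover have "c ^ d * S ^ d \<le> Q ^ d"
    using le c \<open>S > 0\<close> unfolding S_def[symmetric] Q_def[symmetric] power_mult_distrib[symmetric]
    by (intro power_mono) auto
  ultimately have "c ^ d * S ^ d \<le> mat_norm ?I ?A * S ^ d" by linarith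
  then have "c ^ d \<le> mat_norm ?I ?A"
    using \<open>S > 0\<close> by simp
  moreover have "i = j" if "i < n" "j < n" "\<forall>l<d. e i l = e j l" for i j
  proof -
    have "e i \<in> A" "e j \<in> A" using bij that by (auto simp: bij_betw_def)
    then have "e i = e j" using that(3) unfolding A_def by (intro PiE_ext) auto
    then show ?thesis using bij that by (auto simp: bij_betw_def inj_on_def)
  qed
  ultimately show ?thesis by (intro that[of n e]) auto
qed

theorem corollary6p14:
  fixes d :: nat
  assumes "2 \<le> d"
  shows "hol_ext d \<in> elems (hardy1_os d) \<rightarrow> elems (bergman2_os d) \<and>
    cb_norm (hardy1_os d) (bergman2_os d) (hol_ext d) = ennreal (pi powr (real d / 2))"
proof (intro conjI antisym)
  have sqrt_pi: "pi powr (real d / 2) = sqrt (pi ^ d)"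
    by (simp add: powr_half_sqrt[symmetric] powr_powr flip: powr_realpow)
  show "hol_ext d \<in> elems (hardy1_os d) \<rightarrow> elems (bergman2_os d)"
    using hol_ext_in_bergman2 by (auto simp: hardy1_os_def bergman2_os_def subspace_os_def L2_os_def bergman2_def)
  show "cb_norm (hardy1_os d) (bergman2_os d) (hol_ext d) \<le> ennreal (pi powr (real d / 2))"
    unfolding cb_norm_def
  proof (intro SUP_least)
    fix n x
    assume "x \<in> {x. (\<forall>i<n. \<forall>j<n. x i j \<in> elems (hardy1_os d)) \<and> mnorm (hardy1_os d) n x \<le> 1}"
    then have x: "\<And>i j. i < n \<Longrightarrow> j < n \<Longrightarrow> x i j \<in> hardy1 d" and 1: "mnorm (L1_os (torus_measure d)) n x \<le> 1"
      by (auto simp: hardy1_os_def subspace_os_def)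
    show "mnorm (bergman2_os d) n (\<lambda>i j. hol_ext d (x i j)) \<le> ennreal (pi powr (real d / 2))"
      using hol_ext_matrix_bound[OF x 1]
      by (auto simp: bergman2_os_def subspace_os_def L2_os_def sqrt_pi intro!: ennreal_leI real_sqrt_le_mono)
  qed
  show "ennreal (pi powr (real d / 2)) \<le> cb_norm (hardy1_os d) (bergman2_os d) (hol_ext d)"
  proof (rule LIMSEQ_le_const2)
    define c where "c k = pi * (1 - 1 / (real k + 2))" for k :: nat
    have "c \<longlonglongrightarrow> pi" unfolding c_def by real_asymp
    then show "(\<lambda>k. ennreal (sqrt (c k ^ d))) \<longlonglongrightarrow> ennreal (pi powr (real d / 2))"
      unfolding sqrt_pi by (intro tendsto_ennrealI tendsto_real_sqrt tendsto_power)
    have "ennreal (sqrt (c k ^ d)) \<le> cb_norm (hardy1_os d) (bergman2_os d) (hol_ext d)" for k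
    proof -
      have c: "0 \<le> c k" "c k < pi" by (auto simp: c_def field_simps)
      obtain n e where inj: "\<forall>i<n. \<forall>j<n. (\<forall>l<d. e i l = e j l) \<longrightarrow> i = (j :: nat)"
        and le: "c k ^ d \<le> mat_norm ({..<n} \<times> {..<n}) (\<lambda>(p, r) (q, s). LINT z|polydisc_measure d.
          hol_ext d (torus_monomial d (\<lambda>l. e p l + e q l)) z * cnj (hol_ext d (torus_monomial d (\<lambda>l. e r l + e s l)) z))"
        by (rule hankel_hol_ext_lower_bound[OF c, of d])
      let ?x = "\<lambda>i j. torus_monomial d (\<lambda>l. e i l + e j l)"
      have "ennreal (sqrt (c k ^ d)) \<le> mnorm (bergman2_os d) n (\<lambda>i j. hol_ext d (?x i j))"
        using le by (auto simp: bergman2_os_def subspace_os_def L2_os_def intro!: ennreal_leI real_sqrt_le_mono)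
      also have "\<dots> \<le> cb_norm (hardy1_os d) (bergman2_os d) (hol_ext d)"
        unfolding cb_norm_def
      proof (intro SUP_upper2[of n] SUP_upper)
        show "?x \<in> {x. (\<forall>i<n. \<forall>j<n. x i j \<in> elems (hardy1_os d)) \<and> mnorm (hardy1_os d) n x \<le> 1}"
          using hankel_contraction[of n d e] inj torus_monomial_in_hardy1 integrable_monomial
          by (auto simp: hardy1_os_def subspace_os_def L1_os_def)
      qed simp
      finally show ?thesis .
    qed
    then show "\<exists>N. \<forall>k\<ge>N. ennreal (sqrt (c k ^ d)) \<le> cb_norm (hardy1_os d) (bergman2_os d) (hol_ext d)"
      by blast
  qed
qed

end
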